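(* Let $\emptyset$ be the empty 2-category and let $\mathsf{Bi}^{\mathsf{fsy}}_{\mathsf r}$ be the 2-category of flat small symmetric bimonoidal categories, robust symmetric bimonoidal functors, and bimonoidal natural transformations. The finite ordinal category $\Sigma$ is a lax bicolimit of the unique 2-functor $\emptyset\to\mathsf{Bi}^{\mathsf{fsy}}_{\mathsf r}$. That is, $\Sigma$ is an object of $\mathsf{Bi}^{\mathsf{fsy}}_{\mathsf r}$ and, for every flat small symmetric bimonoidal category $C$, the unique functor $\mathsf{Bi}^{\mathsf{fsy}}_{\mathsf r}(\Sigma,C)\to\mathbf 1$ to the terminal category is an equivalence of categories.
   Context: Write $AB$ for $A\otimes B$; $\otimes$ binds tighter than $\oplus$. A bimonoidal category is a category $C$ with a symmetric monoidal structure $(\oplus,0,\alpha^\oplus,\lambda^\oplus,\rho^\oplus,\zeta^\oplus)$, a monoidal structure $(\otimes,1,\alpha^\otimes,\lambda^\otimes,\rho^\otimes)$ (with $\alpha_{A,B,C}:(AB)C\to A(BC)$, $\lambda_A$, $\rho_A$ the left/right unit isomorphisms), natural isomorphisms $\lambda^\bullet_A:0A\to0$, $\rho^\bullet_A:A0\to 0$, and natural monomorphisms $\delta^l_{A,B,C}:A(B\oplus C)\to AB\oplus AC$, $\delta^r_{A,B,C}:(A\oplus B)C\to AC\oplus BC$, such that for all objects: $\delta^l_{A,C,B}(1\otimes\zeta^\oplus_{B,C})=\zeta^\oplus_{AB,AC}\delta^l_{A,B,C}$; $\delta^r_{B,A,C}(\zeta^\oplus_{A,B}\otimes1)=\zeta^\oplus_{AC,BC}\delta^r_{A,B,C}$;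 $\alpha^\oplus(\delta^r_{A,B,D}\oplus1)\delta^r_{A\oplus B,C,D}=(1\oplus\delta^r_{B,C,D})\delta^r_{A,B\oplus C,D}(\alpha^\oplus_{A,B,C}\otimes1)$; $\alpha^\oplus(\delta^l_{A,B,C}\oplus1)\delta^l_{A,B\oplus C,D}=(1\oplus\delta^l_{A,C,D})\delta^l_{A,B,C\oplus D}(1\otimes\alpha^\oplus_{B,C,D})$; $\delta^l_{A,BC,BD}(1\otimes\delta^l_{B,C,D})\alpha^\otimes_{A,B,C\oplus D}=(\alpha^\otimes_{A,B,C}\oplus\alpha^\otimes_{A,B,D})\delta^l_{AB,C,D}$; $(\alpha^\otimes_{A,C,D}\oplus\alpha^\otimes_{B,C,D})\delta^r_{AC,BC,D}(\delta^r_{A,B,C}\otimes1)=\delta^r_{A,B,CD}\alpha^\otimes_{A\oplus B,C,D}$; $(\alpha^\otimes_{A,B,D}\oplus\alpha^\otimes_{A,C,D})\delta^r_{AB,AC,D}(\delta^l_{A,B,C}\otimes1)=\delta^l_{A,BD,CD}(1\otimes\delta^r_{B,C,D})\alpha^\otimes_{A,B\oplus C,D}$; $\mu(\delta^l_{A,C,D}\oplus\delta^l_{B,C,D})\delta^r_{A,B,C\oplus D}=(\delta^r_{A,B,C}\oplus\delta^r_{A,B,D})\delta^l_{A\oplus B,C,D}$, where $\mu:(AC\oplus AD)\oplus(BC\oplus BD)\to(AC\oplus BC)\oplus(AD\oplus BD)$ is the coherence isomorphism exchanging the two middle summands; $\lambda^\bullet_0=\rho^\bullet_0$; $\lambda^\oplus_0(\lambda^\bullet_A\oplus\lambda^\bullet_B)\delta^l_{0,A,B}=\lambda^\bullet_{A\oplus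 B}$; $\lambda^\oplus_0(\rho^\bullet_A\oplus\rho^\bullet_B)\delta^r_{A,B,0}=\rho^\bullet_{A\oplus B}$; $\rho^\otimes_0=\lambda^\bullet_1$; $\lambda^\otimes_0=\rho^\bullet_1$; $\lambda^\bullet_{AB}\alpha^\otimes_{0,A,B}=\lambda^\bullet_B(\lambda^\bullet_A\otimes1)$; $\rho^\bullet_A(1\otimes\lambda^\bullet_B)\alpha^\otimes_{A,0,B}=\lambda^\bullet_B(\rho^\bullet_A\otimes1)$; $\rho^\bullet_A(1\otimes\rho^\bullet_B)\alpha^\otimes_{A,B,0}=\rho^\bullet_{AB}$; $\lambda^\oplus_{AB}(\rho^\bullet_A\oplus1)\delta^l_{A,0,B}=1\otimes\lambda^\oplus_B$; $\lambda^\oplus_{BA}(\lambda^\bullet_A\oplus1)\delta^r_{0,B,A}=\lambda^\oplus_B\otimes1$; $\rho^\oplus_{AB}(1\oplus\rho^\bullet_A)\delta^l_{A,B,0}=1\otimes\rho^\oplus_B$; $\rho^\oplus_{AB}(1\oplus\lambda^\bullet_B)\delta^r_{A,0,B}=\rho^\oplus_A\otimes1$; $(\lambda^\otimes_A\oplus\lambda^\otimes_B)\delta^l_{1,A,B}=\lambda^\otimes_{A\oplus B}$; $(\rho^\otimes_A\oplus\rho^\otimes_B)\delta^r_{A,B,1}=\rho^\otimes_{A\oplus B}$. A symmetric bimonoidal category is a bimonoidal category with a symmetry $\zeta^\otimes$ making $\otimes$ symmetric monoidal, such that $\delta^l_{C,A,B}\zeta^\otimes_{A\oplus B,C}=(\zeta^\otimes_{A,C}\oplus\zeta^\otimes_{B,C})\delta^r_{A,B,C}$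 and $\lambda^\bullet_A\zeta^\otimes_{A,0}=\rho^\bullet_A$. It is flat if every morphism in the following class is a monomorphism: the smallest class containing all components of $\delta^l,\delta^r$ and closed under $f\mapsto f\oplus1_A,\ 1_A\oplus f,\ f\otimes1_A,\ 1_A\otimes f$ for all objects $A$. A symmetric bimonoidal functor $F:C\to D$ is a functor with symmetric monoidal structures $(F^2_\oplus,F^0_\oplus)$ with respect to $\oplus$ and $(F^2_\otimes,F^0_\otimes)$ with respect to $\otimes$ (lax: $F^2_\otimes:FA\otimes FB\to F(A\otimes B)$, $F^0_\otimes:1\to F1$, similarly for $\oplus$) such that $F(\lambda^\bullet_A)F^2_\otimes(F^0_\oplus\otimes1_{FA})=F^0_\oplus\lambda^\bullet_{FA}$ and $F(\delta^l_{A,B,C})F^2_\otimes(1\otimes F^2_\oplus)=F^2_\oplus(F^2_\otimes\oplus F^2_\otimes)\delta^l_{FA,FB,FC}$. It is robust if $F^2_\oplus,F^0_\oplus,F^0_\otimes$ are isomorphisms. A bimonoidal natural transformation is a natural transformation that is monoidal with respect to both the $\oplus$ and the $\otimes$ structures. The finite ordinal category $\Sigma$ has objects the integers $n\ge0$; $\Sigma(n,n)$ is the symmetric group $\Sigma_n$ and there are no other morphisms. Sum: $m\oplus n=m+n$, block sum of permutations; $\zeta^\oplus_{m,n}$ swaps the two blocks. Product: $m\otimes n=mn$, where $(i,j)$ with $1\le i\le m$, $1\le j\le n$ is identified with $i+(j-1)m$, and $(\sigma\otimes\tau)(i,j)=(\sigma i,\tau j)$; $\zeta^\otimes_{m,n}(i,j)=(j,i)$.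 All associativity and unit isomorphisms, $\lambda^\bullet$, $\rho^\bullet$ and $\delta^l$ are identities; $\delta^r_{m,n,p}:(m+n)p\to mp+np$ is the permutation sending $(i,j)$ with $i\le m$ to $i+(j-1)m$ and $(m+i,j)$ with $1\le i\le n$ to $mp+i+(j-1)n$. *)

theory Defs
  imports "HOL-Library.FuncSet" "HOL-Combinatorics.Permutations"
begin

section \<open>Categories\<close>

text \<open>\<open>g \<cdot> f\<close> is ``first \<open>f\<close>, then \<open>g\<close>''.
  Only the values of the operations on the carriers \<open>Obj C\<close> and \<open>Arr C\<close> matter.  As the carriers
  are sets of a type, every such category is small.\<close>

record ('o, 'm) cat_data =
  Obj :: "'o set"
  Arr :: "'m set"
  Dom :: "'m \<Rightarrow> 'o"
  Cod :: "'m \<Rightarrow> 'o"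
  Ident :: "'o \<Rightarrow> 'm"  (\<open>\<iota>\<index>\<close>)
  Comp :: "'m \<Rightarrow> 'm \<Rightarrow> 'm"  (infixr \<open>\<cdot>\<index>\<close> 55)

definition hom :: "('o, 'm, 'z) cat_data_scheme \<Rightarrow> 'o \<Rightarrow> 'o \<Rightarrow> 'm set" where
  "hom C A B = {f \<in> Arr C. Dom C f = A \<and> Cod C f = B}"

locale category =
  fixes C :: "('o, 'm, 'z) cat_data_scheme" (structure)
  assumes Dom_in_Obj: "f \<in> Arr C \<Longrightarrow> Dom C f \<in> Obj C"
    and Cod_in_Obj: "f \<in> Arr C \<Longrightarrow> Cod C f \<in> Obj C"
    and Ident_in_hom: "A \<in> Obj C \<Longrightarrow> \<iota> A \<in> hom C A A"
    and Comp_in_hom: "\<lbrakk>f \<in> Arr C; g \<in> Arr C; Dom C g = Cod C f\<rbrakk>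
          \<Longrightarrow> g \<cdot> f \<in> hom C (Dom C f) (Cod C g)"
    and Comp_assoc: "\<lbrakk>f \<in> Arr C; g \<in> Arr C; h \<in> Arr C; Dom C g = Cod C f; Dom C h = Cod C g\<rbrakk>
          \<Longrightarrow> (h \<cdot> g) \<cdot> f = h \<cdot> (g \<cdot> f)"
    and Ident_left: "f \<in> Arr C \<Longrightarrow> \<iota> (Cod C f) \<cdot> f = f"
    and Ident_right: "f \<in> Arr C \<Longrightarrow> f \<cdot> \<iota> (Dom C f) = f"

definition inverse_arrows :: "('o, 'm, 'z) cat_data_scheme \<Rightarrow> 'm \<Rightarrow> 'm \<Rightarrow> bool" where
  "inverse_arrows C f g \<longleftrightarrow> f \<in> Arr C \<and> g \<in> hom C (Cod C f) (Dom C f) \<and>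
     g \<cdot>\<^bsub>C\<^esub> f = \<iota>\<^bsub>C\<^esub> (Dom C f) \<and> f \<cdot>\<^bsub>C\<^esub> g = \<iota>\<^bsub>C\<^esub> (Cod C f)"

definition iso_arr :: "('o, 'm, 'z) cat_data_scheme \<Rightarrow> 'm \<Rightarrow> bool" where
  "iso_arr C f \<longleftrightarrow> (\<exists>g. inverse_arrows C f g)"

definition inv_arr :: "('o, 'm, 'z) cat_data_scheme \<Rightarrow> 'm \<Rightarrow> 'm" where
  "inv_arr C f = (THE g. inverse_arrows C f g)"

definition mono_arr :: "('o, 'm, 'z) cat_data_scheme \<Rightarrow> 'm \<Rightarrow> bool" where
  "mono_arr C f \<longleftrightarrow> f \<in> Arr C \<and>
     (\<forall>g h. g \<in> Arr C \<and> h \<in> Arr C \<and> Cod C g = Dom C f \<and> Cod C h = Dom C f \<and>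
        Dom C g = Dom C h \<and> f \<cdot>\<^bsub>C\<^esub> g = f \<cdot>\<^bsub>C\<^esub> h \<longrightarrow> g = h)"


section \<open>Functors, natural transformations and equivalences\<close>

text \<open>Functors and families of components are required to be \<open>undefined\<close> off their domains, so that
  HOL equality is equality of functors and of transformations.\<close>

record ('o1, 'm1, 'o2, 'm2) functor_data =
  OMap :: "'o1 \<Rightarrow> 'o2"
  AMap :: "'m1 \<Rightarrow> 'm2"

locale category_functor = A: category A + B: category B
  for A :: "('o1, 'm1, 'y) cat_data_scheme"
    and B :: "('o2, 'm2, 'z) cat_data_scheme"
    and F :: "('o1, 'm1, 'o2, 'm2, 'w) functor_data_scheme" +
  assumes OMap_in_Obj: "a \<in> Obj A \<Longrightarrow> OMap F a \<in> Obj B"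
    and AMap_in_hom: "f \<in> Arr A \<Longrightarrow> AMap F f \<in> hom B (OMap F (Dom A f)) (OMap F (Cod A f))"
    and AMap_Ident: "a \<in> Obj A \<Longrightarrow> AMap F (\<iota>\<^bsub>A\<^esub> a) = \<iota>\<^bsub>B\<^esub> (OMap F a)"
    and AMap_Comp: "\<lbrakk>f \<in> Arr A; g \<in> Arr A; Dom A g = Cod A f\<rbrakk>
          \<Longrightarrow> AMap F (g \<cdot>\<^bsub>A\<^esub> f) = AMap F g \<cdot>\<^bsub>B\<^esub> AMap F f"
    and OMap_extensional: "OMap F \<in> extensional (Obj A)"
    and AMap_extensional: "AMap F \<in> extensional (Arr A)"

definition id_functor :: "('o, 'm, 'z) cat_data_scheme \<Rightarrow> ('o, 'm, 'o, 'm) functor_data" where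
  "id_functor A = \<lparr>OMap = (\<lambda>a\<in>Obj A. a), AMap = (\<lambda>f\<in>Arr A. f)\<rparr>"

definition comp_functor ::
  "('o1, 'm1, 'z) cat_data_scheme \<Rightarrow> ('o2, 'm2, 'o3, 'm3) functor_data \<Rightarrow>
   ('o1, 'm1, 'o2, 'm2) functor_data \<Rightarrow> ('o1, 'm1, 'o3, 'm3) functor_data" where
  "comp_functor A G F =
     \<lparr>OMap = (\<lambda>a\<in>Obj A. OMap G (OMap F a)), AMap = (\<lambda>f\<in>Arr A. AMap G (AMap F f))\<rparr>"

locale natural_transformation = F: category_functor A B F + G: category_functor A B G
  for A :: "('o1, 'm1, 'y) cat_data_scheme"
    and B :: "('o2, 'm2, 'z) cat_data_scheme"
    and F :: "('o1, 'm1, 'o2, 'm2, 'w) functor_data_scheme"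
    and G :: "('o1, 'm1, 'o2, 'm2, 'w) functor_data_scheme" +
  fixes \<eta> :: "'o1 \<Rightarrow> 'm2"
  assumes component_in_hom: "a \<in> Obj A \<Longrightarrow> \<eta> a \<in> hom B (OMap F a) (OMap G a)"
    and naturality: "f \<in> Arr A \<Longrightarrow>
          \<eta> (Cod A f) \<cdot>\<^bsub>B\<^esub> AMap F f = AMap G f \<cdot>\<^bsub>B\<^esub> \<eta> (Dom A f)"
    and component_extensional: "\<eta> \<in> extensional (Obj A)"

locale natural_isomorphism = natural_transformation +
  assumes component_iso: "a \<in> Obj A \<Longrightarrow> iso_arr B (\<eta> a)"

definition equivalence_of_categories ::
  "('o1, 'm1, 'y) cat_data_scheme \<Rightarrow> ('o2, 'm2, 'z) cat_data_scheme \<Rightarrow>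
   ('o1, 'm1, 'o2, 'm2) functor_data \<Rightarrow> bool" where
  "equivalence_of_categories A B T \<longleftrightarrow> category_functor A B T \<and>
     (\<exists>S \<eta> \<epsilon>. category_functor B A S \<and>
        natural_isomorphism A A (id_functor A) (comp_functor A S T) \<eta> \<and>
        natural_isomorphism B B (comp_functor B T S) (id_functor B) \<epsilon>)"

definition terminal_category :: "(unit, unit) cat_data" where
  "terminal_category = \<lparr>Obj = UNIV, Arr = UNIV, Dom = (\<lambda>_. ()), Cod = (\<lambda>_. ()),
     Ident = (\<lambda>_. ()), Comp = (\<lambda>_ _. ())\<rparr>"

text \<open>Uniqueness of the functor to the terminal category is automatic: any two functions into
  \<^typ>\<open>unit\<close> are equal.\<close>

definition to_terminal :: "('o, 'm, 'z) cat_data_scheme \<Rightarrow> ('o, 'm, unit, unit) functor_data" where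
  "to_terminal A = \<lparr>OMap = (\<lambda>_. ()), AMap = (\<lambda>_. ())\<rparr>"


section \<open>Monoidal categories\<close>

record ('o, 'm) tensor_data =
  tObj :: "'o \<Rightarrow> 'o \<Rightarrow> 'o"
  tArr :: "'m \<Rightarrow> 'm \<Rightarrow> 'm"
  tUnit :: 'o
  tAssoc :: "'o \<Rightarrow> 'o \<Rightarrow> 'o \<Rightarrow> 'm"
  tLeft :: "'o \<Rightarrow> 'm"
  tRight :: "'o \<Rightarrow> 'm"

locale monoidal_category = category C for C :: "('o, 'm, 'z) cat_data_scheme" (structure) +
  fixes M :: "('o, 'm) tensor_data"
  assumes tObj_in_Obj: "\<lbrakk>A \<in> Obj C; B \<in> Obj C\<rbrakk> \<Longrightarrow> tObj M A B \<in> Obj C"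
    and tArr_in_hom: "\<lbrakk>f \<in> Arr C; g \<in> Arr C\<rbrakk> \<Longrightarrow>
          tArr M f g \<in> hom C (tObj M (Dom C f) (Dom C g)) (tObj M (Cod C f) (Cod C g))"
    and tArr_Ident: "\<lbrakk>A \<in> Obj C; B \<in> Obj C\<rbrakk> \<Longrightarrow> tArr M (\<iota> A) (\<iota> B) = \<iota> (tObj M A B)"
    and tArr_Comp: "\<lbrakk>f \<in> Arr C; f' \<in> Arr C; g \<in> Arr C; g' \<in> Arr C;
            Dom C f' = Cod C f; Dom C g' = Cod C g\<rbrakk> \<Longrightarrow>
          tArr M (f' \<cdot> f) (g' \<cdot> g) = tArr M f' g' \<cdot> tArr M f g"
    and tUnit_in_Obj: "tUnit M \<in> Obj C"
    and tAssoc_in_hom: "\<lbrakk>A \<in> Obj C; B \<in> Obj C; D \<in> Obj C\<rbrakk> \<Longrightarrow>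
          tAssoc M A B D \<in> hom C (tObj M (tObj M A B) D) (tObj M A (tObj M B D))"
    and tAssoc_iso: "\<lbrakk>A \<in> Obj C; B \<in> Obj C; D \<in> Obj C\<rbrakk> \<Longrightarrow> iso_arr C (tAssoc M A B D)"
    and tAssoc_natural: "\<lbrakk>f \<in> Arr C; g \<in> Arr C; h \<in> Arr C\<rbrakk> \<Longrightarrow>
          tAssoc M (Cod C f) (Cod C g) (Cod C h) \<cdot> tArr M (tArr M f g) h =
          tArr M f (tArr M g h) \<cdot> tAssoc M (Dom C f) (Dom C g) (Dom C h)"
    and tLeft_in_hom: "A \<in> Obj C \<Longrightarrow> tLeft M A \<in> hom C (tObj M (tUnit M) A) A"
    and tLeft_iso: "A \<in> Obj C \<Longrightarrow> iso_arr C (tLeft M A)"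
    and tLeft_natural: "f \<in> Arr C \<Longrightarrow>
          tLeft M (Cod C f) \<cdot> tArr M (\<iota> (tUnit M)) f = f \<cdot> tLeft M (Dom C f)"
    and tRight_in_hom: "A \<in> Obj C \<Longrightarrow> tRight M A \<in> hom C (tObj M A (tUnit M)) A"
    and tRight_iso: "A \<in> Obj C \<Longrightarrow> iso_arr C (tRight M A)"
    and tRight_natural: "f \<in> Arr C \<Longrightarrow>
          tRight M (Cod C f) \<cdot> tArr M f (\<iota> (tUnit M)) = f \<cdot> tRight M (Dom C f)"
    and pentagon: "\<lbrakk>A \<in> Obj C; B \<in> Obj C; D \<in> Obj C; E \<in> Obj C\<rbrakk> \<Longrightarrow>
          tAssoc M A B (tObj M D E) \<cdot> tAssoc M (tObj M A B) D E =
          tArr M (\<iota> A) (tAssoc M B D E) \<cdot> tAssoc M A (tObj M B D) E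
            \<cdot> tArr M (tAssoc M A B D) (\<iota> E)"
    and triangle: "\<lbrakk>A \<in> Obj C; B \<in> Obj C\<rbrakk> \<Longrightarrow>
          tArr M (\<iota> A) (tLeft M B) \<cdot> tAssoc M A (tUnit M) B = tArr M (tRight M A) (\<iota> B)"

locale symmetric_monoidal_category = monoidal_category C M
  for C :: "('o, 'm, 'z) cat_data_scheme" (structure)
    and M :: "('o, 'm) tensor_data" +
  fixes \<zeta> :: "'o \<Rightarrow> 'o \<Rightarrow> 'm"
  assumes sym_in_hom: "\<lbrakk>A \<in> Obj C; B \<in> Obj C\<rbrakk> \<Longrightarrow> \<zeta> A B \<in> hom C (tObj M A B) (tObj M B A)"
    and sym_natural: "\<lbrakk>f \<in> Arr C; g \<in> Arr C\<rbrakk> \<Longrightarrow>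
          \<zeta> (Cod C f) (Cod C g) \<cdot> tArr M f g = tArr M g f \<cdot> \<zeta> (Dom C f) (Dom C g)"
    and sym_inverse: "\<lbrakk>A \<in> Obj C; B \<in> Obj C\<rbrakk> \<Longrightarrow> \<zeta> B A \<cdot> \<zeta> A B = \<iota> (tObj M A B)"
    and sym_hexagon: "\<lbrakk>A \<in> Obj C; B \<in> Obj C; D \<in> Obj C\<rbrakk> \<Longrightarrow>
          tAssoc M B D A \<cdot> \<zeta> A (tObj M B D) \<cdot> tAssoc M A B D =
          tArr M (\<iota> B) (\<zeta> A D) \<cdot> tAssoc M B A D \<cdot> tArr M (\<zeta> A B) (\<iota> D)"
    and sym_unit: "A \<in> Obj C \<Longrightarrow> tLeft M A \<cdot> \<zeta> A (tUnit M) = tRight M A"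


section \<open>Bimonoidal categories\<close>

record ('o, 'm) bimonoidal_data = "('o, 'm) cat_data" +
  Additive :: "('o, 'm) tensor_data"
  add_sym :: "'o \<Rightarrow> 'o \<Rightarrow> 'm"  (\<open>\<zeta>\<^sub>\<oplus>\<index>\<close>)
  Multiplicative :: "('o, 'm) tensor_data"
  left_null :: "'o \<Rightarrow> 'm"  (\<open>\<lambda>\<^sub>\<bullet>\<index>\<close>)
  right_null :: "'o \<Rightarrow> 'm"  (\<open>\<rho>\<^sub>\<bullet>\<index>\<close>)
  left_dist :: "'o \<Rightarrow> 'o \<Rightarrow> 'o \<Rightarrow> 'm"  (\<open>\<delta>\<^sub>l\<index>\<close>)
  right_dist :: "'o \<Rightarrow> 'o \<Rightarrow> 'o \<Rightarrow> 'm"  (\<open>\<delta>\<^sub>r\<index>\<close>)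

text \<open>\<open>\<oplus>\<close>, \<open>\<otimes>\<close> act on objects, \<open>\<boxplus>\<close>, \<open>\<boxtimes>\<close> are the same bifunctors on morphisms.\<close>

abbreviation add_obj (infixr \<open>\<oplus>\<index>\<close> 65) where
  "A \<oplus>\<^bsub>C\<^esub> B \<equiv> tObj (Additive C) A B"
abbreviation add_arr (infixr \<open>\<boxplus>\<index>\<close> 65) where
  "f \<boxplus>\<^bsub>C\<^esub> g \<equiv> tArr (Additive C) f g"
abbreviation zero_obj (\<open>\<zero>\<index>\<close>) where
  "\<zero>\<^bsub>C\<^esub> \<equiv> tUnit (Additive C)"
abbreviation add_assoc (\<open>\<alpha>\<^sub>\<oplus>\<index>\<close>) where
  "\<alpha>\<^sub>\<oplus>\<^bsub>C\<^esub> \<equiv> tAssoc (Additive C)"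
abbreviation add_left (\<open>\<lambda>\<^sub>\<oplus>\<index>\<close>) where
  "\<lambda>\<^sub>\<oplus>\<^bsub>C\<^esub> \<equiv> tLeft (Additive C)"
abbreviation add_right (\<open>\<rho>\<^sub>\<oplus>\<index>\<close>) where
  "\<rho>\<^sub>\<oplus>\<^bsub>C\<^esub> \<equiv> tRight (Additive C)"
abbreviation mult_obj (infixr \<open>\<otimes>\<index>\<close> 70) where
  "A \<otimes>\<^bsub>C\<^esub> B \<equiv> tObj (Multiplicative C) A B"
abbreviation mult_arr (infixr \<open>\<boxtimes>\<index>\<close> 70) where
  "f \<boxtimes>\<^bsub>C\<^esub> g \<equiv> tArr (Multiplicative C) f g"
abbreviation one_obj (\<open>\<one>\<index>\<close>) where
  "\<one>\<^bsub>C\<^esub> \<equiv> tUnit (Multiplicative C)"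
abbreviation mult_assoc (\<open>\<alpha>\<^sub>\<otimes>\<index>\<close>) where
  "\<alpha>\<^sub>\<otimes>\<^bsub>C\<^esub> \<equiv> tAssoc (Multiplicative C)"
abbreviation mult_left (\<open>\<lambda>\<^sub>\<otimes>\<index>\<close>) where
  "\<lambda>\<^sub>\<otimes>\<^bsub>C\<^esub> \<equiv> tLeft (Multiplicative C)"
abbreviation mult_right (\<open>\<rho>\<^sub>\<otimes>\<index>\<close>) where
  "\<rho>\<^sub>\<otimes>\<^bsub>C\<^esub> \<equiv> tRight (Multiplicative C)"

text \<open>The coherence isomorphism \<open>(X \<oplus> Y) \<oplus> (Z \<oplus> W) \<rightarrow> (X \<oplus> Z) \<oplus> (Y \<oplus> W)\<close>.\<close>

definition middle_swap ::
  "('o, 'm, 'z) bimonoidal_data_scheme \<Rightarrow> 'o \<Rightarrow> 'o \<Rightarrow> 'o \<Rightarrow> 'o \<Rightarrow> 'm"  (\<open>\<mu>\<index>\<close>) where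
  "\<mu>\<^bsub>C\<^esub> X Y Z W =
     inv_arr C (\<alpha>\<^sub>\<oplus>\<^bsub>C\<^esub> X Z (Y \<oplus>\<^bsub>C\<^esub> W))
     \<cdot>\<^bsub>C\<^esub> (\<iota>\<^bsub>C\<^esub> X \<boxplus>\<^bsub>C\<^esub> (\<alpha>\<^sub>\<oplus>\<^bsub>C\<^esub> Z Y W
          \<cdot>\<^bsub>C\<^esub> (\<zeta>\<^sub>\<oplus>\<^bsub>C\<^esub> Y Z \<boxplus>\<^bsub>C\<^esub> \<iota>\<^bsub>C\<^esub> W)
          \<cdot>\<^bsub>C\<^esub> inv_arr C (\<alpha>\<^sub>\<oplus>\<^bsub>C\<^esub> Y Z W)))
     \<cdot>\<^bsub>C\<^esub> \<alpha>\<^sub>\<oplus>\<^bsub>C\<^esub> X Y (Z \<oplus>\<^bsub>C\<^esub> W)"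

locale bimonoidal_category =
  add: symmetric_monoidal_category C "Additive C" "add_sym C" +
  mult: monoidal_category C "Multiplicative C"
  for C :: "('o, 'm, 'z) bimonoidal_data_scheme" (structure) +
  assumes left_null_in_hom: "A \<in> Obj C \<Longrightarrow> \<lambda>\<^sub>\<bullet> A \<in> hom C (\<zero> \<otimes> A) \<zero>"
    and left_null_iso: "A \<in> Obj C \<Longrightarrow> iso_arr C (\<lambda>\<^sub>\<bullet> A)"
    and left_null_natural: "f \<in> Arr C \<Longrightarrow> \<lambda>\<^sub>\<bullet> (Cod C f) \<cdot> (\<iota> \<zero> \<boxtimes> f) = \<lambda>\<^sub>\<bullet> (Dom C f)"
    and right_null_in_hom: "A \<in> Obj C \<Longrightarrow> \<rho>\<^sub>\<bullet> A \<in> hom C (A \<otimes> \<zero>) \<zero>"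
    and right_null_iso: "A \<in> Obj C \<Longrightarrow> iso_arr C (\<rho>\<^sub>\<bullet> A)"
    and right_null_natural: "f \<in> Arr C \<Longrightarrow> \<rho>\<^sub>\<bullet> (Cod C f) \<cdot> (f \<boxtimes> \<iota> \<zero>) = \<rho>\<^sub>\<bullet> (Dom C f)"
    and left_dist_in_hom: "\<lbrakk>A \<in> Obj C; B \<in> Obj C; D \<in> Obj C\<rbrakk> \<Longrightarrow>
          \<delta>\<^sub>l A B D \<in> hom C (A \<otimes> (B \<oplus> D)) (A \<otimes> B \<oplus> A \<otimes> D)"
    and left_dist_mono: "\<lbrakk>A \<in> Obj C; B \<in> Obj C; D \<in> Obj C\<rbrakk> \<Longrightarrow> mono_arr C (\<delta>\<^sub>l A B D)"
    and left_dist_natural: "\<lbrakk>f \<in> Arr C; g \<in> Arr C; h \<in> Arr C\<rbrakk> \<Longrightarrow>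
          \<delta>\<^sub>l (Cod C f) (Cod C g) (Cod C h) \<cdot> (f \<boxtimes> (g \<boxplus> h)) =
          (f \<boxtimes> g \<boxplus> f \<boxtimes> h) \<cdot> \<delta>\<^sub>l (Dom C f) (Dom C g) (Dom C h)"
    and right_dist_in_hom: "\<lbrakk>A \<in> Obj C; B \<in> Obj C; D \<in> Obj C\<rbrakk> \<Longrightarrow>
          \<delta>\<^sub>r A B D \<in> hom C ((A \<oplus> B) \<otimes> D) (A \<otimes> D \<oplus> B \<otimes> D)"
    and right_dist_mono: "\<lbrakk>A \<in> Obj C; B \<in> Obj C; D \<in> Obj C\<rbrakk> \<Longrightarrow> mono_arr C (\<delta>\<^sub>r A B D)"
    and right_dist_natural: "\<lbrakk>f \<in> Arr C; g \<in> Arr C; h \<in> Arr C\<rbrakk> \<Longrightarrow>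
          \<delta>\<^sub>r (Cod C f) (Cod C g) (Cod C h) \<cdot> ((f \<boxplus> g) \<boxtimes> h) =
          (f \<boxtimes> h \<boxplus> g \<boxtimes> h) \<cdot> \<delta>\<^sub>r (Dom C f) (Dom C g) (Dom C h)"
    and left_dist_sym: "\<lbrakk>A \<in> Obj C; B \<in> Obj C; D \<in> Obj C\<rbrakk> \<Longrightarrow>
          \<delta>\<^sub>l A D B \<cdot> (\<iota> A \<boxtimes> \<zeta>\<^sub>\<oplus> B D) = \<zeta>\<^sub>\<oplus> (A \<otimes> B) (A \<otimes> D) \<cdot> \<delta>\<^sub>l A B D"
    and right_dist_sym: "\<lbrakk>A \<in> Obj C; B \<in> Obj C; D \<in> Obj C\<rbrakk> \<Longrightarrow>
          \<delta>\<^sub>r B A D \<cdot> (\<zeta>\<^sub>\<oplus> A B \<boxtimes> \<iota> D) = \<zeta>\<^sub>\<oplus> (A \<otimes> D) (B \<otimes> D) \<cdot> \<delta>\<^sub>r A B D"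
    and right_dist_add_assoc: "\<lbrakk>A \<in> Obj C; B \<in> Obj C; D \<in> Obj C; E \<in> Obj C\<rbrakk> \<Longrightarrow>
          \<alpha>\<^sub>\<oplus> (A \<otimes> E) (B \<otimes> E) (D \<otimes> E) \<cdot> (\<delta>\<^sub>r A B E \<boxplus> \<iota> (D \<otimes> E)) \<cdot> \<delta>\<^sub>r (A \<oplus> B) D E =
          (\<iota> (A \<otimes> E) \<boxplus> \<delta>\<^sub>r B D E) \<cdot> \<delta>\<^sub>r A (B \<oplus> D) E \<cdot> (\<alpha>\<^sub>\<oplus> A B D \<boxtimes> \<iota> E)"
    and left_dist_add_assoc: "\<lbrakk>A \<in> Obj C; B \<in> Obj C; D \<in> Obj C; E \<in> Obj C\<rbrakk> \<Longrightarrow>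
          \<alpha>\<^sub>\<oplus> (A \<otimes> B) (A \<otimes> D) (A \<otimes> E) \<cdot> (\<delta>\<^sub>l A B D \<boxplus> \<iota> (A \<otimes> E)) \<cdot> \<delta>\<^sub>l A (B \<oplus> D) E =
          (\<iota> (A \<otimes> B) \<boxplus> \<delta>\<^sub>l A D E) \<cdot> \<delta>\<^sub>l A B (D \<oplus> E) \<cdot> (\<iota> A \<boxtimes> \<alpha>\<^sub>\<oplus> B D E)"
    and left_dist_mult_assoc: "\<lbrakk>A \<in> Obj C; B \<in> Obj C; D \<in> Obj C; E \<in> Obj C\<rbrakk> \<Longrightarrow>
          \<delta>\<^sub>l A (B \<otimes> D) (B \<otimes> E) \<cdot> (\<iota> A \<boxtimes> \<delta>\<^sub>l B D E) \<cdot> \<alpha>\<^sub>\<otimes> A B (D \<oplus> E) =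
          (\<alpha>\<^sub>\<otimes> A B D \<boxplus> \<alpha>\<^sub>\<otimes> A B E) \<cdot> \<delta>\<^sub>l (A \<otimes> B) D E"
    and right_dist_mult_assoc: "\<lbrakk>A \<in> Obj C; B \<in> Obj C; D \<in> Obj C; E \<in> Obj C\<rbrakk> \<Longrightarrow>
          (\<alpha>\<^sub>\<otimes> A D E \<boxplus> \<alpha>\<^sub>\<otimes> B D E) \<cdot> \<delta>\<^sub>r (A \<otimes> D) (B \<otimes> D) E \<cdot> (\<delta>\<^sub>r A B D \<boxtimes> \<iota> E) =
          \<delta>\<^sub>r A B (D \<otimes> E) \<cdot> \<alpha>\<^sub>\<otimes> (A \<oplus> B) D E"
    and dist_mult_assoc: "\<lbrakk>A \<in> Obj C; B \<in> Obj C; D \<in> Obj C; E \<in> Obj C\<rbrakk> \<Longrightarrow>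
          (\<alpha>\<^sub>\<otimes> A B E \<boxplus> \<alpha>\<^sub>\<otimes> A D E) \<cdot> \<delta>\<^sub>r (A \<otimes> B) (A \<otimes> D) E \<cdot> (\<delta>\<^sub>l A B D \<boxtimes> \<iota> E) =
          \<delta>\<^sub>l A (B \<otimes> E) (D \<otimes> E) \<cdot> (\<iota> A \<boxtimes> \<delta>\<^sub>r B D E) \<cdot> \<alpha>\<^sub>\<otimes> A (B \<oplus> D) E"
    and dist_dist: "\<lbrakk>A \<in> Obj C; B \<in> Obj C; D \<in> Obj C; E \<in> Obj C\<rbrakk> \<Longrightarrow>
          \<mu> (A \<otimes> D) (A \<otimes> E) (B \<otimes> D) (B \<otimes> E) \<cdot> (\<delta>\<^sub>l A D E \<boxplus> \<delta>\<^sub>l B D E) \<cdot> \<delta>\<^sub>r A B (D \<oplus> E) =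
          (\<delta>\<^sub>r A B D \<boxplus> \<delta>\<^sub>r A B E) \<cdot> \<delta>\<^sub>l (A \<oplus> B) D E"
    and null_zero: "\<lambda>\<^sub>\<bullet> \<zero> = \<rho>\<^sub>\<bullet> \<zero>"
    and left_null_add: "\<lbrakk>A \<in> Obj C; B \<in> Obj C\<rbrakk> \<Longrightarrow>
          \<lambda>\<^sub>\<oplus> \<zero> \<cdot> (\<lambda>\<^sub>\<bullet> A \<boxplus> \<lambda>\<^sub>\<bullet> B) \<cdot> \<delta>\<^sub>l \<zero> A B = \<lambda>\<^sub>\<bullet> (A \<oplus> B)"
    and right_null_add: "\<lbrakk>A \<in> Obj C; B \<in> Obj C\<rbrakk> \<Longrightarrow>
          \<lambda>\<^sub>\<oplus> \<zero> \<cdot> (\<rho>\<^sub>\<bullet> A \<boxplus> \<rho>\<^sub>\<bullet> B) \<cdot> \<delta>\<^sub>r A B \<zero> = \<rho>\<^sub>\<bullet> (A \<oplus> B)"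
    and left_null_one: "\<rho>\<^sub>\<otimes> \<zero> = \<lambda>\<^sub>\<bullet> \<one>"
    and right_null_one: "\<lambda>\<^sub>\<otimes> \<zero> = \<rho>\<^sub>\<bullet> \<one>"
    and left_null_mult: "\<lbrakk>A \<in> Obj C; B \<in> Obj C\<rbrakk> \<Longrightarrow>
          \<lambda>\<^sub>\<bullet> (A \<otimes> B) \<cdot> \<alpha>\<^sub>\<otimes> \<zero> A B = \<lambda>\<^sub>\<bullet> B \<cdot> (\<lambda>\<^sub>\<bullet> A \<boxtimes> \<iota> B)"
    and middle_null_mult: "\<lbrakk>A \<in> Obj C; B \<in> Obj C\<rbrakk> \<Longrightarrow>
          \<rho>\<^sub>\<bullet> A \<cdot> (\<iota> A \<boxtimes> \<lambda>\<^sub>\<bullet> B) \<cdot> \<alpha>\<^sub>\<otimes> A \<zero> B = \<lambda>\<^sub>\<bullet> B \<cdot> (\<rho>\<^sub>\<bullet> A \<boxtimes> \<iota> B)"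
    and right_null_mult: "\<lbrakk>A \<in> Obj C; B \<in> Obj C\<rbrakk> \<Longrightarrow>
          \<rho>\<^sub>\<bullet> A \<cdot> (\<iota> A \<boxtimes> \<rho>\<^sub>\<bullet> B) \<cdot> \<alpha>\<^sub>\<otimes> A B \<zero> = \<rho>\<^sub>\<bullet> (A \<otimes> B)"
    and left_dist_zero_left: "\<lbrakk>A \<in> Obj C; B \<in> Obj C\<rbrakk> \<Longrightarrow>
          \<lambda>\<^sub>\<oplus> (A \<otimes> B) \<cdot> (\<rho>\<^sub>\<bullet> A \<boxplus> \<iota> (A \<otimes> B)) \<cdot> \<delta>\<^sub>l A \<zero> B = \<iota> A \<boxtimes> \<lambda>\<^sub>\<oplus> B"
    and right_dist_zero_left: "\<lbrakk>A \<in> Obj C; B \<in> Obj C\<rbrakk> \<Longrightarrow>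
          \<lambda>\<^sub>\<oplus> (B \<otimes> A) \<cdot> (\<lambda>\<^sub>\<bullet> A \<boxplus> \<iota> (B \<otimes> A)) \<cdot> \<delta>\<^sub>r \<zero> B A = \<lambda>\<^sub>\<oplus> B \<boxtimes> \<iota> A"
    and left_dist_zero_right: "\<lbrakk>A \<in> Obj C; B \<in> Obj C\<rbrakk> \<Longrightarrow>
          \<rho>\<^sub>\<oplus> (A \<otimes> B) \<cdot> (\<iota> (A \<otimes> B) \<boxplus> \<rho>\<^sub>\<bullet> A) \<cdot> \<delta>\<^sub>l A B \<zero> = \<iota> A \<boxtimes> \<rho>\<^sub>\<oplus> B"
    and right_dist_zero_right: "\<lbrakk>A \<in> Obj C; B \<in> Obj C\<rbrakk> \<Longrightarrow>
          \<rho>\<^sub>\<oplus> (A \<otimes> B) \<cdot> (\<iota> (A \<otimes> B) \<boxplus> \<lambda>\<^sub>\<bullet> B) \<cdot> \<delta>\<^sub>r A \<zero> B = \<rho>\<^sub>\<oplus> A \<boxtimes> \<iota> B"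
    and left_dist_one: "\<lbrakk>A \<in> Obj C; B \<in> Obj C\<rbrakk> \<Longrightarrow>
          (\<lambda>\<^sub>\<otimes> A \<boxplus> \<lambda>\<^sub>\<otimes> B) \<cdot> \<delta>\<^sub>l \<one> A B = \<lambda>\<^sub>\<otimes> (A \<oplus> B)"
    and right_dist_one: "\<lbrakk>A \<in> Obj C; B \<in> Obj C\<rbrakk> \<Longrightarrow>
          (\<rho>\<^sub>\<otimes> A \<boxplus> \<rho>\<^sub>\<otimes> B) \<cdot> \<delta>\<^sub>r A B \<one> = \<rho>\<^sub>\<otimes> (A \<oplus> B)"

record ('o, 'm) symmetric_bimonoidal_data = "('o, 'm) bimonoidal_data" +
  mult_sym :: "'o \<Rightarrow> 'o \<Rightarrow> 'm"  (\<open>\<zeta>\<^sub>\<otimes>\<index>\<close>)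

locale symmetric_bimonoidal_category =
  bimonoidal_category C +
  mult: symmetric_monoidal_category C "Multiplicative C" "mult_sym C"
  for C :: "('o, 'm, 'z) symmetric_bimonoidal_data_scheme" (structure) +
  assumes left_dist_mult_sym: "\<lbrakk>A \<in> Obj C; B \<in> Obj C; D \<in> Obj C\<rbrakk> \<Longrightarrow>
          \<delta>\<^sub>l D A B \<cdot> \<zeta>\<^sub>\<otimes> (A \<oplus> B) D = (\<zeta>\<^sub>\<otimes> A D \<boxplus> \<zeta>\<^sub>\<otimes> B D) \<cdot> \<delta>\<^sub>r A B D"
    and left_null_mult_sym: "A \<in> Obj C \<Longrightarrow> \<lambda>\<^sub>\<bullet> A \<cdot> \<zeta>\<^sub>\<otimes> A \<zero> = \<rho>\<^sub>\<bullet> A"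

inductive_set dist_class :: "('o, 'm, 'z) bimonoidal_data_scheme \<Rightarrow> 'm set"
  for C :: "('o, 'm, 'z) bimonoidal_data_scheme" (structure) where
  left_dist: "\<lbrakk>A \<in> Obj C; B \<in> Obj C; D \<in> Obj C\<rbrakk> \<Longrightarrow> \<delta>\<^sub>l A B D \<in> dist_class C"
| right_dist: "\<lbrakk>A \<in> Obj C; B \<in> Obj C; D \<in> Obj C\<rbrakk> \<Longrightarrow> \<delta>\<^sub>r A B D \<in> dist_class C"
| add_Ident_right: "\<lbrakk>f \<in> dist_class C; A \<in> Obj C\<rbrakk> \<Longrightarrow> f \<boxplus> \<iota> A \<in> dist_class C"
| add_Ident_left: "\<lbrakk>f \<in> dist_class C; A \<in> Obj C\<rbrakk> \<Longrightarrow> \<iota> A \<boxplus> f \<in> dist_class C"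
| mult_Ident_right: "\<lbrakk>f \<in> dist_class C; A \<in> Obj C\<rbrakk> \<Longrightarrow> f \<boxtimes> \<iota> A \<in> dist_class C"
| mult_Ident_left: "\<lbrakk>f \<in> dist_class C; A \<in> Obj C\<rbrakk> \<Longrightarrow> \<iota> A \<boxtimes> f \<in> dist_class C"

locale flat_symmetric_bimonoidal_category = symmetric_bimonoidal_category +
  assumes flat: "f \<in> dist_class C \<Longrightarrow> mono_arr C f"


section \<open>Robust symmetric bimonoidal functors and their transformations\<close>

locale lax_symmetric_monoidal_functor =
  category_functor C D F +
  C: symmetric_monoidal_category C M \<zeta> +
  D: symmetric_monoidal_category D N \<xi>
  for C :: "('o1, 'm1, 'y) cat_data_scheme"
    and M :: "('o1, 'm1) tensor_data"
    and \<zeta> :: "'o1 \<Rightarrow> 'o1 \<Rightarrow> 'm1"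
    and D :: "('o2, 'm2, 'z) cat_data_scheme"
    and N :: "('o2, 'm2) tensor_data"
    and \<xi> :: "'o2 \<Rightarrow> 'o2 \<Rightarrow> 'm2"
    and F :: "('o1, 'm1, 'o2, 'm2, 'w) functor_data_scheme" +
  fixes F2 :: "'o1 \<Rightarrow> 'o1 \<Rightarrow> 'm2"
    and F0 :: "'m2"
  assumes F2_in_hom: "\<lbrakk>A \<in> Obj C; B \<in> Obj C\<rbrakk> \<Longrightarrow>
          F2 A B \<in> hom D (tObj N (OMap F A) (OMap F B)) (OMap F (tObj M A B))"
    and F2_natural: "\<lbrakk>f \<in> Arr C; g \<in> Arr C\<rbrakk> \<Longrightarrow>
          F2 (Cod C f) (Cod C g) \<cdot>\<^bsub>D\<^esub> tArr N (AMap F f) (AMap F g) =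
          AMap F (tArr M f g) \<cdot>\<^bsub>D\<^esub> F2 (Dom C f) (Dom C g)"
    and F2_extensional: "\<not> (A \<in> Obj C \<and> B \<in> Obj C) \<Longrightarrow> F2 A B = undefined"
    and F0_in_hom: "F0 \<in> hom D (tUnit N) (OMap F (tUnit M))"
    and F2_assoc: "\<lbrakk>A \<in> Obj C; B \<in> Obj C; E \<in> Obj C\<rbrakk> \<Longrightarrow>
          AMap F (tAssoc M A B E) \<cdot>\<^bsub>D\<^esub> F2 (tObj M A B) E \<cdot>\<^bsub>D\<^esub> tArr N (F2 A B) (\<iota>\<^bsub>D\<^esub> (OMap F E)) =
          F2 A (tObj M B E) \<cdot>\<^bsub>D\<^esub> tArr N (\<iota>\<^bsub>D\<^esub> (OMap F A)) (F2 B E)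
            \<cdot>\<^bsub>D\<^esub> tAssoc N (OMap F A) (OMap F B) (OMap F E)"
    and F2_left: "A \<in> Obj C \<Longrightarrow>
          AMap F (tLeft M A) \<cdot>\<^bsub>D\<^esub> F2 (tUnit M) A \<cdot>\<^bsub>D\<^esub> tArr N F0 (\<iota>\<^bsub>D\<^esub> (OMap F A)) =
          tLeft N (OMap F A)"
    and F2_right: "A \<in> Obj C \<Longrightarrow>
          AMap F (tRight M A) \<cdot>\<^bsub>D\<^esub> F2 A (tUnit M) \<cdot>\<^bsub>D\<^esub> tArr N (\<iota>\<^bsub>D\<^esub> (OMap F A)) F0 =
          tRight N (OMap F A)"
    and F2_sym: "\<lbrakk>A \<in> Obj C; B \<in> Obj C\<rbrakk> \<Longrightarrow>
          AMap F (\<zeta> A B) \<cdot>\<^bsub>D\<^esub> F2 A B = F2 B A \<cdot>\<^bsub>D\<^esub> \<xi> (OMap F A) (OMap F B)"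

record ('o1, 'm1, 'o2, 'm2) bimonoidal_functor_data = "('o1, 'm1, 'o2, 'm2) functor_data" +
  Add2 :: "'o1 \<Rightarrow> 'o1 \<Rightarrow> 'm2"
  Add0 :: "'m2"
  Mult2 :: "'o1 \<Rightarrow> 'o1 \<Rightarrow> 'm2"
  Mult0 :: "'m2"

locale symmetric_bimonoidal_functor =
  C: symmetric_bimonoidal_category C +
  D: symmetric_bimonoidal_category D +
  add: lax_symmetric_monoidal_functor
    C "Additive C" "add_sym C" D "Additive D" "add_sym D" F "Add2 F" "Add0 F" +
  mult: lax_symmetric_monoidal_functor
    C "Multiplicative C" "mult_sym C" D "Multiplicative D" "mult_sym D" F "Mult2 F" "Mult0 F"
  for C :: "('o1, 'm1, 'y) symmetric_bimonoidal_data_scheme"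
    and D :: "('o2, 'm2, 'z) symmetric_bimonoidal_data_scheme"
    and F :: "('o1, 'm1, 'o2, 'm2) bimonoidal_functor_data" +
  assumes functor_left_null: "A \<in> Obj C \<Longrightarrow>
          AMap F (\<lambda>\<^sub>\<bullet>\<^bsub>C\<^esub> A) \<cdot>\<^bsub>D\<^esub> Mult2 F \<zero>\<^bsub>C\<^esub> A \<cdot>\<^bsub>D\<^esub> (Add0 F \<boxtimes>\<^bsub>D\<^esub> \<iota>\<^bsub>D\<^esub> (OMap F A)) =
          Add0 F \<cdot>\<^bsub>D\<^esub> \<lambda>\<^sub>\<bullet>\<^bsub>D\<^esub> (OMap F A)"
    and functor_left_dist: "\<lbrakk>A \<in> Obj C; B \<in> Obj C; E \<in> Obj C\<rbrakk> \<Longrightarrow>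
          AMap F (\<delta>\<^sub>l\<^bsub>C\<^esub> A B E) \<cdot>\<^bsub>D\<^esub> Mult2 F A (B \<oplus>\<^bsub>C\<^esub> E)
            \<cdot>\<^bsub>D\<^esub> (\<iota>\<^bsub>D\<^esub> (OMap F A) \<boxtimes>\<^bsub>D\<^esub> Add2 F B E) =
          Add2 F (A \<otimes>\<^bsub>C\<^esub> B) (A \<otimes>\<^bsub>C\<^esub> E) \<cdot>\<^bsub>D\<^esub> (Mult2 F A B \<boxplus>\<^bsub>D\<^esub> Mult2 F A E)
            \<cdot>\<^bsub>D\<^esub> \<delta>\<^sub>l\<^bsub>D\<^esub> (OMap F A) (OMap F B) (OMap F E)"

locale robust_symmetric_bimonoidal_functor = symmetric_bimonoidal_functor +
  assumes Add2_iso: "\<lbrakk>A \<in> Obj C; B \<in> Obj C\<rbrakk> \<Longrightarrow> iso_arr D (Add2 F A B)"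
    and Add0_iso: "iso_arr D (Add0 F)"
    and Mult0_iso: "iso_arr D (Mult0 F)"

locale bimonoidal_transformation =
  F: symmetric_bimonoidal_functor C D F +
  G: symmetric_bimonoidal_functor C D G +
  natural_transformation C D F G \<eta>
  for C :: "('o1, 'm1, 'y) symmetric_bimonoidal_data_scheme"
    and D :: "('o2, 'm2, 'z) symmetric_bimonoidal_data_scheme"
    and F :: "('o1, 'm1, 'o2, 'm2) bimonoidal_functor_data"
    and G :: "('o1, 'm1, 'o2, 'm2) bimonoidal_functor_data"
    and \<eta> :: "'o1 \<Rightarrow> 'm2" +
  assumes component_add: "\<lbrakk>A \<in> Obj C; B \<in> Obj C\<rbrakk> \<Longrightarrow>
          \<eta> (A \<oplus>\<^bsub>C\<^esub> B) \<cdot>\<^bsub>D\<^esub> Add2 F A B = Add2 G A B \<cdot>\<^bsub>D\<^esub> (\<eta> A \<boxplus>\<^bsub>D\<^esub> \<eta> B)"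
    and component_zero: "\<eta> \<zero>\<^bsub>C\<^esub> \<cdot>\<^bsub>D\<^esub> Add0 F = Add0 G"
    and component_mult: "\<lbrakk>A \<in> Obj C; B \<in> Obj C\<rbrakk> \<Longrightarrow>
          \<eta> (A \<otimes>\<^bsub>C\<^esub> B) \<cdot>\<^bsub>D\<^esub> Mult2 F A B = Mult2 G A B \<cdot>\<^bsub>D\<^esub> (\<eta> A \<boxtimes>\<^bsub>D\<^esub> \<eta> B)"
    and component_one: "\<eta> \<one>\<^bsub>C\<^esub> \<cdot>\<^bsub>D\<^esub> Mult0 F = Mult0 G"

text \<open>The category of robust symmetric bimonoidal functors \<open>C \<rightarrow> D\<close>.  A transformation is stored
  together with its source and target functors, and composition is the vertical one.\<close>

type_synonym ('o1, 'm1, 'o2, 'm2) bimonoidal_2cell =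
  "('o1, 'm1, 'o2, 'm2) bimonoidal_functor_data \<times> ('o1 \<Rightarrow> 'm2) \<times>
   ('o1, 'm1, 'o2, 'm2) bimonoidal_functor_data"

definition robust_hom ::
  "('o1, 'm1, 'y) symmetric_bimonoidal_data_scheme \<Rightarrow>
   ('o2, 'm2, 'z) symmetric_bimonoidal_data_scheme \<Rightarrow>
   (('o1, 'm1, 'o2, 'm2) bimonoidal_functor_data, ('o1, 'm1, 'o2, 'm2) bimonoidal_2cell) cat_data"
  where
  "robust_hom C D =
     \<lparr>Obj = {F. robust_symmetric_bimonoidal_functor C D F},
      Arr = {(F, \<eta>, G). robust_symmetric_bimonoidal_functor C D F \<and>
               robust_symmetric_bimonoidal_functor C D G \<and> bimonoidal_transformation C D F G \<eta>},
      Dom = (\<lambda>(F, \<eta>, G). F),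
      Cod = (\<lambda>(F, \<eta>, G). G),
      Ident = (\<lambda>F. (F, (\<lambda>A\<in>Obj C. \<iota>\<^bsub>D\<^esub> (OMap F A)), F)),
      Comp = (\<lambda>(G', \<tau>, H) (F, \<sigma>, G). (F, (\<lambda>A\<in>Obj C. \<tau> A \<cdot>\<^bsub>D\<^esub> \<sigma> A), H))\<rparr>"


section \<open>The finite ordinal category\<close>

text \<open>A morphism \<open>n \<rightarrow> n\<close> is a pair \<open>(n, \<sigma>)\<close> where \<open>\<sigma>\<close> permutes \<open>{1..n}\<close> and fixes
  all other numbers.  A pair \<open>(i, j)\<close> with \<open>1 \<le> i \<le> m\<close> and \<open>1 \<le> j\<close> is encoded as
  \<open>i + (j - 1) m\<close>; the functions \<open>row m\<close> and \<open>col m\<close> recover \<open>i\<close> and \<open>j\<close>.\<close>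

definition pair_code :: "nat \<Rightarrow> nat \<Rightarrow> nat \<Rightarrow> nat" where
  "pair_code m i j = i + (j - 1) * m"

definition row :: "nat \<Rightarrow> nat \<Rightarrow> nat" where
  "row m k = (k - 1) mod m + 1"

definition col :: "nat \<Rightarrow> nat \<Rightarrow> nat" where
  "col m k = (k - 1) div m + 1"

lemma pair_code_inverse:
  assumes "1 \<le> i" "i \<le> m" "1 \<le> j"
  shows "row m (pair_code m i j) = i" and "col m (pair_code m i j) = j"
proof -
  obtain a b where ab: "i = Suc a" "j = Suc b" "a < m"
    using assms by (cases i; cases j) auto
  then show "row m (pair_code m i j) = i" and "col m (pair_code m i j) = j"
    by (simp_all add: pair_code_def row_def col_def)
qed

definition block_sum :: "nat \<Rightarrow> (nat \<Rightarrow> nat) \<Rightarrow> (nat \<Rightarrow> nat) \<Rightarrow> nat \<Rightarrow> nat" where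
  "block_sum m \<sigma> \<tau> k = (if k \<le> m then \<sigma> k else m + \<tau> (k - m))"

definition block_swap :: "nat \<Rightarrow> nat \<Rightarrow> nat \<Rightarrow> nat" where
  "block_swap m n k =
     (if k \<in> {1..m} then n + k else if k \<in> {m + 1..m + n} then k - m else k)"

definition perm_prod :: "nat \<Rightarrow> nat \<Rightarrow> (nat \<Rightarrow> nat) \<Rightarrow> (nat \<Rightarrow> nat) \<Rightarrow> nat \<Rightarrow> nat" where
  "perm_prod m n \<sigma> \<tau> k =
     (if k \<in> {1..m * n} then pair_code m (\<sigma> (row m k)) (\<tau> (col m k)) else k)"

definition pair_swap :: "nat \<Rightarrow> nat \<Rightarrow> nat \<Rightarrow> nat" where
  "pair_swap m n k = (if k \<in> {1..m * n} then pair_code n (col m k) (row m k) else k)"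

definition dist_perm :: "nat \<Rightarrow> nat \<Rightarrow> nat \<Rightarrow> nat \<Rightarrow> nat" where
  "dist_perm m n p k =
     (if k \<in> {1..(m + n) * p} then
        let i = row (m + n) k; j = col (m + n) k
        in if i \<le> m then pair_code m i j else m * p + pair_code n (i - m) j
      else k)"

definition Sigma_category :: "(nat, nat \<times> (nat \<Rightarrow> nat)) symmetric_bimonoidal_data" where
  "Sigma_category =
     \<lparr>Obj = UNIV,
      Arr = {(n, \<sigma>). \<sigma> permutes {1..n}},
      Dom = fst,
      Cod = fst,
      Ident = (\<lambda>n. (n, id)),
      Comp = (\<lambda>(n, \<tau>) (m, \<sigma>). (m, \<tau> \<circ> \<sigma>)),
      Additive =
        \<lparr>tObj = (\<lambda>m n. m + n),
         tArr = (\<lambda>(m, \<sigma>) (n, \<tau>). (m + n, block_sum m \<sigma> \<tau>)),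
         tUnit = 0,
         tAssoc = (\<lambda>m n p. (m + n + p, id)),
         tLeft = (\<lambda>n. (n, id)),
         tRight = (\<lambda>n. (n, id))\<rparr>,
      add_sym = (\<lambda>m n. (m + n, block_swap m n)),
      Multiplicative =
        \<lparr>tObj = (\<lambda>m n. m * n),
         tArr = (\<lambda>(m, \<sigma>) (n, \<tau>). (m * n, perm_prod m n \<sigma> \<tau>)),
         tUnit = 1,
         tAssoc = (\<lambda>m n p. (m * n * p, id)),
         tLeft = (\<lambda>n. (n, id)),
         tRight = (\<lambda>n. (n, id))\<rparr>,
      left_null = (\<lambda>n. (0, id)),
      right_null = (\<lambda>n. (0, id)),
      left_dist = (\<lambda>m n p. (m * (n + p), id)),
      right_dist = (\<lambda>m n p. ((m + n) * p, dist_perm m n p)),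
      mult_sym = (\<lambda>m n. (m * n, pair_swap m n))\<rparr>"

end

theory Submission
  imports Defs
begin

text \<open>
  In \<open>\<Sigma>\<close> the object \<open>n\<close> is the sum of \<open>n\<close> copies of the unit \<open>1\<close>, and its permutations are exactly what
  a symmetry of \<open>\<oplus>\<close> forces: \<open>(\<Sigma>, \<oplus>)\<close> is the free symmetric monoidal category on one object.  So a robust
  functor \<open>\<Sigma> \<rightarrow> C\<close> has to send \<open>n\<close> to a sum of \<open>n\<close> copies of the unit of \<open>C\<close>.  The assertion says that such a
  functor exists and that between any two of them there is exactly one bimonoidal transformation.

  The functor.  On objects it is \<open>P n = 1 \<oplus> (1 \<oplus> (\<dots> \<oplus> 0))\<close>.  To let permutations act, summands are labelled
  and \<open>rearrange xs ys\<close> pulls the labels \<open>ys\<close> out of the list \<open>xs\<close> one after the other.  That this respects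
  composition (\<open>rearrange_trans\<close>) reduces to pulling out two labels in either order, hence to the
  Yang-Baxter equation \<open>swap_braid\<close>.  The map \<open>pow_mult m n : P m \<otimes> P n \<rightarrow> P (m n)\<close> expands the second factor
  by \<open>\<delta>\<^sub>l\<close> only; it need not be invertible.  Each axiom for it is an equation between two families of maps out
  of an expression in \<open>P n\<close> that turn sums in \<open>n\<close> into sums, so it follows by induction on \<open>n\<close> from the cases
  \<open>0\<close> and \<open>1\<close>, and the induction step is one coherence axiom of \<open>C\<close>: \<open>left_dist_add_assoc\<close> for additivity,
  \<open>left_dist_mult_assoc\<close> for associativity, \<open>dist_dist\<close> for the expansion of the first factor by \<open>\<delta>\<^sub>r\<close>
  (\<open>pow_mult_right_dist\<close>), from which the compatibility with the symmetry of \<open>\<otimes>\<close> follows (\<open>pow_mult_sym\<close>).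
  Naturality in permutations is checked on generators (\<open>permutation_induct\<close>).

  The transformations.  A transformation out of a robust functor is prescribed at \<open>0\<close> and \<open>1\<close> by the unit
  conditions, hence everywhere by additivity (\<open>transformation_from_Sigma_unique\<close>).  Solving the same recursion
  gives a transformation \<open>comparison\<close> from \<open>P\<close> to any robust \<open>G\<close>; it is invertible as \<open>G\<close> is robust, and
  composing one with the inverse of another connects any two robust functors.
\<close>

section \<open>Composites of typed arrows and unit coherence\<close>

text \<open>The domain and codomain of an arrow are the value of one partial function: a premise \<open>ty f = Some p\<close>
  determines \<open>p\<close>, so that a conditional equation about \<open>f\<close> finds its objects by evaluating \<open>ty f\<close> once.\<close>
definition (in category) ty :: "'m \<Rightarrow> ('o \<times> 'o) option" where
  "ty f = (if f \<in> Arr C then Some (Dom C f, Cod C f) else None)"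

context category begin

abbreviation has_type (\<open>_ \<Ztypecolon> _ \<rightarrow> _\<close> [51, 51, 51] 50) where "f \<Ztypecolon> A \<rightarrow> B \<equiv> ty f = Some (A, B)"

lemma ty_iff_hom: "f \<Ztypecolon> A \<rightarrow> B \<longleftrightarrow> f \<in> hom C A B"
  by (simp add: ty_def hom_def)

lemmas hom_ty = ty_iff_hom[THEN iffD2]

lemma Arr_ty: "f \<in> Arr C \<Longrightarrow> f \<Ztypecolon> Dom C f \<rightarrow> Cod C f"
  by (simp add: ty_def)

lemma tyD:
  assumes "ty f = Some p"
  shows "f \<in> Arr C" "Dom C f = fst p" "Cod C f = snd p" "fst p \<in> Obj C" "snd p \<in> Obj C"
  using assms Dom_in_Obj Cod_in_Obj by (auto simp: ty_def split: if_splits)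

lemma ty_Obj: "f \<Ztypecolon> A \<rightarrow> B \<Longrightarrow> A \<in> Obj C" "f \<Ztypecolon> A \<rightarrow> B \<Longrightarrow> B \<in> Obj C"
  using tyD by fastforce+

lemma ty_Comp [simp]:
  "ty f = Some p \<Longrightarrow> ty g = Some q \<Longrightarrow> fst q = snd p \<Longrightarrow> g \<cdot> f \<Ztypecolon> fst p \<rightarrow> snd q"
  using Comp_in_hom[of f g] by (simp add: tyD ty_iff_hom)

lemma ty_Ident [simp]: "A \<in> Obj C \<Longrightarrow> \<iota> A \<Ztypecolon> A \<rightarrow> A"
  by (simp add: ty_iff_hom Ident_in_hom)

lemma Comp_Ident [simp]:
  "ty f = Some p \<Longrightarrow> snd p = A \<Longrightarrow> \<iota> A \<cdot> f = f"
  "ty f = Some p \<Longrightarrow> fst p = A \<Longrightarrow> f \<cdot> \<iota> A = f"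
  using Ident_left[of f] Ident_right[of f] by (auto simp: tyD)

lemma Comp_assoc' [simp]:
  "ty f = Some p \<Longrightarrow> ty g = Some q \<Longrightarrow> ty h = Some r \<Longrightarrow> fst q = snd p \<Longrightarrow> fst r = snd q \<Longrightarrow>
    (h \<cdot> g) \<cdot> f = h \<cdot> g \<cdot> f"
  using Comp_assoc[of f g h] by (simp add: tyD)

text \<open>Composites are nested to the right, so an equation for \<open>a \<cdot> b\<close> applies inside a composite only in this form.\<close>
lemma chain:
  "a \<cdot> b = c \<Longrightarrow> ty a = Some q \<Longrightarrow> ty b = Some p \<Longrightarrow> fst q = snd p \<Longrightarrow> ty k = Some r \<Longrightarrow> snd r = fst p
    \<Longrightarrow> a \<cdot> b \<cdot> k = c \<cdot> k"
  by (metis Comp_assoc')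

lemma inverse_arrows_unique:
  assumes "inverse_arrows C f g" "inverse_arrows C f h" shows "g = h"
proof -
  obtain A B where ty: "f \<Ztypecolon> A \<rightarrow> B" "g \<Ztypecolon> B \<rightarrow> A" "h \<Ztypecolon> B \<rightarrow> A"
    using assms by (auto simp: inverse_arrows_def ty_iff_hom hom_def)
  then have "g = g \<cdot> (f \<cdot> h)" using assms tyD[OF ty(1)] by (simp add: inverse_arrows_def)
  also have "\<dots> = (g \<cdot> f) \<cdot> h" using ty by simp
  also have "\<dots> = h" using assms ty tyD[OF ty(1)] by (simp add: inverse_arrows_def)
  finally show ?thesis .
qed

lemma inv_arr_eqI: "inverse_arrows C f g \<Longrightarrow> inv_arr C f = g"
  unfolding inv_arr_def using inverse_arrows_unique by blast

lemma inv_arr_inverse: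
  assumes "iso_arr C f" shows "inverse_arrows C f (inv_arr C f)"
  using assms inv_arr_eqI by (auto simp: iso_arr_def)

lemma ty_inv_arr [simp]:
  "iso_arr C f \<Longrightarrow> ty f = Some p \<Longrightarrow> inv_arr C f \<Ztypecolon> snd p \<rightarrow> fst p"
  using inv_arr_inverse[of f] tyD[of f p] by (auto simp: inverse_arrows_def ty_iff_hom)

lemma Comp_inv_arr [simp]:
  assumes "iso_arr C f" "ty f = Some p"
  shows "inv_arr C f \<cdot> f = \<iota> (fst p)" "f \<cdot> inv_arr C f = \<iota> (snd p)"
  using inv_arr_inverse[OF assms(1)] tyD[OF assms(2)] by (auto simp: inverse_arrows_def)

lemma Comp_inv_arr_assoc [simp]:
  assumes "iso_arr C f" "ty f = Some p" "ty g = Some q"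
  shows "snd q = fst p \<Longrightarrow> inv_arr C f \<cdot> f \<cdot> g = g"
    "snd q = snd p \<Longrightarrow> f \<cdot> inv_arr C f \<cdot> g = g"
  using assms by (simp_all flip: Comp_assoc')

lemma iso_arr_ty:
  assumes "iso_arr C f" obtains A B where "f \<Ztypecolon> A \<rightarrow> B"
  using assms that by (auto simp: iso_arr_def inverse_arrows_def ty_iff_hom hom_def)

lemma iso_cancel_right:
  assumes "f \<cdot> e = g \<cdot> e" "iso_arr C e" "ty e = Some p" "ty f = Some q" "ty g = Some r" "fst q
      = snd p" "fst r = snd p"
  shows "f = g"
proof -
  have "(f \<cdot> e) \<cdot> inv_arr C e = (g \<cdot> e) \<cdot> inv_arr C e" using assms(1) by simp
  then show ?thesis using assms(2-) by simp
qed

lemma iso_cancel_left [simp]: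
  assumes "iso_arr C e" "ty e = Some p" "ty f = Some q" "ty g = Some r" "snd q = fst p" "snd r = fst p"
  shows "e \<cdot> f = e \<cdot> g \<longleftrightarrow> f = g"
proof
  assume "e \<cdot> f = e \<cdot> g"
  then have "inv_arr C e \<cdot> e \<cdot> f = inv_arr C e \<cdot> e \<cdot> g" by simp
  then show "f = g" using assms by simp
qed simp

lemma inverseI:
  assumes "g \<cdot> f = \<iota> A" "f \<cdot> g = \<iota> B" "f \<Ztypecolon> A \<rightarrow> B" "g \<Ztypecolon> B \<rightarrow> A"
  shows "iso_arr C f" "inv_arr C f = g"
proof -
  have "inverse_arrows C f g" using assms tyD[OF assms(3)] by (simp add: inverse_arrows_def ty_iff_hom)
  then show "iso_arr C f" "inv_arr C f = g" by (auto simp: iso_arr_def inv_arr_eqI)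
qed

lemma iso_Ident [simp]: "A \<in> Obj C \<Longrightarrow> iso_arr C (\<iota> A)"
  by (rule inverseI[of "\<iota> A" _ A A]) auto

lemma iso_Comp [simp]:
  assumes "ty f = Some p" "ty g = Some q" "fst q = snd p" "iso_arr C f" "iso_arr C g"
  shows "iso_arr C (g \<cdot> f)"
  using assms tyD[OF assms(1)] tyD[OF assms(2)]
  by (intro inverseI[of "inv_arr C f \<cdot> inv_arr C g" _ "fst p" "snd q"]) auto

lemma iso_inv_arr [simp]: "iso_arr C f \<Longrightarrow> iso_arr C (inv_arr C f)"
  by (metis iso_arr_ty Comp_inv_arr inverseI(1) ty_inv_arr fst_conv snd_conv)

end

context monoidal_category begin

abbreviation tens_obj (infixr \<open>\<odot>\<close> 65) where "A \<odot> B \<equiv> tObj M A B"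
abbreviation tens_arr (infixr \<open>\<boxdot>\<close> 65) where "f \<boxdot> g \<equiv> tArr M f g"
abbreviation unit_obj (\<open>I\<close>) where "I \<equiv> tUnit M"
abbreviation assoc (\<open>\<alpha>\<close>) where "\<alpha> \<equiv> tAssoc M"
abbreviation lunit (\<open>\<l>\<close>) where "\<l> \<equiv> tLeft M"
abbreviation runit (\<open>\<r>\<close>) where "\<r> \<equiv> tRight M"

declare tObj_in_Obj [simp] tUnit_in_Obj [simp]

lemma ty_tArr [simp]:
  "ty f = Some p \<Longrightarrow> ty g = Some q \<Longrightarrow> f \<boxdot> g \<Ztypecolon> fst p \<odot> fst q \<rightarrow> snd p \<odot> snd q"
  using tArr_in_hom[of f g] by (simp add: tyD ty_iff_hom)

lemmas ty_structure [simp] = tAssoc_in_hom[THEN hom_ty] tLeft_in_hom[THEN hom_ty] tRight_in_hom[THEN hom_ty]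

declare tAssoc_iso [simp] tLeft_iso [simp] tRight_iso [simp] tArr_Ident [simp]

text \<open>Oriented so that composites of sums become sums of composites.\<close>

lemma interchange [simp]:
  "ty f = Some p \<Longrightarrow> ty f' = Some p' \<Longrightarrow> fst p' = snd p \<Longrightarrow> ty g = Some q \<Longrightarrow> ty g' = Some q' \<Longrightarrow> fst q' = snd q
    \<Longrightarrow> (f' \<boxdot> g') \<cdot> (f \<boxdot> g) = (f' \<cdot> f) \<boxdot> (g' \<cdot> g)"
  using tArr_Comp[of f f' g g'] by (simp add: tyD)

lemmas interchange_chain [simp] = interchange[THEN chain]

lemma iso_tArr [simp]:
  assumes "iso_arr C f" "iso_arr C g" shows "iso_arr C (f \<boxdot> g)"
    and inv_tArr: "inv_arr C (f \<boxdot> g) = inv_arr C f \<boxdot> inv_arr C g"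
proof -
  obtain A B A' B' where ty: "f \<Ztypecolon> A \<rightarrow> B" "g \<Ztypecolon> A' \<rightarrow> B'" using assms iso_arr_ty by metis
  then show "iso_arr C (f \<boxdot> g)" "inv_arr C (f \<boxdot> g) = inv_arr C f \<boxdot> inv_arr C g"
    using assms ty_Obj[OF ty(1)] ty_Obj[OF ty(2)]
    by (auto intro!: inverseI[of "inv_arr C f \<boxdot> inv_arr C g" _ "A \<odot> A'" "B \<odot> B'"])
qed

lemma assoc_natural:
  "ty f = Some p \<Longrightarrow> ty g = Some q \<Longrightarrow> ty h = Some r \<Longrightarrow> snd p = A \<Longrightarrow> snd q = B \<Longrightarrow> snd r = D \<Longrightarrow>
    \<alpha> A B D \<cdot> ((f \<boxdot> g) \<boxdot> h) = (f \<boxdot> (g \<boxdot> h)) \<cdot> \<alpha> (fst p) (fst q) (fst r)"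
  using tAssoc_natural[of f g h] by (simp add: tyD)

text \<open>The special case in which the sum of two identities has already been rewritten to an identity.\<close>
lemma assoc_natural_Ident:
  "ty h = Some r \<Longrightarrow> snd r = D \<Longrightarrow> A \<in> Obj C \<Longrightarrow> B \<in> Obj C \<Longrightarrow>
    \<alpha> A B D \<cdot> (\<iota> (A \<odot> B) \<boxdot> h) = (\<iota> A \<boxdot> (\<iota> B \<boxdot> h)) \<cdot> \<alpha> A B (fst r)"
  using assoc_natural[of "\<iota> A" "(A,A)" "\<iota> B" "(B,B)" h r A B D] by simp

lemma lunit_natural: "ty f = Some p \<Longrightarrow> snd p = A \<Longrightarrow> \<l> A \<cdot> (\<iota> I \<boxdot> f) = f \<cdot> \<l> (fst p)"
  using tLeft_natural[of f] by (simp add: tyD)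

lemma runit_natural: "ty f = Some p \<Longrightarrow> snd p = A \<Longrightarrow> \<r> A \<cdot> (f \<boxdot> \<iota> I) = f \<cdot> \<r> (fst p)"
  using tRight_natural[of f] by (simp add: tyD)

lemmas natural = assoc_natural assoc_natural_Ident lunit_natural runit_natural
  assoc_natural[THEN chain] assoc_natural_Ident[THEN chain] lunit_natural[THEN chain] runit_natural[THEN chain]

text \<open>Naturality of the unit isomorphisms makes \<open>I \<odot> f\<close> and \<open>f \<odot> I\<close> conjugate to \<open>f\<close>.\<close>
lemma unit_tensor_faithful:
  assumes "f \<Ztypecolon> A \<rightarrow> B" "g \<Ztypecolon> A \<rightarrow> B"
  shows "\<iota> I \<boxdot> f = \<iota> I \<boxdot> g \<Longrightarrow> f = g" "f \<boxdot> \<iota> I = g \<boxdot> \<iota> I \<Longrightarrow> f = g"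
proof -
  note [simp] = assms assms[THEN ty_Obj(1)] assms[THEN ty_Obj(2)]
  show "f = g" if "\<iota> I \<boxdot> f = \<iota> I \<boxdot> g"
  proof (rule iso_cancel_right[of f "\<l> A" g])
    show "f \<cdot> \<l> A = g \<cdot> \<l> A"
      using lunit_natural[of f _ B] lunit_natural[of g _ B] that by simp
  qed simp+
  show "f = g" if "f \<boxdot> \<iota> I = g \<boxdot> \<iota> I"
  proof (rule iso_cancel_right[of f "\<r> A" g])
    show "f \<cdot> \<r> A = g \<cdot> \<r> A"
      using runit_natural[of f _ B] runit_natural[of g _ B] that by simp
  qed simp+
qed

text \<open>Kelly's argument: after tensoring with \<open>I\<close>, which loses nothing, both sides are reached from the
  pentagon at \<open>I, I, A, B\<close> by the triangle identity.\<close>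

lemma left_unit_tensor:
  assumes [simp]: "A \<in> Obj C" "B \<in> Obj C"
  shows "\<l> (A \<odot> B) \<cdot> \<alpha> I A B = \<l> A \<boxdot> \<iota> B"
proof -
  let ?e = "\<alpha> I (I \<odot> A) B \<cdot> (\<alpha> I I A \<boxdot> \<iota> B)"
  have "(\<iota> I \<boxdot> (\<l> (A \<odot> B) \<cdot> \<alpha> I A B)) \<cdot> ?e = (\<iota> I \<boxdot> \<l> (A \<odot> B)) \<cdot> ((\<iota> I \<boxdot> \<alpha> I A B) \<cdot> ?e)"
    by simp
  also have "\<dots> = (\<iota> I \<boxdot> \<l> (A \<odot> B)) \<cdot> \<alpha> I I (A \<odot> B) \<cdot> \<alpha> (I \<odot> I) A B"
    by (subst pentagon[symmetric]) auto
  also have "\<dots> = (\<r> I \<boxdot> \<iota> (A \<odot> B)) \<cdot> \<alpha> (I \<odot> I) A B"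
    by (simp add: triangle[THEN chain])
  also have "\<dots> = \<alpha> I A B \<cdot> ((\<r> I \<boxdot> \<iota> A) \<boxdot> \<iota> B)"
    by (simp add: natural)
  also have "\<dots> = \<alpha> I A B \<cdot> ((\<iota> I \<boxdot> \<l> A) \<boxdot> \<iota> B) \<cdot> (\<alpha> I I A \<boxdot> \<iota> B)"
    by (simp add: triangle)
  also have "\<dots> = (\<iota> I \<boxdot> (\<l> A \<boxdot> \<iota> B)) \<cdot> ?e"
    by (subst natural(5)) simp+
  finally have "\<iota> I \<boxdot> (\<l> (A \<odot> B) \<cdot> \<alpha> I A B) = \<iota> I \<boxdot> (\<l> A \<boxdot> \<iota> B)"
    by (rule iso_cancel_right) simp+
  then show ?thesis by (rule unit_tensor_faithful(1)[rotated 2]) simp_all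
qed

text \<open>The mirror image of the previous argument, with the pentagon at \<open>A, B, I, I\<close>.\<close>
lemma right_unit_tensor:
  assumes [simp]: "A \<in> Obj C" "B \<in> Obj C"
  shows "(\<iota> A \<boxdot> \<r> B) \<cdot> \<alpha> A B I = \<r> (A \<odot> B)"
proof -
  have "\<alpha> A B I \<cdot> (((\<iota> A \<boxdot> \<r> B) \<cdot> \<alpha> A B I) \<boxdot> \<iota> I) = \<alpha> A B I \<cdot> ((\<iota> A \<boxdot> \<r> B) \<boxdot> \<iota> I) \<cdot> (\<alpha> A B I \<boxdot> \<iota> I)"
    by simp
  also have "\<dots> = (\<iota> A \<boxdot> (\<r> B \<boxdot> \<iota> I)) \<cdot> \<alpha> A (B \<odot> I) I \<cdot> (\<alpha> A B I \<boxdot> \<iota> I)"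
    by (subst natural(5)) auto
  also have "\<dots> = (\<iota> A \<boxdot> (\<iota> B \<boxdot> \<l> I)) \<cdot> ((\<iota> A \<boxdot> \<alpha> B I I) \<cdot> \<alpha> A (B \<odot> I) I \<cdot> (\<alpha> A B I \<boxdot> \<iota> I))"
    by (simp add: triangle)
  also have "\<dots> = (\<iota> A \<boxdot> (\<iota> B \<boxdot> \<l> I)) \<cdot> (\<alpha> A B (I \<odot> I) \<cdot> \<alpha> (A \<odot> B) I I)"
    by (subst pentagon) auto
  also have "\<dots> = \<alpha> A B I \<cdot> (\<iota> (A \<odot> B) \<boxdot> \<l> I) \<cdot> \<alpha> (A \<odot> B) I I"
    by (simp add: natural)
  also have "\<dots> = \<alpha> A B I \<cdot> (\<r> (A \<odot> B) \<boxdot> \<iota> I)"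
    by (simp add: triangle)
  finally have "((\<iota> A \<boxdot> \<r> B) \<cdot> \<alpha> A B I) \<boxdot> \<iota> I = \<r> (A \<odot> B) \<boxdot> \<iota> I"
    by simp
  then show ?thesis by (rule unit_tensor_faithful(2)[rotated 2]) simp_all
qed

lemma left_unit_eq_right_unit: "\<l> I = \<r> I"
proof -
  have "\<l> I \<cdot> (\<iota> I \<boxdot> \<l> I) = \<l> I \<cdot> \<l> (I \<odot> I)" by (simp add: natural)
  then have "\<iota> I \<boxdot> \<l> I = \<l> (I \<odot> I)" by simp
  then have "\<l> I \<boxdot> \<iota> I = \<r> I \<boxdot> \<iota> I" using left_unit_tensor[of I I] triangle[of I I] by simp
  then show ?thesis by (rule unit_tensor_faithful(2)[rotated 2]) simp_all
qed

end

section \<open>Exchanging summands in a symmetric monoidal category\<close>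

context symmetric_monoidal_category begin

lemmas ty_sym [simp] = sym_in_hom[THEN hom_ty]

lemma sym_inverse_chain [simp]:
  "A \<in> Obj C \<Longrightarrow> B \<in> Obj C \<Longrightarrow> \<zeta> B A \<cdot> \<zeta> A B = \<iota> (A \<odot> B)"
  "A \<in> Obj C \<Longrightarrow> B \<in> Obj C \<Longrightarrow> ty f = Some p \<Longrightarrow> snd p = A \<odot> B \<Longrightarrow> \<zeta> B A \<cdot> \<zeta> A B \<cdot> f = f"
  by (simp_all add: sym_inverse sym_inverse[THEN chain])

lemma iso_sym [simp]: "A \<in> Obj C \<Longrightarrow> B \<in> Obj C \<Longrightarrow> iso_arr C (\<zeta> A B)"
  by (rule inverseI[of "\<zeta> B A" _ "A \<odot> B" "B \<odot> A"]) auto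

lemma sym_nat:
  "ty f = Some p \<Longrightarrow> ty g = Some q \<Longrightarrow> snd p = A \<Longrightarrow> snd q = B \<Longrightarrow>
    \<zeta> A B \<cdot> (f \<boxdot> g) = (g \<boxdot> f) \<cdot> \<zeta> (fst p) (fst q)"
  using sym_natural[of f g] by (simp add: tyD)

lemmas sym_nat' = sym_nat sym_nat[THEN chain]

lemma sym_unit': "A \<in> Obj C \<Longrightarrow> \<r> A \<cdot> \<zeta> I A = \<l> A"
  using sym_unit[of A, symmetric] by simp

text \<open>Sums nested to the right are permuted by exchanging their first two summands.  In terms of
  \<open>swap\<close> the Yang-Baxter equation for such sums involves no associators.\<close>
definition swap :: "'o \<Rightarrow> 'o \<Rightarrow> 'o \<Rightarrow> 'm" where
  "swap A B D = \<alpha> B A D \<cdot> (\<zeta> A B \<boxdot> \<iota> D) \<cdot> inv_arr C (\<alpha> A B D)"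

lemma ty_swap [simp]:
  "A \<in> Obj C \<Longrightarrow> B \<in> Obj C \<Longrightarrow> D \<in> Obj C \<Longrightarrow> swap A B D \<Ztypecolon> A \<odot> (B \<odot> D) \<rightarrow> B \<odot> (A \<odot> D)"
  by (simp add: swap_def)

lemma swap_assoc:
  "A \<in> Obj C \<Longrightarrow> B \<in> Obj C \<Longrightarrow> D \<in> Obj C \<Longrightarrow> swap A B D \<cdot> \<alpha> A B D = \<alpha> B A D \<cdot> (\<zeta> A B \<boxdot> \<iota> D)"
  by (simp add: swap_def)

lemma swap_swap [simp]:
  assumes [simp]: "A \<in> Obj C" "B \<in> Obj C" "D \<in> Obj C"
  shows "swap B A D \<cdot> swap A B D = \<iota> (A \<odot> (B \<odot> D))"
  by (simp add: swap_def)

lemmas swap_swap_chain [simp] = swap_swap[THEN chain]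

lemma swap_natural:
  assumes [simp]: "f \<Ztypecolon> A \<rightarrow> A'" "g \<Ztypecolon> B \<rightarrow> B'" "h \<Ztypecolon> D \<rightarrow> D'"
  shows "swap A' B' D' \<cdot> (f \<boxdot> (g \<boxdot> h)) = (g \<boxdot> (f \<boxdot> h)) \<cdot> swap A B D"
proof (rule iso_cancel_right[of _ "\<alpha> A B D"])
  note [simp] = assms[THEN ty_Obj(1)] assms[THEN ty_Obj(2)]
  have "(swap A' B' D' \<cdot> (f \<boxdot> (g \<boxdot> h))) \<cdot> \<alpha> A B D = swap A' B' D' \<cdot> \<alpha> A' B' D' \<cdot> ((f \<boxdot> g) \<boxdot> h)"
    by (simp add: natural)
  also have "\<dots> = \<alpha> B' A' D' \<cdot> ((g \<boxdot> f) \<boxdot> h) \<cdot> (\<zeta> A B \<boxdot> \<iota> D)"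
    by (simp add: swap_assoc[THEN chain] sym_nat')
  also have "\<dots> = (g \<boxdot> (f \<boxdot> h)) \<cdot> \<alpha> B A D \<cdot> (\<zeta> A B \<boxdot> \<iota> D)"
    by (subst natural(5)) simp+
  finally show "(swap A' B' D' \<cdot> (f \<boxdot> (g \<boxdot> h))) \<cdot> \<alpha> A B D = ((g \<boxdot> (f \<boxdot> h)) \<cdot> swap A B D) \<cdot> \<alpha> A B D"
    by (simp add: swap_assoc)
qed (simp add: assms[THEN ty_Obj(1)] assms[THEN ty_Obj(2)])+

lemma swap_nat:
  "ty f = Some p \<Longrightarrow> ty g = Some q \<Longrightarrow> ty h = Some r \<Longrightarrow> snd p = A \<Longrightarrow> snd q = B \<Longrightarrow> snd r = D \<Longrightarrow>
    swap A B D \<cdot> (f \<boxdot> (g \<boxdot> h)) = (g \<boxdot> (f \<boxdot> h)) \<cdot> swap (fst p) (fst q) (fst r)"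
  using swap_natural[of f "fst p" A g "fst q" B h "fst r" D] by (cases p; cases q; cases r) simp

lemmas swap_nat' = swap_nat swap_nat[THEN chain]

lemma hexagon_swap:
  assumes [simp]: "A \<in> Obj C" "B \<in> Obj C" "D \<in> Obj C"
  shows "\<alpha> B D A \<cdot> \<zeta> A (B \<odot> D) = (\<iota> B \<boxdot> \<zeta> A D) \<cdot> swap A B D"
proof (rule iso_cancel_right[of _ "\<alpha> A B D"])
  show "(\<alpha> B D A \<cdot> \<zeta> A (B \<odot> D)) \<cdot> \<alpha> A B D = ((\<iota> B \<boxdot> \<zeta> A D) \<cdot> swap A B D) \<cdot> \<alpha> A B D"
    by (simp add: swap_assoc sym_hexagon)
qed simp+

lemma swap_unit:
  assumes [simp]: "A \<in> Obj C" "B \<in> Obj C"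
  shows "(\<iota> A \<boxdot> \<l> B) \<cdot> swap I A B = \<l> (A \<odot> B)"
proof (rule iso_cancel_right[of _ "\<alpha> I A B"])
  show "((\<iota> A \<boxdot> \<l> B) \<cdot> swap I A B) \<cdot> \<alpha> I A B = \<l> (A \<odot> B) \<cdot> \<alpha> I A B"
    by (simp add: swap_assoc triangle[THEN chain] sym_unit' left_unit_tensor)
qed simp+

text \<open>Exchanging two summands commutes with rebracketing what comes after them: two pentagons joined by the
  naturality of the associator in \<open>\<zeta> A B\<close>.\<close>
lemma swap_assoc_last:
  assumes [simp]: "A \<in> Obj C" "B \<in> Obj C" "D \<in> Obj C" "E \<in> Obj C"
  shows "swap A B (D \<odot> E) \<cdot> (\<iota> A \<boxdot> \<alpha> B D E) \<cdot> \<alpha> A (B \<odot> D) E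
    = (\<iota> B \<boxdot> \<alpha> A D E) \<cdot> \<alpha> B (A \<odot> D) E \<cdot> (swap A B D \<boxdot> \<iota> E)"
proof (rule iso_cancel_right[of _ "\<alpha> A B D \<boxdot> \<iota> E"])
  have "(swap A B (D \<odot> E) \<cdot> (\<iota> A \<boxdot> \<alpha> B D E) \<cdot> \<alpha> A (B \<odot> D) E) \<cdot> (\<alpha> A B D \<boxdot> \<iota> E)
    = swap A B (D \<odot> E) \<cdot> (\<iota> A \<boxdot> \<alpha> B D E) \<cdot> \<alpha> A (B \<odot> D) E \<cdot> (\<alpha> A B D \<boxdot> \<iota> E)" by simp
  also have "\<dots> = swap A B (D \<odot> E) \<cdot> \<alpha> A B (D \<odot> E) \<cdot> \<alpha> (A \<odot> B) D E"
    by (simp add: pentagon)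
  also have "\<dots> = \<alpha> B A (D \<odot> E) \<cdot> \<alpha> (B \<odot> A) D E \<cdot> ((\<zeta> A B \<boxdot> \<iota> D) \<boxdot> \<iota> E)"
    by (simp add: swap_assoc[THEN chain] natural)
  also have "\<dots> = (\<iota> B \<boxdot> \<alpha> A D E) \<cdot> \<alpha> B (A \<odot> D) E \<cdot> (\<alpha> B A D \<boxdot> \<iota> E) \<cdot> ((\<zeta> A B \<boxdot> \<iota> D) \<boxdot> \<iota> E)"
    by (subst pentagon[THEN chain]) simp+
  also have "\<dots> = ((\<iota> B \<boxdot> \<alpha> A D E) \<cdot> \<alpha> B (A \<odot> D) E \<cdot> (swap A B D \<boxdot> \<iota> E)) \<cdot> (\<alpha> A B D \<boxdot> \<iota> E)"
    by (simp add: swap_assoc)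
  finally show "(swap A B (D \<odot> E) \<cdot> (\<iota> A \<boxdot> \<alpha> B D E) \<cdot> \<alpha> A (B \<odot> D) E) \<cdot> (\<alpha> A B D \<boxdot> \<iota> E) = \<dots>" .
qed simp+

text \<open>The hexagon identity, with a further summand \<open>E\<close> carried along.\<close>
lemma swap_tensor_middle:
  assumes [simp]: "A \<in> Obj C" "B \<in> Obj C" "D \<in> Obj C" "E \<in> Obj C"
  shows "\<alpha> B D (A \<odot> E) \<cdot> swap A (B \<odot> D) E
    = (\<iota> B \<boxdot> swap A D E) \<cdot> swap A B (D \<odot> E) \<cdot> (\<iota> A \<boxdot> \<alpha> B D E)"
proof (rule iso_cancel_right[of _ "\<alpha> A (B \<odot> D) E"])
  have "(\<alpha> B D (A \<odot> E) \<cdot> swap A (B \<odot> D) E) \<cdot> \<alpha> A (B \<odot> D) E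
    = \<alpha> B D (A \<odot> E) \<cdot> \<alpha> (B \<odot> D) A E \<cdot> (\<zeta> A (B \<odot> D) \<boxdot> \<iota> E)"
    by (simp add: swap_assoc)
  also have "\<dots> = (\<iota> B \<boxdot> \<alpha> D A E) \<cdot> \<alpha> B (D \<odot> A) E \<cdot> (\<alpha> B D A \<boxdot> \<iota> E) \<cdot> (\<zeta> A (B \<odot> D) \<boxdot> \<iota> E)"
    by (subst pentagon[THEN chain]) simp+
  also have "\<dots> = (\<iota> B \<boxdot> \<alpha> D A E) \<cdot> \<alpha> B (D \<odot> A) E \<cdot> ((\<iota> B \<boxdot> \<zeta> A D) \<boxdot> \<iota> E) \<cdot> (swap A B D \<boxdot> \<iota> E)"
    by (simp add: hexagon_swap)
  also have "\<dots> = (\<iota> B \<boxdot> (\<alpha> D A E \<cdot> (\<zeta> A D \<boxdot> \<iota> E))) \<cdot> \<alpha> B (A \<odot> D) E \<cdot> (swap A B D \<boxdot> \<iota> E)"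
    by (subst natural(5)) simp+
  also have "\<dots> = (\<iota> B \<boxdot> swap A D E) \<cdot> (\<iota> B \<boxdot> \<alpha> A D E) \<cdot> \<alpha> B (A \<odot> D) E \<cdot> (swap A B D \<boxdot> \<iota> E)"
    by (simp add: swap_assoc)
  also have "\<dots> = ((\<iota> B \<boxdot> swap A D E) \<cdot> swap A B (D \<odot> E) \<cdot> (\<iota> A \<boxdot> \<alpha> B D E)) \<cdot> \<alpha> A (B \<odot> D) E"
    by (subst swap_assoc_last[symmetric]) simp+
  finally show "(\<alpha> B D (A \<odot> E) \<cdot> swap A (B \<odot> D) E) \<cdot> \<alpha> A (B \<odot> D) E = \<dots>" .
qed simp+

text \<open>The inverse form of the hexagon identity.\<close>
lemma swap_tensor_first:
  assumes [simp]: "A \<in> Obj C" "B \<in> Obj C" "D \<in> Obj C" "E \<in> Obj C"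
  shows "(\<iota> A \<boxdot> \<alpha> B D E) \<cdot> swap (B \<odot> D) A E = swap B A (D \<odot> E) \<cdot> (\<iota> B \<boxdot> swap D A E) \<cdot> \<alpha> B D (A \<odot> E)"
proof -
  have "\<alpha> B D (A \<odot> E) = ((\<iota> B \<boxdot> swap A D E) \<cdot> swap A B (D \<odot> E) \<cdot> (\<iota> A \<boxdot> \<alpha> B D E)) \<cdot> swap (B \<odot> D) A E"
    by (subst swap_tensor_middle[symmetric]) simp+
  then show ?thesis by simp
qed

text \<open>The Yang-Baxter equation.  Moving \<open>A\<close> past \<open>B \<odot> D\<close> at once is natural in \<open>\<zeta> B D\<close>; resolving both sides of
  this naturality square by \<open>swap_tensor_middle\<close> gives the two ways of reversing \<open>A, B, D\<close>.\<close>
lemma swap_braid: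
  assumes [simp]: "A \<in> Obj C" "B \<in> Obj C" "D \<in> Obj C" "E \<in> Obj C"
  shows "swap B D (A \<odot> E) \<cdot> (\<iota> B \<boxdot> swap A D E) \<cdot> swap A B (D \<odot> E)
    = (\<iota> D \<boxdot> swap A B E) \<cdot> swap A D (B \<odot> E) \<cdot> (\<iota> A \<boxdot> swap B D E)"
proof (rule iso_cancel_right[of _ "\<iota> A \<boxdot> \<alpha> B D E"])
  have "(swap B D (A \<odot> E) \<cdot> (\<iota> B \<boxdot> swap A D E) \<cdot> swap A B (D \<odot> E)) \<cdot> (\<iota> A \<boxdot> \<alpha> B D E)
     = swap B D (A \<odot> E) \<cdot> \<alpha> B D (A \<odot> E) \<cdot> swap A (B \<odot> D) E"
    by (simp add: swap_tensor_middle)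
  also have "\<dots> = \<alpha> D B (A \<odot> E) \<cdot> (\<zeta> B D \<boxdot> (\<iota> A \<boxdot> \<iota> E)) \<cdot> swap A (B \<odot> D) E"
    by (subst swap_assoc[THEN chain]) simp+
  also have "\<dots> = \<alpha> D B (A \<odot> E) \<cdot> swap A (D \<odot> B) E \<cdot> (\<iota> A \<boxdot> (\<zeta> B D \<boxdot> \<iota> E))"
    by (subst swap_nat'(1)) (simp del: tArr_Ident)+
  also have "\<dots> = (\<iota> D \<boxdot> swap A B E) \<cdot> swap A D (B \<odot> E) \<cdot> (\<iota> A \<boxdot> (\<alpha> D B E \<cdot> (\<zeta> B D \<boxdot> \<iota> E)))"
    by (simp add: swap_tensor_middle[THEN chain])
  also have "\<dots> = ((\<iota> D \<boxdot> swap A B E) \<cdot> swap A D (B \<odot> E) \<cdot> (\<iota> A \<boxdot> swap B D E)) \<cdot> (\<iota> A \<boxdot> \<alpha> B D E)"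
    by (simp add: swap_assoc)
  finally show "(swap B D (A \<odot> E) \<cdot> (\<iota> B \<boxdot> swap A D E) \<cdot> swap A B (D \<odot> E)) \<cdot> (\<iota> A \<boxdot> \<alpha> B D E) = \<dots>" .
qed simp+

end

section \<open>Sums of copies of an object and their rearrangements\<close>

locale symmetric_monoidal_object = symmetric_monoidal_category C M \<zeta>
  for C :: "('o, 'm, 'z) cat_data_scheme" (structure) and M :: "('o, 'm) tensor_data" and \<zeta> :: "'o \<Rightarrow> 'o \<Rightarrow> 'm" +
  fixes X :: 'o
  assumes X_in_Obj [simp]: "X \<in> Obj C"
begin

primrec pow :: "nat \<Rightarrow> 'o" where
  "pow 0 = I"
| "pow (Suc n) = X \<odot> pow n"

primrec pow_add :: "nat \<Rightarrow> nat \<Rightarrow> 'm" where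
  "pow_add 0 n = \<l> (pow n)"
| "pow_add (Suc m) n = (\<iota> X \<boxdot> pow_add m n) \<cdot> \<alpha> X (pow m) (pow n)"

lemma pow_in_Obj [simp]: "pow n \<in> Obj C"
  by (induction n) simp_all

lemma ty_pow_add [simp]: "pow_add m n \<Ztypecolon> pow m \<odot> pow n \<rightarrow> pow (m + n)"
  by (induction m) simp_all

lemma iso_pow_add [simp]: "iso_arr C (pow_add m n)"
  by (induction m) simp_all

lemma pow_add_0_right: "pow_add m 0 = \<r> (pow m)"
  by (induction m) (simp_all add: left_unit_eq_right_unit right_unit_tensor)

lemma pow_add_assoc:
  "pow_add (m + n) p \<cdot> (pow_add m n \<boxdot> \<iota> (pow p))
    = pow_add m (n + p) \<cdot> (\<iota> (pow m) \<boxdot> pow_add n p) \<cdot> \<alpha> (pow m) (pow n) (pow p)"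
proof (induction m)
  case 0
  show ?case by (simp add: natural left_unit_tensor)
next
  case (Suc m)
  have "pow_add (Suc m + n) p \<cdot> (pow_add (Suc m) n \<boxdot> \<iota> (pow p))
      = (\<iota> X \<boxdot> pow_add (m + n) p) \<cdot> \<alpha> X (pow (m + n)) (pow p) \<cdot> ((\<iota> X \<boxdot> pow_add m n) \<boxdot> \<iota> (pow p))
        \<cdot> (\<alpha> X (pow m) (pow n) \<boxdot> \<iota> (pow p))" by simp
  also have "\<dots> = (\<iota> X \<boxdot> (pow_add (m + n) p \<cdot> (pow_add m n \<boxdot> \<iota> (pow p))))
        \<cdot> \<alpha> X (pow m \<odot> pow n) (pow p) \<cdot> (\<alpha> X (pow m) (pow n) \<boxdot> \<iota> (pow p))"
    by (subst natural(5)) simp+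
  also have "\<dots> = (\<iota> X \<boxdot> (pow_add m (n + p) \<cdot> (\<iota> (pow m) \<boxdot> pow_add n p)))
        \<cdot> (\<iota> X \<boxdot> \<alpha> (pow m) (pow n) (pow p)) \<cdot> \<alpha> X (pow m \<odot> pow n) (pow p) \<cdot> (\<alpha> X (pow m) (pow n) \<boxdot> \<iota> (pow p))"
    by (simp add: Suc.IH)
  also have "\<dots> = (\<iota> X \<boxdot> (pow_add m (n + p) \<cdot> (\<iota> (pow m) \<boxdot> pow_add n p)))
        \<cdot> \<alpha> X (pow m) (pow n \<odot> pow p) \<cdot> \<alpha> (X \<odot> pow m) (pow n) (pow p)"
    by (subst pentagon[symmetric]) simp+
  also have "\<dots> = pow_add (Suc m) (n + p) \<cdot> (\<iota> (pow (Suc m)) \<boxdot> pow_add n p) \<cdot> \<alpha> (pow (Suc m)) (pow n) (pow p)"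
    by (simp add: natural)
  finally show ?case .
qed

text \<open>The list \<open>xs\<close> labels the summands of \<open>pow (length xs)\<close>: \<open>pull y xs\<close> moves the summand labelled \<open>y\<close> to the
  front, and \<open>rearrange xs ys\<close> brings the summands into the order \<open>ys\<close>.  The value at the empty list is never
  reached, as \<open>y\<close> always occurs in \<open>xs\<close>.\<close>
primrec pull :: "'k \<Rightarrow> 'k list \<Rightarrow> 'm" where
  "pull y [] = undefined"
| "pull y (x # xs) = (if y = x then \<iota> (pow (Suc (length xs)))
     else swap X X (pow (length (remove1 y xs))) \<cdot> (\<iota> X \<boxdot> pull y xs))"

primrec rearrange :: "'k list \<Rightarrow> 'k list \<Rightarrow> 'm" where
  "rearrange xs [] = \<iota> I"
| "rearrange xs (y # ys) = (\<iota> X \<boxdot> rearrange (remove1 y xs) ys) \<cdot> pull y xs"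

lemma ty_pull [simp]: "y \<in> set xs \<Longrightarrow> pull y xs \<Ztypecolon> pow (length xs) \<rightarrow> X \<odot> pow (length (remove1 y xs))"
  by (induction xs) auto

lemma ty_rearrange [simp]:
  "distinct xs \<Longrightarrow> distinct ys \<Longrightarrow> set xs = set ys \<Longrightarrow> rearrange xs ys \<Ztypecolon> pow (length xs) \<rightarrow> pow (length ys)"
  by (induction ys arbitrary: xs) auto

lemma rearrange_refl [simp]: "rearrange xs xs = \<iota> (pow (length xs))"
  by (induction xs) auto

text \<open>The only case that is not immediate is that of a head different from both labels; there the two sides
  differ by the Yang-Baxter equation.\<close>
lemma pull_pull:
  assumes "distinct xs" "y \<in> set xs" "z \<in> set xs" "y \<noteq> z"
  shows "swap X X (pow (length (remove1 y (remove1 z xs)))) \<cdot> (\<iota> X \<boxdot> pull z (remove1 y xs)) \<cdot> pull y xs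
    = (\<iota> X \<boxdot> pull y (remove1 z xs)) \<cdot> pull z xs"
  using assms
proof (induction xs)
  case (Cons x xs)
  consider "x = y" | "x = z" | "x \<noteq> y" "x \<noteq> z" "y \<in> set xs" "z \<in> set xs" using Cons.prems by auto
  then show ?case
  proof cases
    case 3
    let ?P = "pow (length (remove1 y (remove1 z xs)))"
    note comm = remove1_commute[of z y xs]
    note 3 = 3 \<open>y \<noteq> z\<close> \<open>y \<noteq> z\<close>[symmetric]
    have "swap X X (X \<odot> ?P) \<cdot> (\<iota> X \<boxdot> (swap X X ?P \<cdot> (\<iota> X \<boxdot> pull z (remove1 y xs))))
        \<cdot> swap X X (pow (length (remove1 y xs))) \<cdot> (\<iota> X \<boxdot> pull y xs)
      = (swap X X (X \<odot> ?P) \<cdot> (\<iota> X \<boxdot> swap X X ?P) \<cdot> swap X X (X \<odot> ?P))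
        \<cdot> (\<iota> X \<boxdot> (\<iota> X \<boxdot> pull z (remove1 y xs))) \<cdot> (\<iota> X \<boxdot> pull y xs)"
      using 3 by (simp add: swap_nat' comm del: interchange)
    also have "\<dots> = (\<iota> X \<boxdot> swap X X ?P) \<cdot> swap X X (X \<odot> ?P)
        \<cdot> (\<iota> X \<boxdot> (swap X X ?P \<cdot> (\<iota> X \<boxdot> pull z (remove1 y xs)) \<cdot> pull y xs))"
      using 3 by (subst swap_braid) (simp_all add: comm)
    also have "\<dots> = (\<iota> X \<boxdot> swap X X ?P) \<cdot> swap X X (X \<odot> ?P)
        \<cdot> (\<iota> X \<boxdot> (\<iota> X \<boxdot> pull y (remove1 z xs))) \<cdot> (\<iota> X \<boxdot> pull z xs)"
      using 3 Cons by simp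
    also have "\<dots> = (\<iota> X \<boxdot> (swap X X ?P \<cdot> (\<iota> X \<boxdot> pull y (remove1 z xs))))
        \<cdot> swap X X (pow (length (remove1 z xs))) \<cdot> (\<iota> X \<boxdot> pull z xs)"
      using 3 by (simp add: swap_nat' comm del: interchange)
    finally show ?thesis using 3 by (simp add: comm)
  qed (use Cons.prems in auto)
qed simp

text \<open>If the head \<open>y\<close> of the target is not \<open>z\<close>, then \<open>y\<close> and \<open>z\<close> are pulled out in opposite orders on the two
  sides, which \<open>pull_pull\<close> compares.\<close>
lemma pull_rearrange:
  assumes "distinct xs" "distinct ys" "set xs = set ys" "z \<in> set ys"
  shows "pull z ys \<cdot> rearrange xs ys = (\<iota> X \<boxdot> rearrange (remove1 z xs) (remove1 z ys)) \<cdot> pull z xs"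
  using assms
proof (induction ys arbitrary: xs)
  case (Cons y ys)
  note [simp] = Cons.prems(1)
  show ?case
  proof (cases "z = y")
    case True
    then show ?thesis using Cons.prems by simp
  next
    case False
    let ?P = "pow (length (remove1 z ys))"
    have z: "z \<in> set ys" using Cons.prems False by auto
    have y: "y \<in> set xs" "z \<in> set xs" "set (remove1 y xs) = set ys" "distinct (remove1 y xs)" "distinct ys"
      using Cons.prems False by auto
    have ds: "distinct (remove1 z xs)" "distinct (remove1 z ys)" "set (remove1 z xs)
        = insert y (set (remove1 z ys))"
      using Cons.prems False by auto
    have comm: "remove1 z (remove1 y xs) = remove1 y (remove1 z xs)" by (rule remove1_commute)
    let ?R = "rearrange (remove1 y (remove1 z xs)) (remove1 z ys)"
    have len: "length (remove1 y (remove1 z xs)) = length (remove1 z ys)"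
      using Cons.prems False by (metis distinct_card distinct_remove1 set_remove1_eq y comm list.set(2))
    have R [simp]: "?R \<Ztypecolon> ?P \<rightarrow> ?P"
      using y z ds Cons.prems by (subst ty_rearrange) (auto simp: comm len)
    have "pull z (y # ys) \<cdot> rearrange xs (y # ys)
        = swap X X ?P \<cdot> (\<iota> X \<boxdot> (pull z ys \<cdot> rearrange (remove1 y xs) ys)) \<cdot> pull y xs"
      using False z y by simp
    also have "\<dots> = swap X X ?P \<cdot> (\<iota> X \<boxdot> (\<iota> X \<boxdot> ?R)) \<cdot> (\<iota> X \<boxdot> pull z (remove1 y xs)) \<cdot> pull y xs"
      using Cons.IH[of "remove1 y xs"] y z False by (simp add: len comm)
    also have "\<dots> = (\<iota> X \<boxdot> (\<iota> X \<boxdot> ?R)) \<cdot> swap X X ?P \<cdot> (\<iota> X \<boxdot> pull z (remove1 y xs)) \<cdot> pull y xs"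
      using y z False by (subst swap_nat'(2)) (simp add: len comm)+
    also have "\<dots> = (\<iota> X \<boxdot> (\<iota> X \<boxdot> ?R)) \<cdot> (\<iota> X \<boxdot> pull y (remove1 z xs)) \<cdot> pull z xs"
      using pull_pull[of xs y z] y False by (simp add: len)
    also have "\<dots> = (\<iota> X \<boxdot> rearrange (remove1 z xs) (remove1 z (y # ys))) \<cdot> pull z xs"
      using y z False ds R by (simp add: comm len)
    finally show ?thesis .
  qed
qed simp

text \<open>This is the coherence theorem that makes permutations act: the result of successive rearrangements
  depends only on the initial and the final order.\<close>
lemma rearrange_trans:
  assumes "distinct xs" "distinct ys" "distinct zs" "set xs = set zs" "set ys = set zs"
  shows "rearrange ys zs \<cdot> rearrange xs ys = rearrange xs zs"
  using assms
proof (induction zs arbitrary: xs ys)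
  case (Cons z zs)
  have z: "z \<in> set xs" "z \<in> set ys" using Cons.prems by auto
  have "rearrange ys (z # zs) \<cdot> rearrange xs ys
     = (\<iota> X \<boxdot> rearrange (remove1 z ys) zs) \<cdot> (pull z ys \<cdot> rearrange xs ys)"
    using Cons.prems z by simp
  also have "\<dots> = (\<iota> X \<boxdot> (rearrange (remove1 z ys) zs \<cdot> rearrange (remove1 z xs) (remove1 z ys))) \<cdot> pull z xs"
    using Cons.prems z by (simp add: pull_rearrange)
  also have "\<dots> = rearrange xs (z # zs)"
    using Cons.prems z by (simp add: Cons.IH)
  finally show ?case .
qed simp

text \<open>Since all summands are copies of the same object, labels only serve to identify positions.\<close>
lemma rearrange_map:
  assumes "inj_on f (set xs)" "distinct xs" "distinct ys" "set ys \<subseteq> set xs"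
  shows "rearrange (map f xs) (map f ys) = rearrange xs ys"
proof -
  have pull: "pull (f y) (map f zs) = pull y zs \<and> remove1 (f y) (map f zs) = map f (remove1 y zs)"
    if "inj_on f (set zs)" "y \<in> set zs" for y zs
    using that
  proof (induction zs)
    case (Cons z zs)
    then show ?case by (cases "y = z") (auto simp: inj_on_def)
  qed simp
  show ?thesis
    using assms
  proof (induction ys arbitrary: xs)
    case (Cons y ys)
    have "inj_on f (set (remove1 y xs))" using Cons.prems by (auto simp: inj_on_def)
    then have "rearrange (map f (remove1 y xs)) (map f ys) = rearrange (remove1 y xs) ys"
      using Cons.prems by (intro Cons.IH) auto
    then show ?case using pull[of xs y] Cons.prems by simp
  qed simp
qed

lemma pull_append_left:
  assumes "y \<in> set xs" "distinct xs"
  shows "pull y (xs @ zs) \<cdot> pow_add (length xs) (length zs)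
    = (\<iota> X \<boxdot> pow_add (length (remove1 y xs)) (length zs))
      \<cdot> \<alpha> X (pow (length (remove1 y xs))) (pow (length zs)) \<cdot> (pull y xs \<boxdot> \<iota> (pow (length zs)))"
  using assms
proof (induction xs)
  case (Cons x xs)
  show ?case
  proof (cases "y = x")
    case False
    let ?n = "length xs" let ?n' = "length (remove1 y xs)" let ?m = "length zs"
    have y [simp]: "y \<in> set xs" "length (remove1 y (xs @ zs)) = ?n' + ?m" using False Cons.prems
        by (auto simp: remove1_append)
    have "pull y ((x # xs) @ zs) \<cdot> pow_add (length (x # xs)) ?m
       = swap X X (pow (?n' + ?m)) \<cdot> (\<iota> X \<boxdot> (pull y (xs @ zs) \<cdot> pow_add ?n ?m)) \<cdot> \<alpha> X (pow ?n) (pow ?m)"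
      using False by simp
    also have "\<dots> = swap X X (pow (?n' + ?m)) \<cdot> (\<iota> X \<boxdot> (\<iota> X \<boxdot> pow_add ?n' ?m))
       \<cdot> (\<iota> X \<boxdot> \<alpha> X (pow ?n') (pow ?m)) \<cdot> (\<iota> X \<boxdot> (pull y xs \<boxdot> \<iota> (pow ?m))) \<cdot> \<alpha> X (pow ?n) (pow ?m)"
      using Cons by simp
    also have "\<dots> = (\<iota> X \<boxdot> (\<iota> X \<boxdot> pow_add ?n' ?m)) \<cdot> (swap X X (pow ?n' \<odot> pow ?m)
       \<cdot> (\<iota> X \<boxdot> \<alpha> X (pow ?n') (pow ?m)) \<cdot> \<alpha> X (X \<odot> pow ?n') (pow ?m)) \<cdot> ((\<iota> X \<boxdot> pull y xs) \<boxdot> \<iota> (pow ?m))"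
      by (subst swap_nat'(2)) (simp add: natural)+
    also have "\<dots> = (\<iota> X \<boxdot> (\<iota> X \<boxdot> pow_add ?n' ?m)) \<cdot> ((\<iota> X \<boxdot> \<alpha> X (pow ?n') (pow ?m))
       \<cdot> \<alpha> X (X \<odot> pow ?n') (pow ?m) \<cdot> (swap X X (pow ?n') \<boxdot> \<iota> (pow ?m))) \<cdot> ((\<iota> X \<boxdot> pull y xs) \<boxdot> \<iota> (pow ?m))"
      by (subst swap_assoc_last) simp+
    finally show ?thesis using False by simp
  qed simp
qed simp

text \<open>Pulling \<open>y\<close> past all of \<open>xs\<close> one summand at a time amounts to a single exchange with their sum, by the
  hexagon identity.\<close>
lemma pull_append_middle:
  assumes "y \<notin> set xs"
  shows "pull y (xs @ y # zs) \<cdot> pow_add (length xs) (Suc (length zs))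
    = (\<iota> X \<boxdot> pow_add (length xs) (length zs)) \<cdot> swap (pow (length xs)) X (pow (length zs))"
  using assms
proof (induction xs)
  case Nil
  show ?case by (simp add: swap_unit)
next
  case (Cons x xs)
  let ?n = "length xs" let ?m = "length zs"
  have y [simp]: "y \<noteq> x" "length (remove1 y (xs @ y # zs)) = ?n + ?m" using Cons.prems
      by (auto simp: remove1_append)
  have "pull y ((x # xs) @ y # zs) \<cdot> pow_add (length (x # xs)) (Suc ?m)
     = swap X X (pow (?n + ?m)) \<cdot> (\<iota> X \<boxdot> (pull y (xs @ y # zs) \<cdot> pow_add ?n (Suc ?m)))
         \<cdot> \<alpha> X (pow ?n) (X \<odot> pow ?m)"
    by simp
  also have "\<dots> = swap X X (pow (?n + ?m)) \<cdot> (\<iota> X \<boxdot> (\<iota> X \<boxdot> pow_add ?n ?m)) \<cdot> (\<iota> X \<boxdot> swap (pow ?n) X (pow ?m))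
     \<cdot> \<alpha> X (pow ?n) (X \<odot> pow ?m)"
    using Cons by simp
  also have "\<dots> = (\<iota> X \<boxdot> (\<iota> X \<boxdot> pow_add ?n ?m)) \<cdot> (swap X X (pow ?n \<odot> pow ?m) \<cdot> (\<iota> X \<boxdot> swap (pow ?n) X (pow ?m))
     \<cdot> \<alpha> X (pow ?n) (X \<odot> pow ?m))"
    by (subst swap_nat'(2)) simp+
  also have "\<dots> = (\<iota> X \<boxdot> (\<iota> X \<boxdot> pow_add ?n ?m)) \<cdot> (\<iota> X \<boxdot> \<alpha> X (pow ?n) (pow ?m)) \<cdot> swap (X \<odot> pow ?n) X (pow ?m)"
    by (subst swap_tensor_first) simp+
  finally show ?case by simp
qed

lemma rearrange_append:
  assumes "distinct (xs @ zs)" "distinct (ys @ ws)" "set xs = set ys" "set zs = set ws"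
  shows "rearrange (xs @ zs) (ys @ ws) \<cdot> pow_add (length xs) (length zs)
    = pow_add (length ys) (length ws) \<cdot> (rearrange xs ys \<boxdot> rearrange zs ws)"
  using assms
proof (induction ys arbitrary: xs)
  case Nil
  then show ?case by (simp add: natural)
next
  case (Cons y ys)
  let ?n = "length (remove1 y xs)" and ?m = "length zs"
  have y [simp]: "y \<in> set xs" using Cons.prems by auto
  have rem: "remove1 y (xs @ zs) = remove1 y xs @ zs" by (simp add: remove1_append)
  have IH: "rearrange (remove1 y xs @ zs) (ys @ ws) \<cdot> pow_add ?n ?m
    = pow_add (length ys) (length ws) \<cdot> (rearrange (remove1 y xs) ys \<boxdot> rearrange zs ws)"
    using Cons.prems by (intro Cons.IH) auto
  have ty [simp]: "rearrange (remove1 y xs @ zs) (ys @ ws) \<Ztypecolon> pow (?n + ?m) \<rightarrow> pow (length (ys @ ws))"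
    "rearrange (remove1 y xs) ys \<Ztypecolon> pow ?n \<rightarrow> pow (length ys)"
    "rearrange zs ws \<Ztypecolon> pow ?m \<rightarrow> pow (length ws)"
    "pull y (xs @ zs) \<Ztypecolon> pow (length xs + ?m) \<rightarrow> X \<odot> pow (?n + ?m)"
    using Cons.prems by (subst ty_rearrange ty_pull; auto simp: rem)+
  have "rearrange (xs @ zs) ((y # ys) @ ws) \<cdot> pow_add (length xs) ?m
    = (\<iota> X \<boxdot> rearrange (remove1 y xs @ zs) (ys @ ws)) \<cdot> (pull y (xs @ zs) \<cdot> pow_add (length xs) ?m)"
    by (simp add: rem)
  also have "\<dots> = (\<iota> X \<boxdot> (rearrange (remove1 y xs @ zs) (ys @ ws) \<cdot> pow_add ?n ?m))
      \<cdot> \<alpha> X (pow ?n) (pow ?m) \<cdot> (pull y xs \<boxdot> \<iota> (pow ?m))"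
    using Cons.prems by (subst pull_append_left) simp_all
  also have "\<dots> = (\<iota> X \<boxdot> pow_add (length ys) (length ws))
      \<cdot> (\<iota> X \<boxdot> (rearrange (remove1 y xs) ys \<boxdot> rearrange zs ws)) \<cdot> \<alpha> X (pow ?n) (pow ?m)
          \<cdot> (pull y xs \<boxdot> \<iota> (pow ?m))"
    by (simp add: IH)
  also have "\<dots> = (\<iota> X \<boxdot> pow_add (length ys) (length ws)) \<cdot> \<alpha> X (pow (length ys)) (pow (length ws))
      \<cdot> ((\<iota> X \<boxdot> rearrange (remove1 y xs) ys) \<boxdot> rearrange zs ws) \<cdot> (pull y xs \<boxdot> \<iota> (pow ?m))"
    by (subst natural(5)) simp+
  also have "\<dots> = pow_add (length (y # ys)) (length ws) \<cdot> (rearrange xs (y # ys) \<boxdot> rearrange zs ws)"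
    by simp
  finally show ?case .
qed

lemma rearrange_sym:
  assumes "distinct (xs @ ys)"
  shows "rearrange (xs @ ys) (ys @ xs) \<cdot> pow_add (length xs) (length ys)
    = pow_add (length ys) (length xs) \<cdot> \<zeta> (pow (length xs)) (pow (length ys))"
  using assms
proof (induction ys)
  case Nil
  show ?case by (simp add: pow_add_0_right sym_unit)
next
  case (Cons y ys)
  let ?n = "length xs" and ?m = "length ys"
  have ty [simp]: "rearrange (xs @ ys) (ys @ xs) \<Ztypecolon> pow (?n + ?m) \<rightarrow> pow (length (ys @ xs))"
    "pull y (xs @ y # ys) \<Ztypecolon> pow (?n + Suc ?m) \<rightarrow> X \<odot> pow (?n + ?m)"
    using Cons.prems by (subst ty_rearrange ty_pull; auto simp: remove1_append)+
  have "rearrange (xs @ (y # ys)) ((y # ys) @ xs) \<cdot> pow_add ?n (Suc ?m)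
    = (\<iota> X \<boxdot> rearrange (xs @ ys) (ys @ xs)) \<cdot> (pull y (xs @ y # ys) \<cdot> pow_add ?n (Suc ?m))"
    using Cons.prems ty(2) by (simp add: remove1_append del: add_Suc_right)
  also have "\<dots> = (\<iota> X \<boxdot> (rearrange (xs @ ys) (ys @ xs) \<cdot> pow_add ?n ?m)) \<cdot> swap (pow ?n) X (pow ?m)"
    using Cons.prems by (subst pull_append_middle) simp_all
  also have "\<dots> = (\<iota> X \<boxdot> pow_add ?m ?n) \<cdot> (\<iota> X \<boxdot> \<zeta> (pow ?n) (pow ?m)) \<cdot> swap (pow ?n) X (pow ?m)"
    using Cons by simp
  also have "\<dots> = (\<iota> X \<boxdot> pow_add ?m ?n) \<cdot> \<alpha> X (pow ?m) (pow ?n) \<cdot> \<zeta> (pow ?n) (X \<odot> pow ?m)"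
    by (subst hexagon_swap[symmetric]) simp+
  finally show ?case by simp
qed

end

section \<open>Permutations of sums and products of intervals\<close>

lemma permutesI_inverse:
  assumes "finite A" "\<And>x. x \<in> A \<Longrightarrow> f x \<in> A \<and> g (f x) = x" "\<And>x. x \<notin> A \<Longrightarrow> f x = x"
  shows "f permutes A"
  by (rule inj_imp_permutes) (use assms in \<open>auto intro: inj_on_inverseI[of _ g]\<close>)

lemma interval_permutes:
  assumes "\<sigma> permutes {1..n::nat}"
  shows "\<sigma> 0 = 0" "k \<le> n \<Longrightarrow> \<sigma> k \<le> n" "1 \<le> k \<Longrightarrow> Suc 0 \<le> \<sigma> k" "n < k \<Longrightarrow> \<sigma> k = k" "\<sigma> (inv \<sigma> k) = k" "inv \<sigma> (\<sigma> k) = k"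
proof -
  have *: "\<sigma> k = k \<or> k \<in> {1..n} \<and> \<sigma> k \<in> {1..n}" for k
    using assms by (metis permutes_in_image permutes_not_in)
  show "\<sigma> 0 = 0" "k \<le> n \<Longrightarrow> \<sigma> k \<le> n" "1 \<le> k \<Longrightarrow> Suc 0 \<le> \<sigma> k" "n < k \<Longrightarrow> \<sigma> k = k"
    using *[of k] *[of 0] by auto
  show "\<sigma> (inv \<sigma> k) = k" "inv \<sigma> (\<sigma> k) = k" using permutes_inverses[OF assms] by auto
qed

lemma pair_code_bounds [simp]:
  "1 \<le> i \<Longrightarrow> Suc 0 \<le> pair_code m i j"
  "i \<le> m \<Longrightarrow> 1 \<le> j \<Longrightarrow> j \<le> n \<Longrightarrow> pair_code m i j \<le> m * n"
proof -
  show "1 \<le> i \<Longrightarrow> Suc 0 \<le> pair_code m i j" by (simp add: pair_code_def)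
  assume "i \<le> m" "1 \<le> j" "j \<le> n"
  then obtain j' where "j = Suc j'" "Suc j' \<le> n" by (cases j) auto
  then have "i + j' * m \<le> Suc j' * m" "Suc j' * m \<le> n * m"
    using \<open>i \<le> m\<close> mult_le_mono1[of "Suc j'" n m] by simp_all
  then have "i + j' * m \<le> n * m" by linarith
  then show "pair_code m i j \<le> m * n" using \<open>j = _\<close> by (simp add: pair_code_def mult.commute)
qed

text \<open>With the corresponding facts for blocks, this lets identities between permutations of sums and
  products be verified in coordinates.\<close>
lemma pair_code_cases:
  assumes "1 \<le> k" "k \<le> m * n"
  obtains i j where "k = pair_code m i j" "1 \<le> i" "i \<le> m" "1 \<le> j" "j \<le> n"
proof (rule that[of "row m k" "col m k"])
  have m: "0 < m" using assms by (cases m) auto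
  have k: "k - 1 < m * n" using assms by auto
  show "k = pair_code m (row m k) (col m k)" using assms by (simp add: pair_code_def row_def col_def)
  show "1 \<le> row m k" "row m k \<le> m" using m by (auto simp: row_def Suc_leI)
  show "1 \<le> col m k" by (simp add: col_def)
  have "(k - 1) div m < n" using k m by (simp add: less_mult_imp_div_less mult.commute)
  then show "col m k \<le> n" by (simp add: col_def)
qed

lemma block_cases:
  fixes k :: nat
  assumes "1 \<le> k" "k \<le> m + n"
  obtains "1 \<le> k" "k \<le> m" | k' where "k = m + k'" "1 \<le> k'" "k' \<le> n"
  using assms by (cases "k \<le> m") (auto intro: that(2)[of "k - m"])

lemma pair_code_simps:
  "1 \<le> j \<Longrightarrow> 1 \<le> k \<Longrightarrow> pair_code (m * n) (pair_code m i j) k = pair_code m i (pair_code n j k)"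
  "1 \<le> j \<Longrightarrow> pair_code m i (n + j) = m * n + pair_code m i j"
  "1 \<le> j \<Longrightarrow> pair_code (Suc 0) (Suc 0) j = j"
  "pair_code m i (Suc 0) = i"
  by (cases j; cases k; simp add: pair_code_def algebra_simps)+

context
  fixes m n i j :: nat
  assumes ij [simp]: "Suc 0 \<le> i" "i \<le> m" "Suc 0 \<le> j" "j \<le> n"
begin

lemma row_col_pair_code [simp]: "row m (pair_code m i j) = i" "col m (pair_code m i j) = j"
  by (simp_all add: pair_code_inverse)

lemma pair_code_range [simp]: "pair_code m i j \<in> {Suc 0..m * n}"
  using pair_code_bounds(1)[of i m j] pair_code_bounds(2)[of i m j n] by simp

lemma perm_prod_pair_code: "perm_prod m n \<sigma> \<tau> (pair_code m i j) = pair_code m (\<sigma> i) (\<tau> j)"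
  using pair_code_range by (simp add: perm_prod_def del: atLeastAtMost_iff)

lemma pair_swap_pair_code: "pair_swap m n (pair_code m i j) = pair_code n j i"
  using pair_code_range by (simp add: pair_swap_def del: atLeastAtMost_iff)

end

lemma dist_perm_pair_code:
  assumes "1 \<le> i" "1 \<le> j" "j \<le> p"
  shows "i \<le> m \<Longrightarrow> dist_perm m n p (pair_code (m + n) i j) = pair_code m i j"
    "i \<le> n \<Longrightarrow> dist_perm m n p (pair_code (m + n) (m + i) j) = m * p + pair_code n i j"
  using assms pair_code_range[of i "m + n" j p] pair_code_range[of "m + i" "m + n" j p]
  by (simp_all add: dist_perm_def Let_def del: atLeastAtMost_iff)

lemma block_sum_simps:
  "k \<le> m \<Longrightarrow> block_sum m \<sigma> \<tau> k = \<sigma> k" "1 \<le> k \<Longrightarrow> block_sum m \<sigma> \<tau> (m + k) = m + \<tau> k"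
  by (simp_all add: block_sum_def)

lemma block_swap_simps:
  "1 \<le> k \<Longrightarrow> k \<le> m \<Longrightarrow> block_swap m n k = n + k" "1 \<le> k \<Longrightarrow> k \<le> n \<Longrightarrow> block_swap m n (m + k) = k"
  by (simp_all add: block_swap_def)

lemma off_range:
  assumes "\<not> (1 \<le> k \<and> k \<le> N)"
  shows "m * n = N \<Longrightarrow> perm_prod m n \<sigma> \<tau> k = k" "m * n = N \<Longrightarrow> pair_swap m n k = k"
    "(m + n) * p = N \<Longrightarrow> dist_perm m n p k = k" "m + n = N \<Longrightarrow> block_swap m n k = k"
    "m + n = N \<Longrightarrow> \<sigma> permutes {1..m} \<Longrightarrow> \<tau> permutes {1..n} \<Longrightarrow> block_sum m \<sigma> \<tau> k = k"
proof -
  show "m * n = N \<Longrightarrow> perm_prod m n \<sigma> \<tau> k = k" "m * n = N \<Longrightarrow> pair_swap m n k = k"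
    "(m + n) * p = N \<Longrightarrow> dist_perm m n p k = k" "m + n = N \<Longrightarrow> block_swap m n k = k"
    using assms by (auto simp: perm_prod_def pair_swap_def dist_perm_def block_swap_def)
  assume "m + n = N" "\<sigma> permutes {1..m}" "\<tau> permutes {1..n}"
  then show "block_sum m \<sigma> \<tau> k = k"
    using assms interval_permutes(1)[of \<sigma> m] interval_permutes(4)[of \<tau> n "k - m"] by (cases "k
        = 0") (auto simp: block_sum_def)
qed

lemma permutes_block_sum:
  assumes "\<sigma> permutes {1..m}" "\<tau> permutes {1..n}" shows "block_sum m \<sigma> \<tau> permutes {1..m + n}"
proof (rule permutesI_inverse)
  fix k assume "k \<in> {1..m + n}"
  then have "1 \<le> k" "k \<le> m + n" by auto
  then show "block_sum m \<sigma> \<tau> k \<in> {1..m + n} \<and> block_sum m (inv \<sigma>) (inv \<tau>) (block_sum m \<sigma> \<tau> k) = k"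
    by (rule block_cases) (use interval_permutes[OF assms(1)] interval_permutes[OF assms(2)]
        in \<open>auto simp: block_sum_simps trans_le_add1 trans_le_add2\<close>)
qed (auto intro: off_range(5) assms)

lemma permutes_block_swap: "block_swap m n permutes {1..m + n}"
proof (rule permutesI_inverse)
  fix k assume "k \<in> {1..m + n}"
  then have "1 \<le> k" "k \<le> m + n" by auto
  then show "block_swap m n k \<in> {1..m + n} \<and> block_swap n m (block_swap m n k) = k"
    by (rule block_cases) (auto simp: block_swap_simps)
qed (auto intro: off_range(4))

lemma permutes_perm_prod:
  assumes "\<sigma> permutes {1..m}" "\<tau> permutes {1..n}" shows "perm_prod m n \<sigma> \<tau> permutes {1..m * n}"
proof (rule permutesI_inverse)
  fix k assume "k \<in> {1..m * n}"
  then have "1 \<le> k" "k \<le> m * n" by auto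
  then show "perm_prod m n \<sigma> \<tau> k \<in> {1..m * n} \<and> perm_prod m n (inv \<sigma>) (inv \<tau>) (perm_prod m n \<sigma> \<tau> k) = k"
    by (rule pair_code_cases) (use interval_permutes[OF assms(1)] interval_permutes[OF assms(2)]
        in \<open>auto simp: perm_prod_pair_code\<close>)
qed (auto intro: off_range(1))

lemma permutes_pair_swap: "pair_swap m n permutes {1..m * n}"
proof (rule permutesI_inverse)
  fix k assume "k \<in> {1..m * n}"
  then have "1 \<le> k" "k \<le> m * n" by auto
  then show "pair_swap m n k \<in> {1..m * n} \<and> pair_swap n m (pair_swap m n k) = k"
    using pair_code_bounds(2)[of _ n _ m] by (rule_tac pair_code_cases) (auto simp: pair_swap_pair_code
        mult.commute)
qed (auto intro: off_range(2))

text \<open>The inverse decodes a number in the first block \<open>{1..m p}\<close> with \<open>m\<close> rows, and one in the second block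
  with \<open>n\<close> rows.\<close>
lemma permutes_dist_perm: "dist_perm m n p permutes {1..(m + n) * p}"
proof (rule permutesI_inverse)
  let ?g = "\<lambda>l. if l \<le> m * p then pair_code (m + n) (row m l) (col m l)
    else pair_code (m + n) (m + row n (l - m * p)) (col n (l - m * p))"
  fix k assume "k \<in> {1..(m + n) * p}"
  then obtain i j where k: "k = pair_code (m + n) i j" "1 \<le> j" "j \<le> p" "1 \<le> i" "i \<le> m + n"
    by (metis pair_code_cases atLeastAtMost_iff)
  from k(4,5) show "dist_perm m n p k \<in> {1..(m + n) * p} \<and> ?g (dist_perm m n p k) = k"
  proof (cases rule: block_cases)
    case 1
    have "pair_code m i j \<le> m * p" using 1 k by simp
    then show ?thesis using 1 k by (auto simp: dist_perm_pair_code add_mult_distrib trans_le_add1)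
  next
    case (2 i')
    have "pair_code n i' j \<le> n * p" "0 < pair_code n i' j"
      using 2 k pair_code_bounds(1)[of i' n j] by (auto simp: Suc_le_eq)
    then show ?thesis using 2 k by (auto simp: dist_perm_pair_code add_mult_distrib trans_le_add1)
  qed
qed (auto intro: off_range(3))

lemma Sigma_simps [simp]:
  "Obj Sigma_category = UNIV"
  "f \<in> Arr Sigma_category \<longleftrightarrow> snd f permutes {1..fst f}"
  "Dom Sigma_category = fst" "Cod Sigma_category = fst"
  "Ident Sigma_category n = (n, id)"
  "Comp Sigma_category g f = (fst f, snd g \<circ> snd f)"
  "tObj (Additive Sigma_category) m n = m + n"
  "tArr (Additive Sigma_category) f g = (fst f + fst g, block_sum (fst f) (snd f) (snd g))"
  "tUnit (Additive Sigma_category) = 0"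
  "tAssoc (Additive Sigma_category) m n p = (m + n + p, id)"
  "tLeft (Additive Sigma_category) n = (n, id)"
  "tRight (Additive Sigma_category) n = (n, id)"
  "add_sym Sigma_category m n = (m + n, block_swap m n)"
  "tObj (Multiplicative Sigma_category) m n = m * n"
  "tArr (Multiplicative Sigma_category) f g = (fst f * fst g, perm_prod (fst f) (fst g) (snd f) (snd g))"
  "tUnit (Multiplicative Sigma_category) = 1"
  "tAssoc (Multiplicative Sigma_category) m n p = (m * n * p, id)"
  "tLeft (Multiplicative Sigma_category) n = (n, id)"
  "tRight (Multiplicative Sigma_category) n = (n, id)"
  "left_null Sigma_category n = (0, id)"
  "right_null Sigma_category n = (0, id)"
  "left_dist Sigma_category m n p = (m * (n + p), id)"
  "right_dist Sigma_category m n p = ((m + n) * p, dist_perm m n p)"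
  "mult_sym Sigma_category m n = (m * n, pair_swap m n)"
  by (auto simp: Sigma_category_def split: prod.splits)

interpretation Sigma: category Sigma_category
  by unfold_locales (auto simp: hom_def permutes_id intro: permutes_compose)

lemma Sigma_iso: "f \<in> Arr Sigma_category \<Longrightarrow> iso_arr Sigma_category f"
  unfolding iso_arr_def inverse_arrows_def
  by (rule exI[of _ "(fst f, inv (snd f))"]) (auto simp: hom_def permutes_inv permutes_inv_o)

lemma Sigma_mono: "f \<in> Arr Sigma_category \<Longrightarrow> mono_arr Sigma_category f"
proof -
  assume f: "f \<in> Arr Sigma_category"
  then have "inj (snd f)" by (simp add: permutes_inj)
  then show ?thesis using f unfolding mono_arr_def by (auto simp: fun_eq_iff prod_eq_iff inj_eq)
qed


lemma perm_eqI:
  assumes "f permutes {1..N}" "g permutes {1..N}" "\<And>k. 1 \<le> k \<Longrightarrow> k \<le> N \<Longrightarrow> f k = g k"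
  shows "f = g"
proof
  fix k show "f k = g k"
    using assms(3)[of k] permutes_not_in[OF assms(1), of k] permutes_not_in[OF assms(2), of k]
    by (cases "1 \<le> k \<and> k \<le> N") auto
qed

lemma permutes_intros:
  "\<sigma> permutes {1..m} \<Longrightarrow> \<tau> permutes {1..n} \<Longrightarrow> m + n = N \<Longrightarrow> block_sum m \<sigma> \<tau> permutes {1..N}"
  "m + n = N \<Longrightarrow> block_swap m n permutes {1..N}"
  "\<sigma> permutes {1..m} \<Longrightarrow> \<tau> permutes {1..n} \<Longrightarrow> m * n = N \<Longrightarrow> perm_prod m n \<sigma> \<tau> permutes {1..N}"
  "m * n = N \<Longrightarrow> pair_swap m n permutes {1..N}"
  "(m + n) * p = N \<Longrightarrow> dist_perm m n p permutes {1..N}"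
  using permutes_block_sum permutes_block_swap permutes_perm_prod permutes_pair_swap permutes_dist_perm by auto

lemmas permutes_intros' = permutes_intros permutes_compose permutes_id

lemmas code_simps = perm_prod_pair_code pair_swap_pair_code dist_perm_pair_code
  block_sum_simps block_swap_simps pair_code_simps

lemma block_sum_id [simp]: "block_sum m id id = id"
  by (auto simp: block_sum_def)

lemma block_sum_comp:
  assumes "\<sigma> permutes {1..m}" "\<tau> permutes {1..n}" "\<sigma>' permutes {1..m}" "\<tau>' permutes {1..n}"
  shows "block_sum m (\<sigma>' \<circ> \<sigma>) (\<tau>' \<circ> \<tau>) = block_sum m \<sigma>' \<tau>' \<circ> block_sum m \<sigma> \<tau>"
proof (rule perm_eqI[of _ "m + n"])
  fix k assume "1 \<le> k" "k \<le> m + n"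
  then show "block_sum m (\<sigma>' \<circ> \<sigma>) (\<tau>' \<circ> \<tau>) k = (block_sum m \<sigma>' \<tau>' \<circ> block_sum m \<sigma> \<tau>) k"
    by (rule block_cases) (use interval_permutes[OF assms(1)] interval_permutes[OF assms(2)]
        in \<open>auto simp: block_sum_simps\<close>)
qed (rule permutes_intros' assms refl | simp add: algebra_simps)+

lemma block_sum_assoc:
  assumes "\<sigma> permutes {1..m}" "\<tau> permutes {1..n}"
  shows "block_sum (m + n) (block_sum m \<sigma> \<tau>) \<upsilon> = block_sum m \<sigma> (block_sum n \<tau> \<upsilon>)"
  using interval_permutes[OF assms(1)] interval_permutes[OF assms(2)]
  by (auto simp: block_sum_def fun_eq_iff)

lemma block_sum_zero:
  assumes "\<sigma> permutes {1..m}" shows "block_sum 0 id \<sigma> = \<sigma>" "block_sum m \<sigma> id = \<sigma>"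
  using interval_permutes[OF assms] by (auto simp: block_sum_def fun_eq_iff)

lemma perm_prod_id [simp]: "perm_prod m n id id = id"
proof (rule perm_eqI[of _ "m * n"])
  fix k assume "1 \<le> k" "k \<le> m * n"
  then show "perm_prod m n id id k = id k"
    by (rule pair_code_cases) (simp add: perm_prod_pair_code)
qed (rule permutes_intros' refl | simp add: algebra_simps)+

lemma perm_prod_comp:
  assumes "\<sigma> permutes {1..m}" "\<tau> permutes {1..n}" "\<sigma>' permutes {1..m}" "\<tau>' permutes {1..n}"
  shows "perm_prod m n (\<sigma>' \<circ> \<sigma>) (\<tau>' \<circ> \<tau>) = perm_prod m n \<sigma>' \<tau>' \<circ> perm_prod m n \<sigma> \<tau>"
proof (rule perm_eqI[of _ "m * n"])
  fix k assume "1 \<le> k" "k \<le> m * n"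
  then show "perm_prod m n (\<sigma>' \<circ> \<sigma>) (\<tau>' \<circ> \<tau>) k = (perm_prod m n \<sigma>' \<tau>' \<circ> perm_prod m n \<sigma> \<tau>) k"
    by (rule pair_code_cases) (use interval_permutes[OF assms(1)] interval_permutes[OF assms(2)]
        in \<open>auto simp: perm_prod_pair_code\<close>)
qed (rule permutes_intros' assms refl | simp add: algebra_simps)+

lemma triple_code_cases:
  assumes "1 \<le> k" "k \<le> (m * n) * p"
  obtains a b c where "k = pair_code (m * n) (pair_code m a b) c" "1 \<le> a" "a \<le> m" "1 \<le> b" "b \<le> n" "1 \<le> c" "c
      \<le> p"
  using assms by (metis pair_code_cases)

lemma sum_prod_code_cases:
  assumes "1 \<le> k" "k \<le> (m + n) * p"
  obtains i j where "k = pair_code (m + n) i j" "1 \<le> i" "i \<le> m" "1 \<le> j" "j \<le> p"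
    | i j where "k = pair_code (m + n) (m + i) j" "1 \<le> i" "i \<le> n" "1 \<le> j" "j \<le> p"
  using assms by (metis pair_code_cases block_cases)

lemma prod_sum_code_cases:
  assumes "1 \<le> k" "k \<le> m * (n + p)"
  obtains i j where "k = pair_code m i j" "1 \<le> i" "i \<le> m" "1 \<le> j" "j \<le> n"
    | i j where "k = pair_code m i (n + j)" "1 \<le> i" "i \<le> m" "1 \<le> j" "j \<le> p"
  using assms by (metis pair_code_cases block_cases)

lemma perm_prod_assoc:
  assumes "\<sigma> permutes {1..m}" "\<tau> permutes {1..n}" "\<upsilon> permutes {1..p}"
  shows "perm_prod (m * n) p (perm_prod m n \<sigma> \<tau>) \<upsilon> = perm_prod m (n * p) \<sigma> (perm_prod n p \<tau> \<upsilon>)"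
proof (rule perm_eqI[of _ "m * n * p"])
  fix k assume "1 \<le> k" "k \<le> m * n * p"
  then show "perm_prod (m * n) p (perm_prod m n \<sigma> \<tau>) \<upsilon> k = perm_prod m (n * p) \<sigma> (perm_prod n p \<tau> \<upsilon>) k"
  proof (rule triple_code_cases)
    fix a b c assume k: "k = pair_code (m * n) (pair_code m a b) c" "1 \<le> a" "a \<le> m" "1 \<le> b" "b \<le> n" "1 \<le> c"
        "c \<le> p"
    have "perm_prod (m * n) p (perm_prod m n \<sigma> \<tau>) \<upsilon> k = pair_code (m * n) (pair_code m (\<sigma> a) (\<tau> b)) (\<upsilon> c)"
      using k by (simp add: perm_prod_pair_code)
    also have "\<dots> = perm_prod m (n * p) \<sigma> (perm_prod n p \<tau> \<upsilon>) (pair_code m a (pair_code n b c))"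
      using k interval_permutes[OF assms(2)] interval_permutes[OF assms(3)] by (simp add: code_simps)
    finally show ?thesis using k by (simp add: code_simps)
  qed
qed (rule permutes_intros' assms refl mult.assoc[symmetric] | simp add: algebra_simps)+

lemma perm_prod_one:
  assumes "\<sigma> permutes {1..m}" shows "perm_prod (Suc 0) m id \<sigma> = \<sigma>" "perm_prod m (Suc 0) \<sigma> id = \<sigma>"
proof -
  show "perm_prod (Suc 0) m id \<sigma> = \<sigma>"
  proof (rule perm_eqI[of _ m])
    fix k assume k: "1 \<le> k" "k \<le> m"
    then show "perm_prod (Suc 0) m id \<sigma> k = \<sigma> k"
      using perm_prod_pair_code[of 1 1 k m id \<sigma>] interval_permutes[OF assms] by (simp add: code_simps)
  qed (simp_all add: permutes_intros assms permutes_id[of "{1..1}", simplified] flip: One_nat_def)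
  show "perm_prod m (Suc 0) \<sigma> id = \<sigma>"
  proof (rule perm_eqI[of _ m])
    fix k assume k: "1 \<le> k" "k \<le> m"
    then show "perm_prod m (Suc 0) \<sigma> id k = \<sigma> k"
      using perm_prod_pair_code[of k m 1 1 \<sigma> id] interval_permutes[OF assms] by (simp add: code_simps)
  qed (auto intro!: permutes_intros' assms simp del: One_nat_def)
qed

lemma block_swap_natural:
  assumes "\<sigma> permutes {1..m}" "\<tau> permutes {1..n}"
  shows "block_swap m n \<circ> block_sum m \<sigma> \<tau> = block_sum n \<tau> \<sigma> \<circ> block_swap m n"
proof (rule perm_eqI[of _ "m + n"])
  fix k assume "1 \<le> k" "k \<le> m + n"
  then show "(block_swap m n \<circ> block_sum m \<sigma> \<tau>) k = (block_sum n \<tau> \<sigma> \<circ> block_swap m n) k"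
    by (rule block_cases) (use interval_permutes[OF assms(1)] interval_permutes[OF assms(2)]
        in \<open>auto simp: code_simps\<close>)
qed (rule permutes_intros' assms refl add.commute | simp add: algebra_simps)+

lemma block_swap_simp [simp]: "block_swap n m \<circ> block_swap m n = id" "block_swap m 0 = id" "block_swap 0 m = id"
  by (auto simp: block_swap_def fun_eq_iff)

lemma block_swap_hexagon:
  "block_swap m (n + p) = block_sum n id (block_swap m p) \<circ> block_sum (m + n) (block_swap m n) id"
  by (auto simp: block_swap_def block_sum_def fun_eq_iff)

lemma pair_swap_natural:
  assumes "\<sigma> permutes {1..m}" "\<tau> permutes {1..n}"
  shows "pair_swap m n \<circ> perm_prod m n \<sigma> \<tau> = perm_prod n m \<tau> \<sigma> \<circ> pair_swap m n"
proof (rule perm_eqI[of _ "m * n"])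
  fix k assume "1 \<le> k" "k \<le> m * n"
  then show "(pair_swap m n \<circ> perm_prod m n \<sigma> \<tau>) k = (perm_prod n m \<tau> \<sigma> \<circ> pair_swap m n) k"
    by (rule pair_code_cases) (use interval_permutes[OF assms(1)] interval_permutes[OF assms(2)]
        in \<open>auto simp: code_simps\<close>)
qed (rule permutes_intros' assms refl mult.commute | simp add: algebra_simps)+

lemma pair_swap_simp [simp]: "pair_swap n m \<circ> pair_swap m n = id"
proof (rule perm_eqI[of _ "m * n"])
  fix k assume "1 \<le> k" "k \<le> m * n"
  then show "(pair_swap n m \<circ> pair_swap m n) k = id k"
    by (rule pair_code_cases) (simp add: code_simps)
qed (rule permutes_intros' refl mult.commute | simp add: algebra_simps)+

lemma pair_swap_one: "pair_swap m (Suc 0) = id"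
proof (rule perm_eqI[of _ m])
  fix k assume "1 \<le> k" "k \<le> m"
  then show "pair_swap m (Suc 0) k = id k"
    using pair_swap_pair_code[of k m 1 1] by (simp add: code_simps)
qed (use permutes_pair_swap[of m 1] permutes_id in auto)

lemma pair_swap_hexagon:
  "pair_swap m (n * p) = perm_prod n (m * p) id (pair_swap m p) \<circ> perm_prod (m * n) p (pair_swap m n) id"
proof (rule perm_eqI[of _ "m * n * p"])
  fix k assume "1 \<le> k" "k \<le> m * n * p"
  then show "pair_swap m (n * p) k = (perm_prod n (m * p) id (pair_swap m p) \<circ> perm_prod (m * n) p
      (pair_swap m n) id) k"
  proof (rule triple_code_cases)
    fix a b c assume k: "k = pair_code (m * n) (pair_code m a b) c" "1 \<le> a" "a \<le> m" "1 \<le> b" "b \<le> n" "1 \<le> c"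
        "c \<le> p"
    have "pair_swap m (n * p) k = pair_code (n * p) (pair_code n b c) a"
      using k by (simp add: code_simps)
    moreover have "perm_prod (m * n) p (pair_swap m n) id k = pair_code (n * m) (pair_code n b a) c"
      using k by (simp add: perm_prod_pair_code pair_swap_pair_code mult.commute)
    ultimately show ?thesis using k by (simp add: code_simps)
  qed
qed (rule permutes_intros' refl | simp add: algebra_simps)+


lemma perm_prod_pair_code_right:
  assumes "1 \<le> i" "i \<le> m" "1 \<le> j" "j \<le> p"
  shows "perm_prod m (n + p) \<sigma> \<tau> (m * n + pair_code m i j) = pair_code m (\<sigma> i) (\<tau> (n + j))"
  using assms perm_prod_pair_code[of i m "n + j" "n + p" \<sigma> \<tau>] by (simp add: pair_code_simps)

lemma perm_prod_block_sum:
  assumes "\<sigma> permutes {1..m}" "\<tau> permutes {1..n}" "\<upsilon> permutes {1..p}"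
  shows "perm_prod m (n + p) \<sigma> (block_sum n \<tau> \<upsilon>) = block_sum (m * n) (perm_prod m n \<sigma> \<tau>) (perm_prod m p \<sigma> \<upsilon>)"
proof (rule perm_eqI[of _ "m * (n + p)"])
  fix k assume "1 \<le> k" "k \<le> m * (n + p)"
  then show "perm_prod m (n + p) \<sigma> (block_sum n \<tau> \<upsilon>) k
      = block_sum (m * n) (perm_prod m n \<sigma> \<tau>) (perm_prod m p \<sigma> \<upsilon>) k"
    by (rule prod_sum_code_cases)
      (use interval_permutes[OF assms(1)] interval_permutes[OF assms(2)] interval_permutes[OF assms(3)]
          in \<open>auto simp: code_simps perm_prod_pair_code_right\<close>)
qed (rule permutes_intros' assms refl | simp add: algebra_simps)+

lemma dist_perm_natural:
  assumes "\<sigma> permutes {1..m}" "\<tau> permutes {1..n}" "\<upsilon> permutes {1..p}"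
  shows "dist_perm m n p \<circ> perm_prod (m + n) p (block_sum m \<sigma> \<tau>) \<upsilon>
    = block_sum (m * p) (perm_prod m p \<sigma> \<upsilon>) (perm_prod n p \<tau> \<upsilon>) \<circ> dist_perm m n p"
proof (rule perm_eqI[of _ "(m + n) * p"])
  fix k assume "1 \<le> k" "k \<le> (m + n) * p"
  then show "(dist_perm m n p \<circ> perm_prod (m + n) p (block_sum m \<sigma> \<tau>) \<upsilon>) k
    = (block_sum (m * p) (perm_prod m p \<sigma> \<upsilon>) (perm_prod n p \<tau> \<upsilon>) \<circ> dist_perm m n p) k"
    by (rule sum_prod_code_cases)
      (use interval_permutes[OF assms(1)] interval_permutes[OF assms(2)] interval_permutes[OF assms(3)]
          in \<open>auto simp: code_simps\<close>)
qed (rule permutes_intros' assms refl | simp add: algebra_simps)+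

lemma perm_prod_block_swap: "perm_prod m (n + p) id (block_swap n p) = block_swap (m * n) (m * p)"
proof (rule perm_eqI[of _ "m * (n + p)"])
  fix k assume "1 \<le> k" "k \<le> m * (n + p)"
  then show "perm_prod m (n + p) id (block_swap n p) k = block_swap (m * n) (m * p) k"
    by (rule prod_sum_code_cases) (auto simp: code_simps perm_prod_pair_code_right)
qed (rule permutes_intros' refl | simp add: algebra_simps)+

lemma dist_perm_block_swap:
  "dist_perm n m p \<circ> perm_prod (m + n) p (block_swap m n) id = block_swap (m * p) (n * p) \<circ> dist_perm m n p"
proof (rule perm_eqI[of _ "(m + n) * p"])
  fix k assume "1 \<le> k" "k \<le> (m + n) * p"
  then show "(dist_perm n m p \<circ> perm_prod (m + n) p (block_swap m n) id) k
    = (block_swap (m * p) (n * p) \<circ> dist_perm m n p) k"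
    by (rule sum_prod_code_cases)
      (auto simp: perm_prod_pair_code block_swap_simps add.commute[of m n] dist_perm_pair_code block_swap_simps,
       auto simp: dist_perm_pair_code block_swap_simps add.commute[of n m])
qed (rule permutes_intros' refl | simp add: algebra_simps)+

lemma pair_swap_sum: "pair_swap (m + n) p = block_sum (m * p) (pair_swap m p) (pair_swap n p) \<circ> dist_perm m n p"
proof (rule perm_eqI[of _ "(m + n) * p"])
  fix k assume "1 \<le> k" "k \<le> (m + n) * p"
  then show "pair_swap (m + n) p k = (block_sum (m * p) (pair_swap m p) (pair_swap n p) \<circ> dist_perm m n p) k"
    by (rule sum_prod_code_cases) (auto simp: code_simps mult.commute)
qed (rule permutes_intros' refl | simp add: algebra_simps)+

lemma dist_perm_add_assoc:
  "block_sum (m * q + n * q) (dist_perm m n q) id \<circ> dist_perm (m + n) p q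
    = block_sum (m * q) id (dist_perm n p q) \<circ> dist_perm m (n + p) q"
proof (rule perm_eqI[of _ "(m + n + p) * q"])
  fix k assume "1 \<le> k" "k \<le> (m + n + p) * q"
  then show "(block_sum (m * q + n * q) (dist_perm m n q) id \<circ> dist_perm (m + n) p q) k
    = (block_sum (m * q) id (dist_perm n p q) \<circ> dist_perm m (n + p) q) k"
  proof (rule sum_prod_code_cases)
    fix i j assume k: "k = pair_code (m + n + p) i j" "1 \<le> i" "i \<le> m + n" "1 \<le> j" "j \<le> q"
    have b: "pair_code (m + n) i j \<le> m * q + n * q"
      using pair_code_bounds(2)[of i "m + n" j q] k by (simp add: algebra_simps)
    from k(2,3) show ?thesis
      by (rule block_cases) (use k b in \<open>auto simp: code_simps trans_le_add1 add.assoc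
          dist_perm_pair_code[where m = "m + n", unfolded add.assoc]\<close>)
  next
    fix i j assume k: "k = pair_code (m + n + p) (m + n + i) j" "1 \<le> i" "i \<le> p" "1 \<le> j" "j \<le> q"
    then have "dist_perm (m + n) p q k = (m * q + n * q) + pair_code p i j"
      by (simp add: dist_perm_pair_code(2) add_mult_distrib)
    moreover have "dist_perm m (n + p) q k = m * q + pair_code (n + p) (n + i) j"
      using k dist_perm_pair_code(2)[of "n + i" j q "n + p" m] by (simp add: add.assoc)
    moreover have "1 \<le> pair_code p i j" using k by simp
    ultimately show ?thesis using k block_sum_simps(2)[of "pair_code p i j" "m * q + n * q"]
      by (simp add: block_sum_simps(2)[of _ "m * q"] dist_perm_pair_code)
  qed
qed (rule permutes_intros' refl | simp add: algebra_simps)+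

lemma dist_perm_mult_assoc:
  "dist_perm (m * p) (n * p) q \<circ> perm_prod ((m + n) * p) q (dist_perm m n p) id = dist_perm m n (p * q)"
proof (rule perm_eqI[of _ "(m + n) * p * q"])
  fix k assume "1 \<le> k" "k \<le> (m + n) * p * q"
  then show "(dist_perm (m * p) (n * p) q \<circ> perm_prod ((m + n) * p) q (dist_perm m n p) id) k
      = dist_perm m n (p * q) k"
  proof (rule triple_code_cases)
    fix a b c assume k: "k = pair_code ((m + n) * p) (pair_code (m + n) a b) c" "1 \<le> a" "a \<le> m + n" "1 \<le> b"
        "b \<le> p" "1 \<le> c" "c \<le> q"
    have R: "dist_perm m n (p * q) k = dist_perm m n (p * q) (pair_code (m + n) a (pair_code p b c))"
      using k by (simp add: pair_code_simps)
    have L: "perm_prod ((m + n) * p) q (dist_perm m n p) id k = pair_code (m * p + n * p) (dist_perm m n p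
        (pair_code (m + n) a b)) c"
      using k by (simp add: perm_prod_pair_code) (simp add: add_mult_distrib)
    have bd: "1 \<le> pair_code p b c" "pair_code p b c \<le> p * q" using k by auto
    from k(2,3) show ?thesis
    proof (rule block_cases)
      assume a: "1 \<le> a" "a \<le> m"
      then show ?thesis using k L R bd by (simp add: dist_perm_pair_code(1) pair_code_simps)
    next
      fix a' assume a: "a = m + a'" "1 \<le> a'" "a' \<le> n"
      then show ?thesis using k L R bd by (simp add: dist_perm_pair_code(2) pair_code_simps)
    qed
  qed
qed (rule permutes_intros' refl | simp add: algebra_simps)+

lemma perm_prod_dist_perm: "dist_perm (m * n) (m * p) q = perm_prod m ((n + p) * q) id (dist_perm n p q)"
proof (rule perm_eqI[of _ "m * ((n + p) * q)"])
  fix k assume "1 \<le> k" "k \<le> m * ((n + p) * q)"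
  then have k: "1 \<le> k" "k \<le> m * (n + p) * q" by (simp_all add: mult.assoc)
  then show "dist_perm (m * n) (m * p) q k = perm_prod m ((n + p) * q) id (dist_perm n p q) k"
  proof (rule triple_code_cases)
    fix a b c assume k: "k = pair_code (m * (n + p)) (pair_code m a b) c" "1 \<le> a" "a \<le> m" "1 \<le> b" "b \<le> n +
        p" "1 \<le> c" "c \<le> q"
    have R: "perm_prod m ((n + p) * q) id (dist_perm n p q) k = pair_code m a (dist_perm n p q (pair_code (n
        + p) b c))"
      using k by (simp add: pair_code_simps perm_prod_pair_code)
    have L: "dist_perm (m * n) (m * p) q k = dist_perm (m * n) (m * p) q (pair_code (m * n + m * p)
        (pair_code m a b) c)"
      using k by (simp add: add_mult_distrib2)
    from k(4,5) show ?thesis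
    proof (rule block_cases)
      assume b: "1 \<le> b" "b \<le> n"
      then show ?thesis using k L R by (simp add: dist_perm_pair_code(1) pair_code_simps)
    next
      fix b' assume b: "b = n + b'" "1 \<le> b'" "b' \<le> p"
      then show ?thesis using k L R pair_code_bounds(1)[of b' p c]
        by (simp add: dist_perm_pair_code(2) pair_code_simps mult.assoc[symmetric])
    qed
  qed
qed (rule permutes_intros' refl | simp add: algebra_simps)+

lemma dist_perm_sum:
  "block_sum (m * p) id (block_sum (m * q + n * p) (block_swap (m * q) (n * p)) id) \<circ> dist_perm m n (p + q)
    = block_sum ((m + n) * p) (dist_perm m n p) (dist_perm m n q)"
proof (rule perm_eqI[of _ "(m + n) * (p + q)"])
  fix k assume "1 \<le> k" "k \<le> (m + n) * (p + q)"
  then show "(block_sum (m * p) id (block_sum (m * q + n * p) (block_swap (m * q) (n * p)) id) \<circ> dist_perm m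
      n (p + q)) k
    = block_sum ((m + n) * p) (dist_perm m n p) (dist_perm m n q) k"
  proof (rule prod_sum_code_cases)
    fix i j assume k: "k = pair_code (m + n) i j" "1 \<le> i" "i \<le> m + n" "1 \<le> j" "j \<le> p"
    then have R: "block_sum ((m + n) * p) (dist_perm m n p) (dist_perm m n q) k
        = dist_perm m n p (pair_code (m + n) i j)"
      by (simp add: block_sum_simps)
    from k(2,3) show ?thesis
    proof (rule block_cases)
      assume "1 \<le> i" "i \<le> m"
      then show ?thesis using k R by (simp add: dist_perm_pair_code(1) block_sum_simps)
    next
      fix i' assume i: "i = m + i'" "1 \<le> i'" "i' \<le> n"
      have b: "1 \<le> pair_code n i' j" "pair_code n i' j \<le> n * p" using i k by auto
      have "dist_perm m n (p + q) k = m * p + (m * q + pair_code n i' j)"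
        using i k by (simp add: dist_perm_pair_code(2) add_mult_distrib2)
      moreover have "block_swap (m * q) (n * p) (m * q + pair_code n i' j) = pair_code n i' j"
        "block_sum (m * q + n * p) (block_swap (m * q) (n * p)) id (m * q + pair_code n i' j)
          = block_swap (m * q) (n * p) (m * q + pair_code n i' j)"
        using b by (simp_all add: block_swap_simps(2) block_sum_simps(1))
      moreover have "block_sum (m * p) id (block_sum (m * q + n * p) (block_swap (m * q) (n * p)) id)
          (m * p + (m * q + pair_code n i' j))
        = m * p + block_sum (m * q + n * p) (block_swap (m * q) (n * p)) id (m * q + pair_code n i' j)"
        using b by (intro block_sum_simps(2)) simp
      ultimately show ?thesis using R i k by (simp only: comp_apply) (simp add: dist_perm_pair_code(2))
    qed
  next
    fix i j assume k: "k = pair_code (m + n) i (p + j)" "1 \<le> i" "i \<le> m + n" "1 \<le> j" "j \<le> q"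
    then have R: "block_sum ((m + n) * p) (dist_perm m n p) (dist_perm m n q) k
        = m * p + n * p + dist_perm m n q (pair_code (m + n) i j)"
      by (simp add: pair_code_simps block_sum_simps add_mult_distrib)
    from k(2,3) show ?thesis
    proof (rule block_cases)
      assume i: "1 \<le> i" "i \<le> m"
      have b: "1 \<le> pair_code m i j" "pair_code m i j \<le> m * q" using i k by auto
      have "dist_perm m n (p + q) k = m * p + pair_code m i j"
        using i k dist_perm_pair_code(1)[of i "p + j" "p + q" m n] pair_code_simps(2)[of j m i p] by simp
      then show ?thesis using b R i k
        by (simp add: block_sum_simps trans_le_add1 block_swap_simps dist_perm_pair_code(1))
    next
      fix i' assume i: "i = m + i'" "1 \<le> i'" "i' \<le> n"
      have b: "1 \<le> pair_code n i' j" using i k by auto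
      have "dist_perm m n (p + q) k = m * p + (m * q + n * p + pair_code n i' j)"
        using i k dist_perm_pair_code(2)[of i' "p + j" "p + q" n m] pair_code_simps(2)[of j n i' p]
        by (simp add: add_mult_distrib2 mult.commute)
      moreover have "block_sum (m * q + n * p) (block_swap (m * q) (n * p)) id (m * q + n * p + pair_code n
          i' j)
          = m * q + n * p + pair_code n i' j"
        using b by (simp only: block_sum_simps(2) id_apply)
      moreover have "block_sum (m * p) id (block_sum (m * q + n * p) (block_swap (m * q) (n * p)) id)
          (m * p + (m * q + n * p + pair_code n i' j))
        = m * p + block_sum (m * q + n * p) (block_swap (m * q) (n * p)) id (m * q + n * p + pair_code n i' j)"
        using b by (intro block_sum_simps(2)) simp
      ultimately show ?thesis using R i k by (simp only: comp_apply) (simp add: dist_perm_pair_code(2))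
    qed
  qed
qed (rule permutes_intros' refl | simp add: algebra_simps)+

section \<open>The finite ordinal category\<close>

lemmas permutes_simps = permutes_intros[unfolded One_nat_def]

lemma Sigma_inv_arr_id [simp]: "inv_arr Sigma_category (n, id) = (n, id)"
  by (rule Sigma.inv_arr_eqI) (auto simp: inverse_arrows_def hom_def permutes_id)

lemma perm_prod_empty [simp]: "perm_prod 0 m \<sigma> \<tau> = id" "perm_prod m 0 \<sigma> \<tau> = id"
  by (auto simp: perm_prod_def)

lemma pair_swap_empty [simp]: "pair_swap 0 m = id" "pair_swap m 0 = id"
  by (auto simp: pair_swap_def)

lemma dist_perm_empty [simp]: "dist_perm m n 0 = id" "dist_perm 0 n p = id" "dist_perm n 0 p = id"
proof -
  show "dist_perm m n 0 = id" by (auto simp: dist_perm_def)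
  show "dist_perm 0 n p = id"
  proof (rule perm_eqI[of _ "(0 + n) * p"])
    fix k assume "1 \<le> k" "k \<le> (0 + n) * p"
    then show "dist_perm 0 n p k = id k"
      by (rule sum_prod_code_cases) (auto simp: dist_perm_pair_code(2)[where m = 0, simplified])
  qed (rule permutes_intros' refl)+
  show "dist_perm n 0 p = id"
  proof (rule perm_eqI[of _ "(n + 0) * p"])
    fix k assume "1 \<le> k" "k \<le> (n + 0) * p"
    then show "dist_perm n 0 p k = id k"
      by (rule sum_prod_code_cases) (auto simp: dist_perm_pair_code(1)[where n = 0, simplified])
  qed (rule permutes_intros' refl)+
qed

lemma dist_perm_one: "dist_perm m n (Suc 0) = id"
proof (rule perm_eqI[of _ "(m + n) * 1"])
  fix k assume "1 \<le> k" "k \<le> (m + n) * 1"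
  then show "dist_perm m n (Suc 0) k = id k"
  proof (rule sum_prod_code_cases)
    fix i j assume "k = pair_code (m + n) i j" "1 \<le> i" "i \<le> m" "1 \<le> j" "j \<le> 1"
    then show ?thesis using dist_perm_pair_code(1)[of i 1 1 m n] by (simp add: pair_code_simps)
  next
    fix i j assume "k = pair_code (m + n) (m + i) j" "1 \<le> i" "i \<le> n" "1 \<le> j" "j \<le> 1"
    then show ?thesis using dist_perm_pair_code(2)[of i 1 1 n m] by (simp add: pair_code_simps)
  qed
qed (use permutes_dist_perm[of m n 1] permutes_id in auto)

interpretation Sigma_add: symmetric_monoidal_category Sigma_category "Additive Sigma_category" "add_sym
    Sigma_category"
  by unfold_locales
    (auto simp: hom_def permutes_simps permutes_id Sigma_iso block_sum_comp block_sum_assoc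
      block_sum_zero block_swap_natural block_swap_hexagon add.commute)

interpretation Sigma_mult: symmetric_monoidal_category Sigma_category "Multiplicative Sigma_category"
    "mult_sym Sigma_category"
  by unfold_locales
    (auto simp: hom_def permutes_simps permutes_id Sigma_iso perm_prod_comp perm_prod_assoc
      perm_prod_one pair_swap_natural pair_swap_hexagon pair_swap_one mult.commute mult.assoc)

lemma Sigma_middle_swap:
  "middle_swap Sigma_category m n p q = (m + n + (p + q), block_sum m id (block_sum (n + p) (block_swap n p)
      id))"
  by (simp add: middle_swap_def)

interpretation Sigma: symmetric_bimonoidal_category Sigma_category
  by unfold_locales
    (auto simp: hom_def permutes_id Sigma_iso Sigma_mono perm_prod_block_sum permutes_simps
     dist_perm_natural perm_prod_block_swap dist_perm_block_swap pair_swap_sum dist_perm_add_assoc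
         dist_perm_mult_assoc[unfolded add_mult_distrib]
     perm_prod_dist_perm dist_perm_sum Sigma_middle_swap dist_perm_one add_mult_distrib add_mult_distrib2
         mult.assoc add.assoc)


lemma Sigma_flat: "f \<in> dist_class Sigma_category \<Longrightarrow> mono_arr Sigma_category f"
proof (rule Sigma_mono)
  show "f \<in> dist_class Sigma_category \<Longrightarrow> f \<in> Arr Sigma_category"
    by (induction rule: dist_class.induct) (auto simp: permutes_id permutes_simps algebra_simps)
qed

lemma Sigma_flat_symmetric_bimonoidal: "flat_symmetric_bimonoidal_category Sigma_category"
  by unfold_locales (rule Sigma_flat)

text \<open>The symmetric groups are generated under composition and block sum by block swaps: composing \<open>\<sigma>\<close> with
  the inverse of the cycle that moves \<open>1\<close> to \<open>\<sigma> 1\<close>, which is a block swap of one point with \<open>\<sigma> 1 - 1\<close> points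
  extended by the identity, leaves a permutation that fixes \<open>1\<close>.\<close>
lemma permutation_induct [consumes 1, case_names id comp sum swap]:
  assumes "\<sigma> permutes {1..n}"
    and id: "\<And>n. P n id"
    and comp: "\<And>n \<sigma> \<tau>. \<sigma> permutes {1..n} \<Longrightarrow> \<tau> permutes {1..n} \<Longrightarrow> P n \<sigma> \<Longrightarrow> P n \<tau> \<Longrightarrow> P n (\<tau> \<circ> \<sigma>)"
    and sum: "\<And>m n \<sigma> \<tau>. \<sigma> permutes {1..m} \<Longrightarrow> \<tau> permutes {1..n} \<Longrightarrow> P m \<sigma> \<Longrightarrow> P n \<tau> \<Longrightarrow> P (m + n) (block_sum m \<sigma> \<tau>)"
    and swap: "\<And>m n. P (m + n) (block_swap m n)"
  shows "P n \<sigma>"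
  using assms(1)
proof (induction n arbitrary: \<sigma>)
  case 0
  then have "\<sigma> = id" by simp
  show ?case unfolding \<open>\<sigma> = id\<close> by (rule id)
next
  case (Suc n)
  define k where "k = \<sigma> 1 - 1"
  have "1 \<le> \<sigma> 1" "\<sigma> 1 \<le> Suc n" using interval_permutes(2,3)[OF Suc.prems, of 1] by auto
  then have k: "\<sigma> 1 = Suc k" "k \<le> n" by (auto simp: k_def)
  define c where "c = block_sum (1 + k) (block_swap 1 k) id"
  have c: "c permutes {1..Suc n}" "P (Suc n) c"
    using permutes_block_sum[OF permutes_block_swap[of 1 k] permutes_id[of "{1..n - k}"]]
      sum[OF permutes_block_swap[of 1 k] permutes_id[of "{1..n - k}"] swap id] k by (simp_all add: c_def)
  define \<tau> where "\<tau> = inv c \<circ> \<sigma>"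
  have \<tau>: "\<tau> permutes {1..Suc n}" unfolding \<tau>_def by (intro permutes_compose Suc.prems permutes_inv c)
  have "c 1 = Suc k" by (simp add: c_def block_sum_def block_swap_def)
  then have \<tau>1: "\<tau> 1 = 1" using k permutes_inverses(2)[OF c(1)] by (metis \<tau>_def comp_apply)
  \<comment> \<open>The restriction of \<open>\<tau>\<close> to \<open>{2..n + 1}\<close>, shifted down by one.\<close>
  define \<upsilon> where "\<upsilon> = (\<lambda>i. if i = 0 then 0 else \<tau> (Suc i) - 1)"
  have pos: "\<tau> (Suc i) > 1" if "i > 0" for i
  proof -
    have "\<tau> (Suc i) \<noteq> \<tau> 1" using that permutes_inj[OF \<tau>] by (metis injD Suc_inject One_nat_def less_irrefl)
    moreover have "1 \<le> \<tau> (Suc i)" using interval_permutes(3)[OF \<tau>, of "Suc i"] by simp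
    ultimately show ?thesis using \<tau>1 by linarith
  qed
  have \<upsilon>: "\<upsilon> permutes {1..n}"
  proof (rule inj_imp_permutes)
    show "inj_on \<upsilon> {1..n}"
    proof (rule inj_onI)
      fix i j assume *: "i \<in> {1..n}" "j \<in> {1..n}" "\<upsilon> i = \<upsilon> j"
      then have "\<tau> (Suc i) = \<tau> (Suc j)" using pos[of i] pos[of j] by (auto simp: \<upsilon>_def)
      then show "i = j" using permutes_inj[OF \<tau>] by (auto dest: injD)
    qed
    show "\<upsilon> i \<in> {1..n}" if "i \<in> {1..n}" for i
      using that pos[of i] interval_permutes(2)[OF \<tau>, of "Suc i"] by (auto simp: \<upsilon>_def)
    show "\<upsilon> i = i" if "i \<notin> {1..n}" for i
      using that interval_permutes(4)[OF \<tau>, of "Suc i"] by (auto simp: \<upsilon>_def)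
  qed simp
  have "\<tau> = block_sum 1 id \<upsilon>"
  proof
    fix i show "\<tau> i = block_sum 1 id \<upsilon> i"
      using \<tau>1 pos[of "i - 1"] interval_permutes(1)[OF \<tau>]
      by (cases i rule: nat.exhaust; cases "i = 1") (auto simp: block_sum_def \<upsilon>_def)
  qed
  then have "P (Suc n) \<tau>" using sum[OF permutes_id \<upsilon> id Suc.IH[OF \<upsilon>], of 1] by simp
  moreover have "\<sigma> = c \<circ> \<tau>" using permutes_inv_o(1)[OF c(1)] by (simp add: \<tau>_def flip: comp_assoc)
  ultimately show ?case using comp[OF \<tau> c(1) _ c(2)] by (simp only:)
qed

section \<open>The action of permutations on sums of copies\<close>

definition labels :: "nat \<Rightarrow> nat list" where
  "labels n = [1..<Suc n]"

lemma labels_simps [simp]: "length (labels n) = n" "set (labels n) = {1..n}" "distinct (labels n)"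
  by (auto simp: labels_def simp del: upt_Suc)

lemma labels_add: "labels (m + n) = labels m @ map ((+) m) (labels n)"
  unfolding labels_def by (induction n) auto

lemma map_labels_permutes [simp]:
  assumes "\<sigma> permutes {1..n}" shows "distinct (map \<sigma> (labels n))" "\<sigma> ` {1..n} = {1..n}"
  using permutes_inj_on[OF assms] permutes_image[OF assms] by (auto simp: distinct_map)

context symmetric_monoidal_object begin

text \<open>Position \<open>i\<close> of the source carries the label \<open>\<sigma> i\<close> and position \<open>j\<close> of the target the label \<open>j\<close>, so the
  \<open>i\<close>-th summand moves to position \<open>\<sigma> i\<close>.\<close>
definition permute :: "nat \<Rightarrow> (nat \<Rightarrow> nat) \<Rightarrow> 'm" where
  "permute n \<sigma> = rearrange (map \<sigma> (labels n)) (labels n)"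

lemma ty_permute [simp]:
  assumes "\<sigma> permutes {Suc 0..n}" shows "permute n \<sigma> \<Ztypecolon> pow n \<rightarrow> pow n"
  using assms map_labels_permutes[of \<sigma> n] ty_rearrange[of "map \<sigma> (labels n)" "labels n"]
  by (simp add: permute_def)

lemma permute_id [simp]: "permute n id = \<iota> (pow n)" "permute n (\<lambda>i. i) = \<iota> (pow n)"
  by (simp_all add: permute_def)

text \<open>Relabelling by \<open>\<tau>\<close> turns the rearrangement for \<open>\<sigma>\<close> into one that ends where the rearrangement for \<open>\<tau>\<close>
  starts.\<close>
lemma permute_comp:
  assumes "\<sigma> permutes {1..n}" "\<tau> permutes {1..n}"
  shows "permute n (\<tau> \<circ> \<sigma>) = permute n \<tau> \<cdot> permute n \<sigma>"
proof -
  note * = map_labels_permutes[OF assms(1)] map_labels_permutes[OF assms(2)]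
    map_labels_permutes[OF permutes_compose[OF assms]]
  have "rearrange (map \<tau> (map \<sigma> (labels n))) (map \<tau> (labels n)) = rearrange (map \<sigma> (labels n)) (labels n)"
    using * permutes_inj_on[OF assms(2)] by (intro rearrange_map) simp_all
  moreover have "rearrange (map \<tau> (labels n)) (labels n) \<cdot> rearrange (map \<tau> (map \<sigma> (labels n))) (map \<tau>
      (labels n))
      = rearrange (map (\<tau> \<circ> \<sigma>) (labels n)) (labels n)"
    using * by (subst rearrange_trans) (simp_all add: image_comp[symmetric])
  ultimately show ?thesis by (simp add: permute_def)
qed

lemma iso_permute [simp]:
  assumes "\<sigma> permutes {Suc 0..n}" shows "iso_arr C (permute n \<sigma>)"
proof (rule inverseI[of "permute n (inv \<sigma>)" _ "pow n" "pow n"])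
  show "permute n (inv \<sigma>) \<cdot> permute n \<sigma> = \<iota> (pow n)" "permute n \<sigma> \<cdot> permute n (inv \<sigma>) = \<iota> (pow n)"
    using assms permutes_inv[OF assms] permutes_inv_o[OF assms] by (simp_all flip: permute_comp)
qed (use assms permutes_inv[OF assms] in auto)

lemma permute_block_sum:
  assumes "\<sigma> permutes {1..m}" "\<tau> permutes {1..n}"
  shows "permute (m + n) (block_sum m \<sigma> \<tau>) \<cdot> pow_add m n = pow_add m n \<cdot> (permute m \<sigma> \<boxdot> permute n \<tau>)"
proof -
  let ?xs = "map \<sigma> (labels m)" and ?zs = "map ((+) m) (map \<tau> (labels n))" and ?ws = "map ((+) m) (labels n)"
  have eq: "map (block_sum m \<sigma> \<tau>) (labels (m + n)) = ?xs @ ?zs"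
    by (auto simp: labels_add block_sum_def)
  note * = map_labels_permutes[OF assms(1)] map_labels_permutes[OF assms(2)]
  have "set ?zs = (+) m ` \<tau> ` {1..n}" by (simp only: list.set_map labels_simps)
  then have set: "set ?zs = (+) m ` {1..n}" using * by simp
  have "distinct ?zs" using *(3) by (simp only: distinct_map) simp
  then have d: "distinct (?xs @ ?zs)" "distinct (labels m @ ?ws)"
    using * set by (auto simp: distinct_map simp del: map_map)
  have "rearrange (?xs @ ?zs) (labels m @ ?ws) \<cdot> pow_add (length ?xs) (length ?zs)
     = pow_add (length (labels m)) (length ?ws) \<cdot> (rearrange ?xs (labels m) \<boxdot> rearrange ?zs ?ws)"
    by (rule rearrange_append[OF d]) (use * set in simp_all)
  moreover have "rearrange ?zs ?ws = rearrange (map \<tau> (labels n)) (labels n)"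
    using * by (intro rearrange_map) simp_all
  ultimately show ?thesis unfolding permute_def eq by (simp add: labels_add)
qed

lemma permute_block_swap:
  "permute (m + n) (block_swap m n) \<cdot> pow_add m n = pow_add n m \<cdot> \<zeta> (pow m) (pow n)"
proof -
  let ?xs = "map ((+) n) (labels m)" and ?ys = "labels n"
  have "map (block_swap m n) (labels m) = ?xs" "map (block_swap m n) (map ((+) m) ?ys) = ?ys"
    unfolding map_map by (auto simp: block_swap_def intro!: map_cong map_idI)
  then have eq: "map (block_swap m n) (labels (m + n)) = ?xs @ ?ys"
    by (simp add: labels_add)
  have "distinct (?xs @ ?ys)" by (auto simp: distinct_map)
  from rearrange_sym[OF this] show ?thesis
    unfolding permute_def eq by (simp add: labels_add add.commute[of m n])
qed

end

context symmetric_monoidal_category begin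

text \<open>Interchange of the middle summands, which for the additive structure is \<open>\<mu>\<close>.\<close>
definition exchange :: "'o \<Rightarrow> 'o \<Rightarrow> 'o \<Rightarrow> 'o \<Rightarrow> 'm" where
  "exchange A B D E = inv_arr C (\<alpha> A D (B \<odot> E)) \<cdot> (\<iota> A \<boxdot> swap B D E) \<cdot> \<alpha> A B (D \<odot> E)"

lemma ty_exchange [simp]:
  "A \<in> Obj C \<Longrightarrow> B \<in> Obj C \<Longrightarrow> D \<in> Obj C \<Longrightarrow> E \<in> Obj C \<Longrightarrow>
    exchange A B D E \<Ztypecolon> (A \<odot> B) \<odot> (D \<odot> E) \<rightarrow> (A \<odot> D) \<odot> (B \<odot> E)"
  by (simp add: exchange_def)

lemma assoc_exchange:
  "A \<in> Obj C \<Longrightarrow> B \<in> Obj C \<Longrightarrow> D \<in> Obj C \<Longrightarrow> E \<in> Obj C \<Longrightarrow>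
    \<alpha> A D (B \<odot> E) \<cdot> exchange A B D E = (\<iota> A \<boxdot> swap B D E) \<cdot> \<alpha> A B (D \<odot> E)"
  by (simp add: exchange_def)

lemma exchange_natural:
  assumes [simp]: "f \<Ztypecolon> A \<rightarrow> A'" "g \<Ztypecolon> B \<rightarrow> B'" "h \<Ztypecolon> D \<rightarrow> D'" "k \<Ztypecolon> E \<rightarrow> E'"
  shows "exchange A' B' D' E' \<cdot> ((f \<boxdot> g) \<boxdot> (h \<boxdot> k)) = ((f \<boxdot> h) \<boxdot> (g \<boxdot> k)) \<cdot> exchange A B D E"
proof -
  note [simp] = assms[THEN ty_Obj(1)] assms[THEN ty_Obj(2)]
  have "\<alpha> A' D' (B' \<odot> E') \<cdot> exchange A' B' D' E' \<cdot> ((f \<boxdot> g) \<boxdot> (h \<boxdot> k))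
      = (\<iota> A' \<boxdot> swap B' D' E') \<cdot> (f \<boxdot> (g \<boxdot> (h \<boxdot> k))) \<cdot> \<alpha> A B (D \<odot> E)"
    by (simp add: assoc_exchange[THEN chain] natural)
  also have "\<dots> = (f \<boxdot> (h \<boxdot> (g \<boxdot> k))) \<cdot> (\<iota> A \<boxdot> swap B D E) \<cdot> \<alpha> A B (D \<odot> E)"
    by (simp add: swap_nat')
  also have "\<dots> = (f \<boxdot> (h \<boxdot> (g \<boxdot> k))) \<cdot> \<alpha> A D (B \<odot> E) \<cdot> exchange A B D E"
    by (subst assoc_exchange) simp+
  also have "\<dots> = \<alpha> A' D' (B' \<odot> E') \<cdot> ((f \<boxdot> h) \<boxdot> (g \<boxdot> k)) \<cdot> exchange A B D E"
    by (simp add: natural)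
  finally show ?thesis by simp
qed

end

context symmetric_monoidal_object begin

lemma permute_block_sum_chain:
  assumes "\<sigma> permutes {1..m}" "\<tau> permutes {1..n}" "ty f = Some p" "snd p = pow m \<odot> pow n" "N = m + n"
  shows "permute N (block_sum m \<sigma> \<tau>) \<cdot> pow_add m n \<cdot> f = pow_add m n \<cdot> (permute m \<sigma> \<boxdot> permute n \<tau>) \<cdot> f"
proof -
  have *: "permute N (block_sum m \<sigma> \<tau>) \<Ztypecolon> pow N \<rightarrow> pow N" "permute m \<sigma> \<Ztypecolon> pow m \<rightarrow> pow m" "permute n \<tau> \<Ztypecolon> pow n \<rightarrow>
      pow n"
    using permutes_block_sum[OF assms(1,2)] assms(1,2,5) by simp_all
  then have "permute N (block_sum m \<sigma> \<tau>) \<cdot> pow_add m n \<cdot> f = (permute N (block_sum m \<sigma> \<tau>) \<cdot> pow_add m n) \<cdot> f"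
    using assms(3-5) by simp
  also have "\<dots> = (pow_add m n \<cdot> (permute m \<sigma> \<boxdot> permute n \<tau>)) \<cdot> f"
    using permute_block_sum[OF assms(1,2)] assms(5) by simp
  finally show ?thesis using * assms(3,4) by simp
qed

text \<open>The block permutation on the left is the image of \<open>\<mu>\<close> for \<open>\<Sigma>\<close>, so this says that \<open>pow\<close> preserves \<open>\<mu>\<close>.\<close>
lemma permute_exchange:
  "permute (m + (n + (p + q))) (block_sum m id (block_sum (n + p) (block_swap n p) id))
     \<cdot> pow_add (m + n) (p + q) \<cdot> (pow_add m n \<boxdot> pow_add p q)
   = pow_add (m + p) (n + q) \<cdot> (pow_add m p \<boxdot> pow_add n q) \<cdot> exchange (pow m) (pow n) (pow p) (pow q)"
proof -
  let ?N = "block_sum (n + p) (block_swap n p) id"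
  let ?M = "block_sum m id ?N"
  have N: "?N permutes {1..n + (p + q)}" "?N permutes {Suc 0..n + (p + q)}"
    using permutes_block_sum[OF permutes_block_swap[of n p] permutes_id[of "{1..q}"]]
        by (simp_all add: add.assoc)
  have M: "?M permutes {Suc 0..m + (n + (p + q))}"
    using permutes_block_sum[OF permutes_id N(1), of m] by simp
  note [simp] = ty_permute[OF N(2)] ty_permute[OF M] permutes_simps
  have split: "pow_add (a + b) (c + d) \<cdot> (pow_add a b \<boxdot> pow_add c d)
      = pow_add a (b + (c + d)) \<cdot> (\<iota> (pow a) \<boxdot> (pow_add b (c + d) \<cdot> (\<iota> (pow b) \<boxdot> pow_add c d)))
        \<cdot> \<alpha> (pow a) (pow b) (pow c \<odot> pow d)" for a b c d
  proof -
    have "pow_add (a + b) (c + d) \<cdot> (pow_add a b \<boxdot> pow_add c d)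
       = (pow_add (a + b) (c + d) \<cdot> (pow_add a b \<boxdot> \<iota> (pow (c + d)))) \<cdot> (\<iota> (pow a \<odot> pow b) \<boxdot> pow_add c d)"
      by (simp add: add.assoc)
    then show ?thesis by (simp add: pow_add_assoc natural add.assoc del: tArr_Ident)
  qed
  have N_swap: "permute (n + (p + q)) ?N \<cdot> pow_add n (p + q) \<cdot> (\<iota> (pow n) \<boxdot> pow_add p q)
     = pow_add p (n + q) \<cdot> (\<iota> (pow p) \<boxdot> pow_add n q) \<cdot> swap (pow n) (pow p) (pow q)"
  proof (rule iso_cancel_right[of _ "\<alpha> (pow n) (pow p) (pow q)"])
    have "(permute (n + (p + q)) ?N \<cdot> pow_add n (p + q) \<cdot> (\<iota> (pow n) \<boxdot> pow_add p q)) \<cdot> \<alpha> (pow n) (pow p) (pow q)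
       = permute (n + p + q) ?N \<cdot> pow_add (n + p) q \<cdot> (pow_add n p \<boxdot> \<iota> (pow q))"
      by (subst pow_add_assoc) (simp add: add.assoc)+
    also have "\<dots> = pow_add (n + p) q \<cdot> ((permute (n + p) (block_swap n p) \<cdot> pow_add n p) \<boxdot> \<iota> (pow q))"
      using permutes_block_swap[of n p] permutes_id by (subst permute_block_sum_chain) (simp add: add.assoc)+
    also have "\<dots> = (pow_add (p + n) q \<cdot> (pow_add p n \<boxdot> \<iota> (pow q))) \<cdot> (\<zeta> (pow n) (pow p) \<boxdot> \<iota> (pow q))"
      by (simp add: permute_block_swap add.commute)
    also have "\<dots> = (pow_add p (n + q) \<cdot> (\<iota> (pow p) \<boxdot> pow_add n q) \<cdot> swap (pow n) (pow p) (pow q))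
        \<cdot> \<alpha> (pow n) (pow p) (pow q)"
      by (simp add: pow_add_assoc swap_assoc)
    finally show "(permute (n + (p + q)) ?N \<cdot> pow_add n (p + q) \<cdot> (\<iota> (pow n) \<boxdot> pow_add p q))
        \<cdot> \<alpha> (pow n) (pow p) (pow q) = \<dots>" .
  qed (simp add: add.left_commute)+
  have "permute (m + (n + (p + q))) ?M \<cdot> pow_add (m + n) (p + q) \<cdot> (pow_add m n \<boxdot> pow_add p q)
     = permute (m + (n + (p + q))) ?M \<cdot> pow_add m (n + (p + q))
       \<cdot> (\<iota> (pow m) \<boxdot> (pow_add n (p + q) \<cdot> (\<iota> (pow n) \<boxdot> pow_add p q))) \<cdot> \<alpha> (pow m) (pow n) (pow p \<odot> pow q)"
    by (subst split) simp
  also have "\<dots> = pow_add m (n + (p + q))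
       \<cdot> (\<iota> (pow m) \<boxdot> (permute (n + (p + q)) ?N \<cdot> pow_add n (p + q) \<cdot> (\<iota> (pow n) \<boxdot> pow_add p q)))
       \<cdot> \<alpha> (pow m) (pow n) (pow p \<odot> pow q)"
    using permutes_id N by (subst permute_block_sum_chain) simp+
  also have "\<dots> = pow_add m (p + (n + q)) \<cdot> (\<iota> (pow m) \<boxdot> (pow_add p (n + q) \<cdot> (\<iota> (pow p) \<boxdot> pow_add n q)))
       \<cdot> (\<iota> (pow m) \<boxdot> swap (pow n) (pow p) (pow q)) \<cdot> \<alpha> (pow m) (pow n) (pow p \<odot> pow q)"
    by (subst N_swap) (simp add: add.left_commute)
  also have "\<dots> = pow_add m (p + (n + q)) \<cdot> (\<iota> (pow m) \<boxdot> (pow_add p (n + q) \<cdot> (\<iota> (pow p) \<boxdot> pow_add n q)))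
       \<cdot> \<alpha> (pow m) (pow p) (pow n \<odot> pow q) \<cdot> exchange (pow m) (pow n) (pow p) (pow q)"
    by (subst assoc_exchange) simp+
  also have "\<dots> = (pow_add (m + p) (n + q) \<cdot> (pow_add m p \<boxdot> pow_add n q))
      \<cdot> exchange (pow m) (pow n) (pow p) (pow q)"
    by (subst split) simp
  finally show ?thesis by (simp add: add.assoc)
qed

end

section \<open>The multiplication of sums of copies of the unit\<close>

text \<open>The rules for identity permutations are stated for the constant \<open>id\<close>, which therefore has to survive
  simplification also where it occurs applied to a bound variable.\<close>
declare id_apply [simp del]

context bimonoidal_category begin

lemmas ty_bimonoidal [simp] = left_null_in_hom[THEN add.hom_ty] right_null_in_hom[THEN add.hom_ty]
  left_dist_in_hom[THEN add.hom_ty] right_dist_in_hom[THEN add.hom_ty]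

declare left_null_iso [simp] right_null_iso [simp]

lemma left_dist_nat:
  "add.ty f = Some p \<Longrightarrow> add.ty g = Some q \<Longrightarrow> add.ty h = Some r \<Longrightarrow> snd p = A \<Longrightarrow> snd q = B \<Longrightarrow> snd r = D \<Longrightarrow>
    \<delta>\<^sub>l A B D \<cdot> (f \<boxtimes> (g \<boxplus> h)) = (f \<boxtimes> g \<boxplus> f \<boxtimes> h) \<cdot> \<delta>\<^sub>l (fst p) (fst q) (fst r)"
  using left_dist_natural[of f g h] by (simp add: add.tyD)

text \<open>As for \<open>assoc_natural_Ident\<close>, with the identity of a sum already collapsed.\<close>
lemma left_dist_nat_Ident:
  "add.ty f = Some p \<Longrightarrow> snd p = A \<Longrightarrow> B \<in> Obj C \<Longrightarrow> D \<in> Obj C \<Longrightarrow>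
    \<delta>\<^sub>l A B D \<cdot> (f \<boxtimes> \<iota> (B \<oplus> D)) = (f \<boxtimes> \<iota> B \<boxplus> f \<boxtimes> \<iota> D) \<cdot> \<delta>\<^sub>l (fst p) B D"
  using left_dist_nat[of f p "\<iota> B" "(B, B)" "\<iota> D" "(D, D)" A B D] by simp

lemma right_dist_nat:
  "add.ty f = Some p \<Longrightarrow> add.ty g = Some q \<Longrightarrow> add.ty h = Some r \<Longrightarrow> snd p = A \<Longrightarrow> snd q = B \<Longrightarrow> snd r = D \<Longrightarrow>
    \<delta>\<^sub>r A B D \<cdot> ((f \<boxplus> g) \<boxtimes> h) = (f \<boxtimes> h \<boxplus> g \<boxtimes> h) \<cdot> \<delta>\<^sub>r (fst p) (fst q) (fst r)"
  using right_dist_natural[of f g h] by (simp add: add.tyD)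

lemma right_null_nat: "add.ty f = Some p \<Longrightarrow> snd p = A \<Longrightarrow> \<rho>\<^sub>\<bullet> A \<cdot> (f \<boxtimes> \<iota> \<zero>) = \<rho>\<^sub>\<bullet> (fst p)"
  using right_null_natural[of f] by (simp add: add.tyD)

lemmas dist_nat = left_dist_nat left_dist_nat_Ident right_dist_nat right_null_nat
lemmas dist_nat_chain = dist_nat[THEN add.chain]

end

context symmetric_bimonoidal_category begin

lemma middle_swap_eq_exchange: "\<mu> A B D E = add.exchange A B D E"
  by (simp add: middle_swap_def add.exchange_def add.swap_def)

sublocale one: symmetric_monoidal_object C "Additive C" "add_sym C" "\<one>"
  by unfold_locales simp

abbreviation P where "P \<equiv> one.pow"
abbreviation PA where "PA \<equiv> one.pow_add"
abbreviation act where "act \<equiv> one.permute"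

text \<open>Only the second factor is expanded, so that \<open>\<delta>\<^sub>r\<close> does not enter the definition.\<close>
primrec pow_mult :: "nat \<Rightarrow> nat \<Rightarrow> 'm" where
  "pow_mult m 0 = \<rho>\<^sub>\<bullet> (P m)"
| "pow_mult m (Suc n) = PA m (m * n) \<cdot> (\<rho>\<^sub>\<otimes> (P m) \<boxplus> pow_mult m n) \<cdot> \<delta>\<^sub>l (P m) \<one> (P n)"

lemma ty_pow_mult [simp]: "add.ty (pow_mult m n) = Some (P m \<otimes> P n, P (m * n))"
  by (induction n) simp_all

text \<open>In \<open>\<Sigma>\<close> the permutation \<open>\<sigma> \<otimes> id\<close> of \<open>m (n + 1)\<close> is the block sum of \<open>\<sigma>\<close> and \<open>\<sigma> \<otimes> id\<close> on \<open>m n\<close>, as \<open>\<delta>\<^sub>l\<close> is an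
  identity there.\<close>
lemma pow_mult_natural_left:
  assumes "\<sigma> permutes {1..m}"
  shows "act (m * n) (perm_prod m n \<sigma> id) \<cdot> pow_mult m n = pow_mult m n \<cdot> (act m \<sigma> \<boxtimes> \<iota> (P n))"
proof (induction n)
  case 0
  show ?case using assms by (simp add: dist_nat)
next
  case (Suc n)
  have eq: "perm_prod m (Suc n) \<sigma> id = block_sum m \<sigma> (perm_prod m n \<sigma> id)"
    using perm_prod_block_sum[of \<sigma> m id 1 id n] assms by (simp add: permutes_id perm_prod_one)
  have perm: "perm_prod m n \<sigma> id permutes {Suc 0..m * n}" using assms by (simp add: permutes_simps permutes_id)
  have "act (m * Suc n) (perm_prod m (Suc n) \<sigma> id) \<cdot> pow_mult m (Suc n)
     = PA m (m * n) \<cdot> (act m \<sigma> \<boxplus> act (m * n) (perm_prod m n \<sigma> id)) \<cdot> (\<rho>\<^sub>\<otimes> (P m) \<boxplus> pow_mult m n)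
         \<cdot> \<delta>\<^sub>l (P m) \<one> (P n)"
    unfolding eq pow_mult.simps using assms perm by (subst one.permute_block_sum_chain) simp+
  also have "\<dots> = PA m (m * n) \<cdot> (\<rho>\<^sub>\<otimes> (P m) \<boxplus> pow_mult m n) \<cdot> ((act m \<sigma> \<boxtimes> \<iota> \<one>) \<boxplus> (act m \<sigma> \<boxtimes> \<iota> (P n)))
      \<cdot> \<delta>\<^sub>l (P m) \<one> (P n)"
    using assms perm Suc by (simp add: mult.natural)
  also have "\<dots> = pow_mult m (Suc n) \<cdot> (act m \<sigma> \<boxtimes> \<iota> (P (Suc n)))"
    using assms by (simp add: dist_nat dist_nat_chain)
  finally show ?case .
qed

text \<open>The defining recursion splits off one summand of the second factor; by \<open>left_dist_add_assoc\<close> it may be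
  split at any place.\<close>
lemma pow_mult_add:
  "pow_mult m (n + p) \<cdot> (\<iota> (P m) \<boxtimes> PA n p)
    = PA (m * n) (m * p) \<cdot> (pow_mult m n \<boxplus> pow_mult m p) \<cdot> \<delta>\<^sub>l (P m) (P n) (P p)"
proof (induction n)
  case 0
  have "PA (m * 0) (m * p) \<cdot> (pow_mult m 0 \<boxplus> pow_mult m p) \<cdot> \<delta>\<^sub>l (P m) (P 0) (P p)
    = \<lambda>\<^sub>\<oplus> (P (m * p)) \<cdot> (\<iota> \<zero> \<boxplus> pow_mult m p) \<cdot> (\<rho>\<^sub>\<bullet> (P m) \<boxplus> \<iota> (P m \<otimes> P p)) \<cdot> \<delta>\<^sub>l (P m) \<zero> (P p)"
    by simp
  also have "\<dots> = pow_mult m p \<cdot> (\<lambda>\<^sub>\<oplus> (P m \<otimes> P p) \<cdot> (\<rho>\<^sub>\<bullet> (P m) \<boxplus> \<iota> (P m \<otimes> P p)) \<cdot> \<delta>\<^sub>l (P m) \<zero> (P p))"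
    by (subst add.natural(7)) simp+
  also have "\<dots> = pow_mult m p \<cdot> (\<iota> (P m) \<boxtimes> \<lambda>\<^sub>\<oplus> (P p))"
    by (subst left_dist_zero_left) simp+
  finally show ?case by simp
next
  case (Suc n)
  let ?d = "\<delta>\<^sub>l (P m) \<one> (P (n + p))"
  have "pow_mult m (Suc n + p) \<cdot> (\<iota> (P m) \<boxtimes> PA (Suc n) p)
    = PA m (m * (n + p)) \<cdot> (\<rho>\<^sub>\<otimes> (P m) \<boxplus> pow_mult m (n + p)) \<cdot> ?d \<cdot> (\<iota> (P m) \<boxtimes> (\<iota> \<one> \<boxplus> PA n p))
        \<cdot> (\<iota> (P m) \<boxtimes> \<alpha>\<^sub>\<oplus> \<one> (P n) (P p))"
    by simp
  also have "\<dots> = PA m (m * (n + p)) \<cdot> (\<rho>\<^sub>\<otimes> (P m) \<boxplus> (pow_mult m (n + p) \<cdot> (\<iota> (P m) \<boxtimes> PA n p)))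
      \<cdot> \<delta>\<^sub>l (P m) \<one> (P n \<oplus> P p) \<cdot> (\<iota> (P m) \<boxtimes> \<alpha>\<^sub>\<oplus> \<one> (P n) (P p))"
    by (subst dist_nat_chain(1)) simp+
  also have "\<dots> = PA m (m * n + m * p) \<cdot> (\<rho>\<^sub>\<otimes> (P m) \<boxplus> (PA (m * n) (m * p) \<cdot> (pow_mult m n \<boxplus> pow_mult m p)))
      \<cdot> (\<iota> (P m \<otimes> \<one>) \<boxplus> \<delta>\<^sub>l (P m) (P n) (P p)) \<cdot> \<delta>\<^sub>l (P m) \<one> (P n \<oplus> P p) \<cdot> (\<iota> (P m) \<boxtimes> \<alpha>\<^sub>\<oplus> \<one> (P n) (P p))"
    by (simp add: Suc.IH add_mult_distrib2)
  also have "\<dots> = PA m (m * n + m * p) \<cdot> (\<rho>\<^sub>\<otimes> (P m) \<boxplus> (PA (m * n) (m * p) \<cdot> (pow_mult m n \<boxplus> pow_mult m p)))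
      \<cdot> (\<alpha>\<^sub>\<oplus> (P m \<otimes> \<one>) (P m \<otimes> P n) (P m \<otimes> P p) \<cdot> (\<delta>\<^sub>l (P m) \<one> (P n) \<boxplus> \<iota> (P m \<otimes> P p))
          \<cdot> \<delta>\<^sub>l (P m) (\<one> \<oplus> P n) (P p))"
    by (subst left_dist_add_assoc) simp+
  also have "\<dots> = PA m (m * n + m * p) \<cdot> (\<iota> (P m) \<boxplus> PA (m * n) (m * p)) \<cdot> \<alpha>\<^sub>\<oplus> (P m) (P (m * n)) (P (m * p))
      \<cdot> ((\<rho>\<^sub>\<otimes> (P m) \<boxplus> pow_mult m n) \<boxplus> pow_mult m p) \<cdot> (\<delta>\<^sub>l (P m) \<one> (P n) \<boxplus> \<iota> (P m \<otimes> P p))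
          \<cdot> \<delta>\<^sub>l (P m) (\<one> \<oplus> P n) (P p)"
    by (subst add.natural(5)) simp+
  also have "\<dots> = (PA m (m * n + m * p) \<cdot> (\<iota> (P m) \<boxplus> PA (m * n) (m * p)) \<cdot> \<alpha>\<^sub>\<oplus> (P m) (P (m * n)) (P (m * p)))
      \<cdot> ((\<rho>\<^sub>\<otimes> (P m) \<boxplus> pow_mult m n) \<boxplus> pow_mult m p) \<cdot> (\<delta>\<^sub>l (P m) \<one> (P n) \<boxplus> \<iota> (P m \<otimes> P p))
          \<cdot> \<delta>\<^sub>l (P m) (\<one> \<oplus> P n) (P p)"
    by simp
  also have "\<dots> = (PA (m + m * n) (m * p) \<cdot> (PA m (m * n) \<boxplus> \<iota> (P (m * p))))
      \<cdot> ((\<rho>\<^sub>\<otimes> (P m) \<boxplus> pow_mult m n) \<boxplus> pow_mult m p) \<cdot> (\<delta>\<^sub>l (P m) \<one> (P n) \<boxplus> \<iota> (P m \<otimes> P p))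
          \<cdot> \<delta>\<^sub>l (P m) (\<one> \<oplus> P n) (P p)"
    by (subst one.pow_add_assoc) simp
  finally show ?case by (simp add: add.assoc)
qed

text \<open>For block sums and block swaps the claim may be tested after composing with the invertible map
  \<open>1 \<otimes> PA n p\<close>, where \<open>pow_mult_add\<close> reduces it to naturality of \<open>\<delta>\<^sub>l\<close> and to \<open>left_dist_sym\<close>.\<close>
lemma pow_mult_natural_right:
  assumes "\<tau> permutes {1..n}"
  shows "act (m * n) (perm_prod m n id \<tau>) \<cdot> pow_mult m n = pow_mult m n \<cdot> (\<iota> (P m) \<boxtimes> act n \<tau>)"
  using assms
proof (induction rule: permutation_induct)
  case (id n)
  then show ?case by simp
next
  case (comp n \<sigma> \<tau>)
  then have [simp]: "\<sigma> permutes {Suc 0..n}" "\<tau> permutes {Suc 0..n}"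
    "perm_prod m n id \<sigma> permutes {Suc 0..m * n}" "perm_prod m n id \<tau> permutes {Suc 0..m * n}"
    by (simp_all add: permutes_simps permutes_id)
  have "perm_prod m n id (\<tau> \<circ> \<sigma>) = perm_prod m n id \<tau> \<circ> perm_prod m n id \<sigma>"
    using perm_prod_comp[of id m \<sigma> n id \<tau>] by (simp add: permutes_id)
  then have "act (m * n) (perm_prod m n id (\<tau> \<circ> \<sigma>)) \<cdot> pow_mult m n
    = act (m * n) (perm_prod m n id \<tau>) \<cdot> act (m * n) (perm_prod m n id \<sigma>) \<cdot> pow_mult m n"
    by (simp add: one.permute_comp)
  also have "\<dots> = (act (m * n) (perm_prod m n id \<tau>) \<cdot> pow_mult m n) \<cdot> (\<iota> (P m) \<boxtimes> act n \<sigma>)"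
    by (simp add: comp.IH(1))
  also have "\<dots> = pow_mult m n \<cdot> (\<iota> (P m) \<boxtimes> act n (\<tau> \<circ> \<sigma>))"
    unfolding comp.IH(2) by (simp add: one.permute_comp)
  finally show ?case .
next
  case (sum n p \<sigma> \<tau>)
  then have [simp]: "\<sigma> permutes {Suc 0..n}" "\<tau> permutes {Suc 0..p}" "block_sum n \<sigma> \<tau> permutes {Suc 0..n + p}"
    "perm_prod m n id \<sigma> permutes {Suc 0..m * n}" "perm_prod m p id \<tau> permutes {Suc 0..m * p}"
    by (simp_all add: permutes_simps permutes_id)
  have eq: "perm_prod m (n + p) id (block_sum n \<sigma> \<tau>) = block_sum (m * n) (perm_prod m n id \<sigma>) (perm_prod m p
      id \<tau>)"
    by (rule perm_prod_block_sum) (simp_all add: permutes_id)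
  have [simp]: "act (m * (n + p)) (perm_prod m (n + p) id (block_sum n \<sigma> \<tau>)) \<Ztypecolon> P (m * (n + p)) \<rightarrow> P (m * (n +
      p))"
    by (simp add: permutes_simps permutes_id)
  show ?case
  proof (rule add.iso_cancel_right[of _ "\<iota> (P m) \<boxtimes> PA n p"])
    have "(act (m * (n + p)) (perm_prod m (n + p) id (block_sum n \<sigma> \<tau>)) \<cdot> pow_mult m (n + p))
        \<cdot> (\<iota> (P m) \<boxtimes> PA n p)
      = act (m * (n + p)) (perm_prod m (n + p) id (block_sum n \<sigma> \<tau>)) \<cdot> PA (m * n) (m * p)
          \<cdot> (pow_mult m n \<boxplus> pow_mult m p) \<cdot> \<delta>\<^sub>l (P m) (P n) (P p)"
      by (simp add: pow_mult_add)
    also have "\<dots> = PA (m * n) (m * p) \<cdot> (act (m * n) (perm_prod m n id \<sigma>) \<boxplus> act (m * p) (perm_prod m p id \<tau>))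
        \<cdot> (pow_mult m n \<boxplus> pow_mult m p) \<cdot> \<delta>\<^sub>l (P m) (P n) (P p)"
      unfolding eq by (subst one.permute_block_sum_chain) (simp add: add_mult_distrib2)+
    also have "\<dots> = PA (m * n) (m * p) \<cdot> (pow_mult m n \<boxplus> pow_mult m p) \<cdot> ((\<iota> (P m) \<boxtimes> act n \<sigma>) \<boxplus> (\<iota> (P m) \<boxtimes>
        act p \<tau>)) \<cdot> \<delta>\<^sub>l (P m) (P n) (P p)"
      using sum by simp
    also have "\<dots> = (PA (m * n) (m * p) \<cdot> (pow_mult m n \<boxplus> pow_mult m p) \<cdot> \<delta>\<^sub>l (P m) (P n) (P p))
        \<cdot> (\<iota> (P m) \<boxtimes> (act n \<sigma> \<boxplus> act p \<tau>))"
      by (simp add: dist_nat)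
    also have "\<dots> = pow_mult m (n + p) \<cdot> (\<iota> (P m) \<boxtimes> (PA n p \<cdot> (act n \<sigma> \<boxplus> act p \<tau>)))"
      by (subst pow_mult_add[symmetric]) simp
    also have "\<dots> = (pow_mult m (n + p) \<cdot> (\<iota> (P m) \<boxtimes> act (n + p) (block_sum n \<sigma> \<tau>))) \<cdot> (\<iota> (P m) \<boxtimes> PA n p)"
      by (simp add: one.permute_block_sum)
    finally show "(act (m * (n + p)) (perm_prod m (n + p) id (block_sum n \<sigma> \<tau>)) \<cdot> pow_mult m (n + p))
        \<cdot> (\<iota> (P m) \<boxtimes> PA n p) = \<dots>" .
  qed simp+
next
  case (swap n p)
  have [simp]: "act (m * (n + p)) (perm_prod m (n + p) id (block_swap n p)) \<Ztypecolon> P (m * (n + p)) \<rightarrow> P (m * (n + p))"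
    "act (n + p) (block_swap n p) \<Ztypecolon> P (n + p) \<rightarrow> P (n + p)"
    by (simp_all add: permutes_simps permutes_id)
  show ?case
  proof (rule add.iso_cancel_right[of _ "\<iota> (P m) \<boxtimes> PA n p"])
    have "(act (m * (n + p)) (perm_prod m (n + p) id (block_swap n p)) \<cdot> pow_mult m (n + p))
        \<cdot> (\<iota> (P m) \<boxtimes> PA n p)
      = (act (m * n + m * p) (block_swap (m * n) (m * p)) \<cdot> PA (m * n) (m * p))
          \<cdot> (pow_mult m n \<boxplus> pow_mult m p) \<cdot> \<delta>\<^sub>l (P m) (P n) (P p)"
      by (simp add: pow_mult_add perm_prod_block_swap add_mult_distrib2 permutes_simps)
    also have "\<dots> = PA (m * p) (m * n) \<cdot> (pow_mult m p \<boxplus> pow_mult m n) \<cdot> \<zeta>\<^sub>\<oplus> (P m \<otimes> P n) (P m \<otimes> P p)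
        \<cdot> \<delta>\<^sub>l (P m) (P n) (P p)"
      by (simp add: one.permute_block_swap add.sym_nat')
    also have "\<dots> = (PA (m * p) (m * n) \<cdot> (pow_mult m p \<boxplus> pow_mult m n) \<cdot> \<delta>\<^sub>l (P m) (P p) (P n))
        \<cdot> (\<iota> (P m) \<boxtimes> \<zeta>\<^sub>\<oplus> (P n) (P p))"
      by (simp add: left_dist_sym)
    also have "\<dots> = pow_mult m (p + n) \<cdot> (\<iota> (P m) \<boxtimes> (PA p n \<cdot> \<zeta>\<^sub>\<oplus> (P n) (P p)))"
      by (subst pow_mult_add[symmetric]) simp
    also have "\<dots> = (pow_mult m (n + p) \<cdot> (\<iota> (P m) \<boxtimes> act (n + p) (block_swap n p))) \<cdot> (\<iota> (P m) \<boxtimes> PA n p)"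
      by (simp add: one.permute_block_swap add.commute)
    finally show "(act (m * (n + p)) (perm_prod m (n + p) id (block_swap n p)) \<cdot> pow_mult m (n + p))
        \<cdot> (\<iota> (P m) \<boxtimes> PA n p) = \<dots>" .
  qed simp+
qed

lemma pow_mult_one_right: "pow_mult m (Suc 0) = \<rho>\<^sub>\<otimes> (P m) \<cdot> (\<iota> (P m) \<boxtimes> \<rho>\<^sub>\<oplus> \<one>)"
proof -
  have "pow_mult m (Suc 0) = \<rho>\<^sub>\<oplus> (P m) \<cdot> (\<rho>\<^sub>\<otimes> (P m) \<boxplus> \<iota> \<zero>) \<cdot> (\<iota> (P m \<otimes> \<one>) \<boxplus> \<rho>\<^sub>\<bullet> (P m)) \<cdot> \<delta>\<^sub>l (P m) \<one> \<zero>"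
    by (simp add: one.pow_add_0_right)
  also have "\<dots> = \<rho>\<^sub>\<otimes> (P m) \<cdot> \<rho>\<^sub>\<oplus> (P m \<otimes> \<one>) \<cdot> (\<iota> (P m \<otimes> \<one>) \<boxplus> \<rho>\<^sub>\<bullet> (P m)) \<cdot> \<delta>\<^sub>l (P m) \<one> \<zero>"
    by (subst add.natural(8)) simp+
  finally show ?thesis by (simp add: left_dist_zero_right)
qed

text \<open>The unit \<open>1\<close> is isomorphic, but need not be equal, to \<open>P 1 = 1 \<oplus> 0\<close>.\<close>
definition pow_one :: 'm where "pow_one = inv_arr C (\<rho>\<^sub>\<oplus> \<one>)"

lemma ty_pow_one [simp]: "pow_one \<Ztypecolon> \<one> \<rightarrow> P (Suc 0)"
  by (simp add: pow_one_def)

lemma pow_add_pow_one [simp]: "PA (Suc 0) n \<cdot> (pow_one \<boxplus> \<iota> (P n)) = \<iota> (P (Suc n))"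
proof -
  have "PA (Suc 0) n \<cdot> (pow_one \<boxplus> \<iota> (P n)) = ((\<iota> \<one> \<boxplus> \<lambda>\<^sub>\<oplus> (P n)) \<cdot> \<alpha>\<^sub>\<oplus> \<one> \<zero> (P n)) \<cdot> (pow_one \<boxplus> \<iota> (P n))" by simp
  then show ?thesis by (subst (asm) add.triangle) (simp_all add: pow_one_def)
qed

lemma pow_mult_one_left: "pow_mult (Suc 0) n \<cdot> (pow_one \<boxtimes> \<iota> (P n)) = \<lambda>\<^sub>\<otimes> (P n)"
proof (induction n)
  case 0
  show ?case by (simp add: dist_nat right_null_one)
next
  case (Suc n)
  have "pow_mult (Suc 0) (Suc n) \<cdot> (pow_one \<boxtimes> \<iota> (P (Suc n)))
    = PA (Suc 0) n \<cdot> ((\<rho>\<^sub>\<otimes> (P (Suc 0)) \<cdot> (pow_one \<boxtimes> \<iota> \<one>)) \<boxplus> (pow_mult (Suc 0) n \<cdot> (pow_one \<boxtimes> \<iota> (P n))))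
        \<cdot> \<delta>\<^sub>l \<one> \<one> (P n)"
    by (simp add: dist_nat)
  also have "\<dots> = (PA (Suc 0) n \<cdot> (pow_one \<boxplus> \<iota> (P n))) \<cdot> (\<lambda>\<^sub>\<otimes> \<one> \<boxplus> \<lambda>\<^sub>\<otimes> (P n)) \<cdot> \<delta>\<^sub>l \<one> \<one> (P n)"
    unfolding Suc.IH by (simp add: mult.natural mult.left_unit_eq_right_unit del: one.pow_add.simps
        pow_add_pow_one)
  also have "\<dots> = \<lambda>\<^sub>\<otimes> (P (Suc n))"
    unfolding pow_add_pow_one by (simp add: left_dist_one)
  finally show ?case .
qed

lemma pow_mult_zero_left: "pow_mult 0 n = \<lambda>\<^sub>\<bullet> (P n)"
proof (induction n)
  case (Suc n)
  then show ?case by (simp add: left_null_one left_null_add)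
qed (simp add: null_zero)

text \<open>Both sides expand the third factor: on the left the inner multiplication is expanded first and \<open>pow_mult_add\<close>
  distributes the outer one over the result, and \<open>left_dist_mult_assoc\<close> exchanges the two expansions.\<close>
lemma pow_mult_assoc:
  "pow_mult m (n * p) \<cdot> (\<iota> (P m) \<boxtimes> pow_mult n p) \<cdot> \<alpha>\<^sub>\<otimes> (P m) (P n) (P p) = pow_mult (m * n) p
      \<cdot> (pow_mult m n \<boxtimes> \<iota> (P p))"
proof (induction p)
  case 0
  show ?case by (simp add: dist_nat right_null_mult)
next
  case (Suc p)
  have "pow_mult m (n * Suc p) \<cdot> (\<iota> (P m) \<boxtimes> pow_mult n (Suc p)) \<cdot> \<alpha>\<^sub>\<otimes> (P m) (P n) (P (Suc p))
    = (pow_mult m (n + n * p) \<cdot> (\<iota> (P m) \<boxtimes> PA n (n * p))) \<cdot> (\<iota> (P m) \<boxtimes> (\<rho>\<^sub>\<otimes> (P n) \<boxplus> pow_mult n p))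
        \<cdot> (\<iota> (P m) \<boxtimes> \<delta>\<^sub>l (P n) \<one> (P p)) \<cdot> \<alpha>\<^sub>\<otimes> (P m) (P n) (P (Suc p))" by simp
  also have "\<dots> = PA (m * n) (m * (n * p)) \<cdot> (pow_mult m n \<boxplus> pow_mult m (n * p)) \<cdot> \<delta>\<^sub>l (P m) (P n) (P (n * p))
        \<cdot> (\<iota> (P m) \<boxtimes> (\<rho>\<^sub>\<otimes> (P n) \<boxplus> pow_mult n p))
        \<cdot> (\<iota> (P m) \<boxtimes> \<delta>\<^sub>l (P n) \<one> (P p)) \<cdot> \<alpha>\<^sub>\<otimes> (P m) (P n) (P (Suc p))"
    by (subst pow_mult_add) simp
  also have "\<dots> = PA (m * n) (m * (n * p)) \<cdot> ((pow_mult m n \<cdot> (\<iota> (P m) \<boxtimes> \<rho>\<^sub>\<otimes> (P n))) \<boxplus> (pow_mult m (n * p)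
      \<cdot> (\<iota> (P m) \<boxtimes> pow_mult n p)))
        \<cdot> (\<delta>\<^sub>l (P m) (P n \<otimes> \<one>) (P n \<otimes> P p) \<cdot> (\<iota> (P m) \<boxtimes> \<delta>\<^sub>l (P n) \<one> (P p)) \<cdot> \<alpha>\<^sub>\<otimes> (P m) (P n) (P (Suc p)))"
    by (subst dist_nat_chain(1)) simp+
  also have "\<dots> = PA (m * n) (m * (n * p)) \<cdot> ((pow_mult m n \<cdot> ((\<iota> (P m) \<boxtimes> \<rho>\<^sub>\<otimes> (P n)) \<cdot> \<alpha>\<^sub>\<otimes> (P m) (P n) \<one>))
          \<boxplus> (pow_mult m (n * p) \<cdot> (\<iota> (P m) \<boxtimes> pow_mult n p) \<cdot> \<alpha>\<^sub>\<otimes> (P m) (P n) (P p)))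
        \<cdot> \<delta>\<^sub>l (P m \<otimes> P n) \<one> (P p)"
    by (simp add: left_dist_mult_assoc)
  also have "\<dots> = PA (m * n) (m * n * p) \<cdot> ((\<rho>\<^sub>\<otimes> (P (m * n)) \<cdot> (pow_mult m n \<boxtimes> \<iota> \<one>)) \<boxplus> (pow_mult (m * n) p
      \<cdot> (pow_mult m n \<boxtimes> \<iota> (P p))))
        \<cdot> \<delta>\<^sub>l (P m \<otimes> P n) \<one> (P p)"
    unfolding Suc.IH by (simp add: mult.right_unit_tensor mult.natural mult.assoc)
  also have "\<dots> = pow_mult (m * n) (Suc p) \<cdot> (pow_mult m n \<boxtimes> \<iota> (P (Suc p)))"
    by (simp add: dist_nat)
  finally show ?case .
qed

end

section \<open>The free robust functor\<close>

context symmetric_bimonoidal_category begin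

text \<open>Expansion of the first factor.  Splitting off a summand of \<open>P p\<close> as well leads to a fourfold sum, on which
  \<open>dist_dist\<close> compares the two orders of expansion up to \<open>\<mu>\<close>.  For \<open>\<Sigma>\<close> the same axiom says how the
  permutation that swaps the two middle blocks relates \<open>dist_perm m n (p + 1)\<close> to \<open>dist_perm m n p\<close>.\<close>
lemma pow_mult_right_dist:
  "act ((m + n) * p) (dist_perm m n p) \<cdot> pow_mult (m + n) p \<cdot> (PA m n \<boxtimes> \<iota> (P p))
    = PA (m * p) (n * p) \<cdot> (pow_mult m p \<boxplus> pow_mult n p) \<cdot> \<delta>\<^sub>r (P m) (P n) (P p)"
proof (induction p)
  case 0
  show ?case by (simp add: dist_nat right_null_add)
next
  case (Suc p)
  let ?M = "block_sum m id (block_sum (m * p + n) (block_swap (m * p) n) id)"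
  let ?d = "dist_perm m n (Suc p)"
  let ?N = "m + (m * p + (n + n * p))"
  have N: "(m + n) * Suc p = ?N" by (simp add: algebra_simps)
  have N': "m + n + (m + n) * p = ?N" by (simp add: algebra_simps)
  have M: "?M permutes {1..?N}" "?M permutes {Suc 0..?N}"
    using permutes_block_sum[OF permutes_id permutes_block_sum[OF permutes_block_swap permutes_id]]
    by (simp_all add: add.assoc[symmetric])
  have d: "?d permutes {1..?N}" "?d permutes {Suc 0..?N}"
    using permutes_dist_perm[of m n "Suc p"] unfolding N by simp_all
  have dp: "dist_perm m n p permutes {1..(m + n) * p}" "dist_perm m n p permutes {Suc 0..(m + n) * p}"
    using permutes_dist_perm by simp_all
  have [simp]: "P (m + n + (m + n) * p) = P ?N" "P (m * p + m + (n * p + n)) = P ?N"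
    "P (m + n + (m * p + n * p)) = P ?N" "P ((m + n) * p) = P (m * p + n * p)"
    by (simp_all add: algebra_simps)
  note [simp] = one.ty_permute[OF M(2)] one.ty_permute[OF d(2)] one.ty_permute[OF dp(2)]
  have Md: "?M \<circ> ?d = block_sum (m + n) id (dist_perm m n p)"
    using dist_perm_sum[of m 1 p n] by (simp add: dist_perm_one)
  let ?X = "PA m (m * p) \<boxplus> PA n (n * p)" and ?Y = "(\<rho>\<^sub>\<otimes> (P m) \<boxplus> pow_mult m p) \<boxplus> (\<rho>\<^sub>\<otimes> (P n) \<boxplus> pow_mult n p)"
  let ?e = "\<delta>\<^sub>r (P m) (P n) (\<one> \<oplus> P p)"
  \<comment> \<open>As \<open>?M\<close> acts by an isomorphism, it suffices to compare the two sides after composing with it.\<close>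
  have "act ?N ?M \<cdot> (act ?N ?d \<cdot> pow_mult (m + n) (Suc p) \<cdot> (PA m n \<boxtimes> \<iota> (P (Suc p))))
    = act (m + n + (m + n) * p) (block_sum (m + n) id (dist_perm m n p)) \<cdot> PA (m + n) ((m + n) * p)
      \<cdot> (\<rho>\<^sub>\<otimes> (P (m + n)) \<boxplus> pow_mult (m + n) p) \<cdot> \<delta>\<^sub>l (P (m + n)) \<one> (P p) \<cdot> (PA m n \<boxtimes> \<iota> (P (Suc p)))"
    unfolding Md[symmetric] N' one.permute_comp[OF d(1) M(1)] N by simp
  also have "\<dots> = PA (m + n) ((m + n) * p) \<cdot> (\<rho>\<^sub>\<otimes> (P (m + n)) \<boxplus> (act ((m + n) * p) (dist_perm m n p)
      \<cdot> pow_mult (m + n) p))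
      \<cdot> \<delta>\<^sub>l (P (m + n)) \<one> (P p) \<cdot> (PA m n \<boxtimes> \<iota> (P (Suc p)))"
    using dp by (subst one.permute_block_sum_chain) (simp add: permutes_id)+
  also have "\<dots> = PA (m + n) ((m + n) * p) \<cdot> ((PA m n \<cdot> \<rho>\<^sub>\<otimes> (P m \<oplus> P n))
        \<boxplus> (act ((m + n) * p) (dist_perm m n p) \<cdot> pow_mult (m + n) p \<cdot> (PA m n \<boxtimes> \<iota> (P p))))
      \<cdot> \<delta>\<^sub>l (P m \<oplus> P n) \<one> (P p)"
    by (simp add: dist_nat mult.natural)
  also have "\<dots> = PA (m + n) (m * p + n * p) \<cdot> ((PA m n \<cdot> (\<rho>\<^sub>\<otimes> (P m) \<boxplus> \<rho>\<^sub>\<otimes> (P n)) \<cdot> \<delta>\<^sub>r (P m) (P n) \<one>)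
        \<boxplus> (PA (m * p) (n * p) \<cdot> (pow_mult m p \<boxplus> pow_mult n p) \<cdot> \<delta>\<^sub>r (P m) (P n) (P p)))
      \<cdot> \<delta>\<^sub>l (P m \<oplus> P n) \<one> (P p)"
    unfolding Suc.IH by (simp add: right_dist_one add_mult_distrib)
  also have "\<dots> = PA (m + n) (m * p + n * p) \<cdot> (PA m n \<boxplus> PA (m * p) (n * p))
      \<cdot> ((\<rho>\<^sub>\<otimes> (P m) \<boxplus> \<rho>\<^sub>\<otimes> (P n)) \<boxplus> (pow_mult m p \<boxplus> pow_mult n p))
      \<cdot> ((\<delta>\<^sub>r (P m) (P n) \<one> \<boxplus> \<delta>\<^sub>r (P m) (P n) (P p)) \<cdot> \<delta>\<^sub>l (P m \<oplus> P n) \<one> (P p))"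
    by simp
  also have "\<dots> = PA (m + n) (m * p + n * p) \<cdot> (PA m n \<boxplus> PA (m * p) (n * p))
      \<cdot> (((\<rho>\<^sub>\<otimes> (P m) \<boxplus> \<rho>\<^sub>\<otimes> (P n)) \<boxplus> (pow_mult m p \<boxplus> pow_mult n p))
      \<cdot> add.exchange (P m \<otimes> \<one>) (P m \<otimes> P p) (P n \<otimes> \<one>) (P n \<otimes> P p))
      \<cdot> (\<delta>\<^sub>l (P m) \<one> (P p) \<boxplus> \<delta>\<^sub>l (P n) \<one> (P p)) \<cdot> ?e"
    by (subst dist_dist[symmetric]) (simp add: middle_swap_eq_exchange)+
  also have "\<dots> = PA (m + n) (m * p + n * p) \<cdot> (PA m n \<boxplus> PA (m * p) (n * p))
      \<cdot> (add.exchange (P m) (P (m * p)) (P n) (P (n * p)) \<cdot> ?Y)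
      \<cdot> (\<delta>\<^sub>l (P m) \<one> (P p) \<boxplus> \<delta>\<^sub>l (P n) \<one> (P p)) \<cdot> ?e"
    by (subst add.exchange_natural) simp+
  also have "\<dots> = (PA (m + n) (m * p + n * p) \<cdot> (PA m n \<boxplus> PA (m * p) (n * p))
      \<cdot> add.exchange (P m) (P (m * p)) (P n) (P (n * p))) \<cdot> ?Y
      \<cdot> (\<delta>\<^sub>l (P m) \<one> (P p) \<boxplus> \<delta>\<^sub>l (P n) \<one> (P p)) \<cdot> ?e"
    by simp
  also have "\<dots> = (act ?N ?M \<cdot> PA (m + m * p) (n + n * p) \<cdot> ?X) \<cdot> ?Y
      \<cdot> (\<delta>\<^sub>l (P m) \<one> (P p) \<boxplus> \<delta>\<^sub>l (P n) \<one> (P p)) \<cdot> ?e"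
    by (subst one.permute_exchange) simp
  also have "\<dots> = act ?N ?M \<cdot> (PA (m * Suc p) (n * Suc p) \<cdot> (pow_mult m (Suc p) \<boxplus> pow_mult n (Suc p))
      \<cdot> \<delta>\<^sub>r (P m) (P n) (P (Suc p)))"
    by (simp add: add.assoc)
  finally have eq: "act ?N ?M \<cdot> (act ?N ?d \<cdot> pow_mult (m + n) (Suc p) \<cdot> (PA m n \<boxtimes> \<iota> (P (Suc p))))
    = act ?N ?M \<cdot> (PA (m * Suc p) (n * Suc p) \<cdot> (pow_mult m (Suc p) \<boxplus> pow_mult n (Suc p))
        \<cdot> \<delta>\<^sub>r (P m) (P n) (P (Suc p)))" .
  have ty: "act ?N ?d \<cdot> pow_mult (m + n) (Suc p) \<cdot> (PA m n \<boxtimes> \<iota> (P (Suc p))) \<Ztypecolon> (P m \<oplus> P n) \<otimes> P (Suc p) \<rightarrow> P ?N"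
    "PA (m * Suc p) (n * Suc p) \<cdot> (pow_mult m (Suc p) \<boxplus> pow_mult n (Suc p))
        \<cdot> \<delta>\<^sub>r (P m) (P n) (P (Suc p)) \<Ztypecolon> (P m \<oplus> P n) \<otimes> P (Suc p) \<rightarrow> P ?N"
    by (simp, simp add: add.assoc)
  show ?case unfolding N
    using eq by (subst (asm) add.iso_cancel_left[OF one.iso_permute[OF M(2)] one.ty_permute[OF M(2)] ty])
        simp_all
qed

lemma right_dist_mult_sym:
  assumes [simp]: "A \<in> Obj C" "B \<in> Obj C" "D \<in> Obj C"
  shows "\<delta>\<^sub>r A B D \<cdot> \<zeta>\<^sub>\<otimes> D (A \<oplus> B) = (\<zeta>\<^sub>\<otimes> D A \<boxplus> \<zeta>\<^sub>\<otimes> D B) \<cdot> \<delta>\<^sub>l D A B"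
proof -
  have "(\<zeta>\<^sub>\<otimes> D A \<boxplus> \<zeta>\<^sub>\<otimes> D B) \<cdot> \<delta>\<^sub>l D A B
    = (\<zeta>\<^sub>\<otimes> D A \<boxplus> \<zeta>\<^sub>\<otimes> D B) \<cdot> (\<delta>\<^sub>l D A B \<cdot> \<zeta>\<^sub>\<otimes> (A \<oplus> B) D) \<cdot> \<zeta>\<^sub>\<otimes> D (A \<oplus> B)"
    by simp
  then show ?thesis by (simp add: left_dist_mult_sym)
qed

text \<open>The symmetry of \<open>\<otimes>\<close> turns the expansion of the second factor, by which \<open>pow_mult m n\<close> is defined, into the
  expansion of the first factor of \<open>pow_mult n m\<close>.\<close>
lemma pow_mult_sym: "act (m * n) (pair_swap n m) \<cdot> pow_mult n m \<cdot> \<zeta>\<^sub>\<otimes> (P m) (P n) = pow_mult m n"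
proof (induction n)
  case 0
  show ?case by (simp add: pow_mult_zero_left left_null_mult_sym)
next
  case (Suc n)
  let ?N = "m + n * m"
  have N: "m * Suc n = ?N" by (simp add: mult.commute)
  have d: "dist_perm 1 n m permutes {1..?N}" using permutes_dist_perm[of 1 n m] by simp
  have s: "pair_swap n m permutes {1..n * m}" "pair_swap n m permutes {Suc 0..n * m}"
    using permutes_pair_swap[of n m] by simp_all
  have b: "block_sum m id (pair_swap n m) permutes {1..?N}"
    using s(1) by (intro permutes_block_sum permutes_id)
  have t: "pair_swap (Suc n) m permutes {Suc 0..?N}" using permutes_pair_swap[of "Suc n" m] by simp
  have swap_one: "pair_swap (Suc 0) m = id"
    using pair_swap_simp[of m 1] by (simp add: pair_swap_one)
  have eq: "pair_swap (Suc n) m = block_sum m id (pair_swap n m) \<circ> dist_perm 1 n m"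
    using pair_swap_sum[of 1 n m] by (simp add: swap_one)
  note [simp] = one.ty_permute[OF d[unfolded One_nat_def]] one.ty_permute[OF b[unfolded One_nat_def]]
    one.ty_permute[OF s(2)] one.ty_permute[OF t]
  have comp: "act ?N (pair_swap (Suc n) m) = act ?N (block_sum m id (pair_swap n m)) \<cdot> act ?N (dist_perm 1 n m)"
    unfolding eq by (rule one.permute_comp[OF d b])
  have "act ?N (dist_perm 1 n m) \<cdot> pow_mult (Suc n) m
    = (act ?N (dist_perm 1 n m) \<cdot> pow_mult (1 + n) m \<cdot> (PA 1 n \<boxtimes> \<iota> (P m))) \<cdot> ((pow_one \<boxplus> \<iota> (P n)) \<boxtimes> \<iota> (P m))"
    using pow_add_pow_one[of n] by (simp del: one.pow_add.simps)
  also have "\<dots> = PA m (n * m) \<cdot> (pow_mult 1 m \<boxplus> pow_mult n m) \<cdot> \<delta>\<^sub>r (P 1) (P n) (P m)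
      \<cdot> ((pow_one \<boxplus> \<iota> (P n)) \<boxtimes> \<iota> (P m))"
    using pow_mult_right_dist[of 1 n m] by simp
  also have "\<dots> = PA m (n * m) \<cdot> ((pow_mult 1 m \<cdot> (pow_one \<boxtimes> \<iota> (P m))) \<boxplus> pow_mult n m) \<cdot> \<delta>\<^sub>r \<one> (P n) (P m)"
    by (subst dist_nat(3)) simp+
  \<comment> \<open>The first block of rows is a single row, on which multiplication is the left unit isomorphism.\<close>
  finally have dist: "act ?N (dist_perm 1 n m) \<cdot> pow_mult (Suc n) m
      = PA m (n * m) \<cdot> (\<lambda>\<^sub>\<otimes> (P m) \<boxplus> pow_mult n m) \<cdot> \<delta>\<^sub>r \<one> (P n) (P m)"
    by (simp add: pow_mult_one_left)
  have "act (m * Suc n) (pair_swap (Suc n) m) \<cdot> pow_mult (Suc n) m \<cdot> \<zeta>\<^sub>\<otimes> (P m) (P (Suc n))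
    = act ?N (block_sum m id (pair_swap n m)) \<cdot> (act ?N (dist_perm 1 n m) \<cdot> pow_mult (Suc n) m)
        \<cdot> \<zeta>\<^sub>\<otimes> (P m) (P (Suc n))"
    unfolding N comp by simp
  also have "\<dots> = act ?N (block_sum m id (pair_swap n m)) \<cdot> PA m (n * m) \<cdot> (\<lambda>\<^sub>\<otimes> (P m) \<boxplus> pow_mult n m)
      \<cdot> (\<delta>\<^sub>r \<one> (P n) (P m) \<cdot> \<zeta>\<^sub>\<otimes> (P m) (\<one> \<oplus> P n))"
    unfolding dist by simp
  also have "\<dots> = PA m (n * m) \<cdot> (\<iota> (P m) \<boxplus> act (n * m) (pair_swap n m)) \<cdot> (\<lambda>\<^sub>\<otimes> (P m) \<boxplus> pow_mult n m)
      \<cdot> (\<zeta>\<^sub>\<otimes> (P m) \<one> \<boxplus> \<zeta>\<^sub>\<otimes> (P m) (P n)) \<cdot> \<delta>\<^sub>l (P m) \<one> (P n)"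
    using s(1) by (subst one.permute_block_sum_chain) (simp add: right_dist_mult_sym permutes_id)+
  also have "\<dots> = pow_mult m (Suc n)"
    using Suc.IH by (simp add: mult.sym_unit mult.commute[of m n])
  finally show ?case .
qed

lemma pow_mult_sym': "act (m * n) (pair_swap m n) \<cdot> pow_mult m n = pow_mult n m \<cdot> \<zeta>\<^sub>\<otimes> (P m) (P n)"
proof -
  have s: "pair_swap n m permutes {Suc 0..m * n}" "pair_swap m n permutes {Suc 0..m * n}"
    using permutes_pair_swap[of n m] permutes_pair_swap[of m n] by (simp_all add: mult.commute)
  have "act (m * n) (pair_swap m n) \<cdot> act (m * n) (pair_swap n m) = \<iota> (P (m * n))"
    using s by (simp flip: one.permute_comp)
  from this[THEN add.chain, of _ _ "pow_mult n m \<cdot> \<zeta>\<^sub>\<otimes> (P m) (P n)"] show ?thesis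
    using s by (simp add: pow_mult_sym mult.commute)
qed

lemma pow_mult_natural:
  assumes "\<sigma> permutes {1..m}" "\<tau> permutes {1..n}"
  shows "pow_mult m n \<cdot> (act m \<sigma> \<boxtimes> act n \<tau>) = act (m * n) (perm_prod m n \<sigma> \<tau>) \<cdot> pow_mult m n"
proof -
  have perms: "perm_prod m n \<sigma> id permutes {1..m * n}" "perm_prod m n id \<tau> permutes {1..m * n}"
    using assms by (simp_all add: permutes_simps permutes_id)
  note [simp] = one.ty_permute[OF perms(1)[unfolded One_nat_def]] one.ty_permute[OF perms(2)[unfolded
      One_nat_def]]
    one.ty_permute[OF assms(1)[unfolded One_nat_def]] one.ty_permute[OF assms(2)[unfolded One_nat_def]]
  have "perm_prod m n \<sigma> \<tau> = perm_prod m n \<sigma> id \<circ> perm_prod m n id \<tau>"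
    using perm_prod_comp[of id m \<tau> n \<sigma> id] assms by (simp add: permutes_id)
  then have "act (m * n) (perm_prod m n \<sigma> \<tau>) \<cdot> pow_mult m n
    = act (m * n) (perm_prod m n \<sigma> id) \<cdot> (act (m * n) (perm_prod m n id \<tau>) \<cdot> pow_mult m n)"
    using one.permute_comp[OF perms(2,1)] by simp
  also have "\<dots> = (act (m * n) (perm_prod m n \<sigma> id) \<cdot> pow_mult m n) \<cdot> (\<iota> (P m) \<boxtimes> act n \<tau>)"
    using assms by (subst pow_mult_natural_right) simp_all
  also have "\<dots> = pow_mult m n \<cdot> (act m \<sigma> \<boxtimes> act n \<tau>)"
    using assms by (subst pow_mult_natural_left) simp_all
  finally show ?thesis by simp
qed

definition free_functor :: "(nat, nat \<times> (nat \<Rightarrow> nat), 'o, 'm) bimonoidal_functor_data" where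
  "free_functor = \<lparr>OMap = P, AMap = (\<lambda>f\<in>Arr Sigma_category. act (fst f) (snd f)),
     Add2 = PA, Add0 = \<iota> \<zero>, Mult2 = pow_mult, Mult0 = pow_one\<rparr>"

lemma free_functor_simps [simp]:
  "OMap free_functor = P"
  "snd f permutes {Suc 0..fst f} \<Longrightarrow> AMap free_functor f = act (fst f) (snd f)"
  "Add2 free_functor = PA" "Add0 free_functor = \<iota> \<zero>" "Mult2 free_functor = pow_mult" "Mult0 free_functor
      = pow_one"
  by (simp_all add: free_functor_def)

lemma pow_one_simps [simp]: "iso_arr C pow_one" "\<rho>\<^sub>\<oplus> \<one> \<cdot> pow_one = \<iota> \<one>"
  by (simp_all add: pow_one_def)

lemma robust_free_functor: "robust_symmetric_bimonoidal_functor Sigma_category C free_functor"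
  by unfold_locales
    (simp_all add: add.ty_iff_hom[symmetric] permutes_id permutes_simps permutes_compose one.permute_comp
    one.permute_block_sum one.permute_block_swap one.pow_add_assoc one.pow_add_0_right pow_mult_natural
        pow_mult_assoc pow_mult_sym'
    pow_mult_one_left pow_mult_one_right pow_mult_zero_left pow_mult_add add.left_unit_eq_right_unit
        add.assoc add_mult_distrib2 del: pow_mult.simps(2),
     simp add: free_functor_def)

end

section \<open>Bimonoidal transformations\<close>

context category_functor begin

lemma ty_AMap [simp]: "A.ty f = Some p \<Longrightarrow> B.ty (AMap F f) = Some (OMap F (fst p), OMap F (snd p))"
  using AMap_in_hom[of f] A.tyD[of f p] by (simp add: B.ty_iff_hom)

lemma AMap_Comp_ty:
  "A.ty f = Some p \<Longrightarrow> A.ty g = Some q \<Longrightarrow> fst q = snd p \<Longrightarrow> AMap F (g \<cdot>\<^bsub>A\<^esub> f) = AMap F g \<cdot>\<^bsub>B\<^esub> AMap F f"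
  using AMap_Comp[of f g] by (simp add: A.tyD)

declare OMap_in_Obj [simp] AMap_Ident [simp]

end

context lax_symmetric_monoidal_functor begin

lemmas ty_F2 [simp] = F2_in_hom[THEN B.hom_ty]
lemmas ty_F0 [simp] = F0_in_hom[THEN B.hom_ty]

end

context symmetric_bimonoidal_functor begin

text \<open>The axiom for \<open>\<lambda>\<^sub>\<bullet>\<close> transported along the symmetries of the two categories.\<close>
lemma functor_right_null:
  assumes [simp]: "A \<in> Obj C"
  shows "AMap F (\<rho>\<^sub>\<bullet>\<^bsub>C\<^esub> A) \<cdot>\<^bsub>D\<^esub> Mult2 F A \<zero>\<^bsub>C\<^esub> \<cdot>\<^bsub>D\<^esub> (\<iota>\<^bsub>D\<^esub> (OMap F A) \<boxtimes>\<^bsub>D\<^esub> Add0 F)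
    = Add0 F \<cdot>\<^bsub>D\<^esub> \<rho>\<^sub>\<bullet>\<^bsub>D\<^esub> (OMap F A)"
proof -
  let ?z = "\<zeta>\<^sub>\<otimes>\<^bsub>C\<^esub> A \<zero>\<^bsub>C\<^esub>"
  have "AMap F (\<rho>\<^sub>\<bullet>\<^bsub>C\<^esub> A) = AMap F (\<lambda>\<^sub>\<bullet>\<^bsub>C\<^esub> A) \<cdot>\<^bsub>D\<^esub> AMap F ?z"
    by (simp add: add.AMap_Comp_ty[symmetric] C.left_null_mult_sym)
  then have "AMap F (\<rho>\<^sub>\<bullet>\<^bsub>C\<^esub> A) \<cdot>\<^bsub>D\<^esub> Mult2 F A \<zero>\<^bsub>C\<^esub> \<cdot>\<^bsub>D\<^esub> (\<iota>\<^bsub>D\<^esub> (OMap F A) \<boxtimes>\<^bsub>D\<^esub> Add0 F)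
    = AMap F (\<lambda>\<^sub>\<bullet>\<^bsub>C\<^esub> A) \<cdot>\<^bsub>D\<^esub> (AMap F ?z \<cdot>\<^bsub>D\<^esub> Mult2 F A \<zero>\<^bsub>C\<^esub>) \<cdot>\<^bsub>D\<^esub> (\<iota>\<^bsub>D\<^esub> (OMap F A) \<boxtimes>\<^bsub>D\<^esub> Add0 F)"
    by simp
  also have "\<dots> = (AMap F (\<lambda>\<^sub>\<bullet>\<^bsub>C\<^esub> A) \<cdot>\<^bsub>D\<^esub> Mult2 F \<zero>\<^bsub>C\<^esub> A \<cdot>\<^bsub>D\<^esub> (Add0 F \<boxtimes>\<^bsub>D\<^esub> \<iota>\<^bsub>D\<^esub> (OMap F A)))
      \<cdot>\<^bsub>D\<^esub> \<zeta>\<^sub>\<otimes>\<^bsub>D\<^esub> (OMap F A) \<zero>\<^bsub>D\<^esub>"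
    by (simp add: mult.F2_sym D.mult.sym_nat')
  also have "\<dots> = Add0 F \<cdot>\<^bsub>D\<^esub> \<rho>\<^sub>\<bullet>\<^bsub>D\<^esub> (OMap F A)"
    unfolding functor_left_null[OF assms] by (simp add: D.left_null_mult_sym)
  finally show ?thesis .
qed

end

context category begin

lemma iso_square:
  assumes "g \<cdot> b = a \<cdot> f" "iso_arr C f" "iso_arr C g"
    "f \<Ztypecolon> A \<rightarrow> A'" "g \<Ztypecolon> B \<rightarrow> B'" "a \<Ztypecolon> A' \<rightarrow> B'" "b \<Ztypecolon> A \<rightarrow> B"
  shows "inv_arr C g \<cdot> a = b \<cdot> inv_arr C f"
proof -
  have "inv_arr C g \<cdot> a = inv_arr C g \<cdot> (a \<cdot> f) \<cdot> inv_arr C f" using assms(2-) by simp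
  also have "\<dots> = b \<cdot> inv_arr C f" unfolding assms(1)[symmetric] using assms(2-) by simp
  finally show ?thesis .
qed

end

context natural_transformation begin

lemma ty_component [simp]: "a \<in> Obj A \<Longrightarrow> F.B.ty (\<eta> a) = Some (OMap F a, OMap G a)"
  using component_in_hom F.B.hom_ty by blast

end

lemma bimonoidal_transformation_id:
  assumes "symmetric_bimonoidal_functor C D F"
  shows "bimonoidal_transformation C D F F (\<lambda>A\<in>Obj C. \<iota>\<^bsub>D\<^esub> (OMap F A))"
proof -
  interpret F: symmetric_bimonoidal_functor C D F by fact
  show ?thesis
    by unfold_locales
      (simp_all add: F.D.add.ty_iff_hom[symmetric] F.C.add.Arr_ty F.C.add.Dom_in_Obj F.C.add.Cod_in_Obj)
qed

lemma bimonoidal_transformation_comp: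
  assumes "bimonoidal_transformation C D F G \<sigma>" "bimonoidal_transformation C D G H \<tau>"
  shows "bimonoidal_transformation C D F H (\<lambda>A\<in>Obj C. \<tau> A \<cdot>\<^bsub>D\<^esub> \<sigma> A)"
proof -
  interpret S: bimonoidal_transformation C D F G \<sigma> by fact
  interpret T: bimonoidal_transformation C D G H \<tau> by fact
  note chain = S.F.D.add.chain
  show ?thesis
  proof unfold_locales
    fix f assume f: "f \<in> Arr C"
    have ty: "S.F.C.add.ty f = Some (Dom C f, Cod C f)" using f by (rule S.F.C.add.Arr_ty)
    note [simp] = f ty S.F.C.add.ty_Obj[OF ty] chain[OF T.naturality[OF f]]
    show "(\<lambda>A\<in>Obj C. \<tau> A \<cdot>\<^bsub>D\<^esub> \<sigma> A) (Cod C f) \<cdot>\<^bsub>D\<^esub> AMap F f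
        = AMap H f \<cdot>\<^bsub>D\<^esub> (\<lambda>A\<in>Obj C. \<tau> A \<cdot>\<^bsub>D\<^esub> \<sigma> A) (Dom C f)"
      by (simp add: S.naturality)
  next
    fix A B assume [simp]: "A \<in> Obj C" "B \<in> Obj C"
    show "(\<lambda>A\<in>Obj C. \<tau> A \<cdot>\<^bsub>D\<^esub> \<sigma> A) (A \<oplus>\<^bsub>C\<^esub> B) \<cdot>\<^bsub>D\<^esub> Add2 F A B
        = Add2 H A B \<cdot>\<^bsub>D\<^esub> ((\<lambda>A\<in>Obj C. \<tau> A \<cdot>\<^bsub>D\<^esub> \<sigma> A) A \<boxplus>\<^bsub>D\<^esub> (\<lambda>A\<in>Obj C. \<tau> A \<cdot>\<^bsub>D\<^esub> \<sigma> A) B)"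
      by (simp add: S.component_add chain[OF T.component_add])
    show "(\<lambda>A\<in>Obj C. \<tau> A \<cdot>\<^bsub>D\<^esub> \<sigma> A) (A \<otimes>\<^bsub>C\<^esub> B) \<cdot>\<^bsub>D\<^esub> Mult2 F A B
        = Mult2 H A B \<cdot>\<^bsub>D\<^esub> ((\<lambda>A\<in>Obj C. \<tau> A \<cdot>\<^bsub>D\<^esub> \<sigma> A) A \<boxtimes>\<^bsub>D\<^esub> (\<lambda>A\<in>Obj C. \<tau> A \<cdot>\<^bsub>D\<^esub> \<sigma> A) B)"
      by (simp add: S.component_mult chain[OF T.component_mult])
  qed (simp_all add: S.F.D.add.ty_iff_hom[symmetric] S.component_zero S.component_one T.component_zero
      T.component_one)
qed

lemma bimonoidal_transformation_inverse:
  assumes "bimonoidal_transformation C D F G \<sigma>" "\<And>A. A \<in> Obj C \<Longrightarrow> iso_arr D (\<sigma> A)"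
  shows "bimonoidal_transformation C D G F (\<lambda>A\<in>Obj C. inv_arr D (\<sigma> A))"
proof -
  interpret S: bimonoidal_transformation C D F G \<sigma> by fact
  note [simp] = assms(2)
  show ?thesis
  proof unfold_locales
    fix f assume f: "f \<in> Arr C"
    have ty: "S.F.C.add.ty f = Some (Dom C f, Cod C f)" using f by (rule S.F.C.add.Arr_ty)
    note [simp] = f ty S.F.C.add.ty_Obj[OF ty]
    show "(\<lambda>A\<in>Obj C. inv_arr D (\<sigma> A)) (Cod C f) \<cdot>\<^bsub>D\<^esub> AMap G f
        = AMap F f \<cdot>\<^bsub>D\<^esub> (\<lambda>A\<in>Obj C. inv_arr D (\<sigma> A)) (Dom C f)"
      by simp (rule S.F.D.add.iso_square[OF S.naturality[OF f]]; simp)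
  next
    fix A B assume [simp]: "A \<in> Obj C" "B \<in> Obj C"
    show "(\<lambda>A\<in>Obj C. inv_arr D (\<sigma> A)) (A \<oplus>\<^bsub>C\<^esub> B) \<cdot>\<^bsub>D\<^esub> Add2 G A B
        = Add2 F A B \<cdot>\<^bsub>D\<^esub> ((\<lambda>A\<in>Obj C. inv_arr D (\<sigma> A)) A \<boxplus>\<^bsub>D\<^esub> (\<lambda>A\<in>Obj C. inv_arr D (\<sigma> A)) B)"
      by (simp flip: S.F.D.add.inv_tArr) (rule S.F.D.add.iso_square[OF S.component_add]; simp)
    show "(\<lambda>A\<in>Obj C. inv_arr D (\<sigma> A)) (A \<otimes>\<^bsub>C\<^esub> B) \<cdot>\<^bsub>D\<^esub> Mult2 G A B
        = Mult2 F A B \<cdot>\<^bsub>D\<^esub> ((\<lambda>A\<in>Obj C. inv_arr D (\<sigma> A)) A \<boxtimes>\<^bsub>D\<^esub> (\<lambda>A\<in>Obj C. inv_arr D (\<sigma> A)) B)"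
      by (simp flip: S.F.D.mult.inv_tArr) (rule S.F.D.add.iso_square[OF S.component_mult]; simp)
  qed (simp_all add: S.F.D.add.ty_iff_hom[symmetric] flip: S.component_zero S.component_one)
qed

lemma robust_hom_simps [simp]:
  "Obj (robust_hom C D) = {F. robust_symmetric_bimonoidal_functor C D F}"
  "(F, \<eta>, G) \<in> Arr (robust_hom C D) \<longleftrightarrow> robust_symmetric_bimonoidal_functor C D F \<and>
     robust_symmetric_bimonoidal_functor C D G \<and> bimonoidal_transformation C D F G \<eta>"
  "Dom (robust_hom C D) (F, \<eta>, G) = F"
  "Cod (robust_hom C D) (F, \<eta>, G) = G"
  "Ident (robust_hom C D) F = (F, (\<lambda>A\<in>Obj C. \<iota>\<^bsub>D\<^esub> (OMap F A)), F)"
  "Comp (robust_hom C D) (G', \<tau>, H) (F, \<sigma>, G) = (F, (\<lambda>A\<in>Obj C. \<tau> A \<cdot>\<^bsub>D\<^esub> \<sigma> A), H)"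
  by (simp_all add: robust_hom_def)

text \<open>The unit laws hold as equalities of families because components are undefined off the objects of the source.\<close>
lemma category_robust_hom: "category (robust_hom C D)"
proof (unfold_locales, goal_cases)
  case (3 F)
  then have "symmetric_bimonoidal_functor C D F" by (simp add: robust_symmetric_bimonoidal_functor_def)
  then show ?case using 3 by (simp add: hom_def bimonoidal_transformation_id)
next
  case (5 f g h)
  obtain F \<sigma> G where f: "f = (F, \<sigma>, G)" by (cases f)
  obtain G' \<tau> H where g: "g = (G', \<tau>, H)" by (cases g)
  obtain H' \<upsilon> K where h: "h = (H', \<upsilon>, K)" by (cases h)
  interpret S: bimonoidal_transformation C D F G \<sigma> using 5 f by simp
  interpret T: bimonoidal_transformation C D G H \<tau> using 5 f g by simp
  interpret U: bimonoidal_transformation C D H K \<upsilon> using 5 f g h by simp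
  show ?case by (simp add: f g h restrict_def fun_eq_iff)
next
  case (6 f)
  obtain F \<sigma> G where f: "f = (F, \<sigma>, G)" by (cases f)
  interpret S: bimonoidal_transformation C D F G \<sigma> using 6 f by simp
  show ?case using S.component_extensional by (auto simp: f fun_eq_iff extensional_def)
next
  case (7 f)
  obtain F \<sigma> G where f: "f = (F, \<sigma>, G)" by (cases f)
  interpret S: bimonoidal_transformation C D F G \<sigma> using 7 f by simp
  show ?case using S.component_extensional by (auto simp: f fun_eq_iff extensional_def)
qed (auto simp: hom_def intro: bimonoidal_transformation_comp)

section \<open>Comparison of robust functors and the equivalence\<close>

lemma Sigma_ty [simp]: "\<sigma> permutes {Suc 0..n} \<Longrightarrow> Sigma.ty (n, \<sigma>) = Some (n, n)"
  by (simp add: Sigma.ty_def)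

text \<open>Robustness of the source allows the structure maps in the unit and additivity conditions to be cancelled;
  they then determine the components at \<open>0\<close> and \<open>1\<close>, and that at \<open>n + 1\<close> from those at \<open>1\<close> and \<open>n\<close>.\<close>
lemma transformation_from_Sigma_unique:
  assumes "robust_symmetric_bimonoidal_functor Sigma_category C F"
    and "bimonoidal_transformation Sigma_category C F G \<eta>" "bimonoidal_transformation Sigma_category C F G \<theta>"
  shows "\<eta> = \<theta>"
proof
  interpret F: robust_symmetric_bimonoidal_functor Sigma_category C F by fact
  interpret E: bimonoidal_transformation Sigma_category C F G \<eta> by fact
  interpret T: bimonoidal_transformation Sigma_category C F G \<theta> by fact
  note tys [simp] = E.ty_component[unfolded Sigma_simps] T.ty_component[unfolded Sigma_simps]
  have zero: "\<eta> 0 = \<theta> 0"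
  proof (rule F.D.add.iso_cancel_right[of _ "Add0 F"])
    show "\<eta> 0 \<cdot>\<^bsub>C\<^esub> Add0 F = \<theta> 0 \<cdot>\<^bsub>C\<^esub> Add0 F" using E.component_zero T.component_zero by simp
  qed (use F.Add0_iso F.add.ty_F0 in simp)+
  have one: "\<eta> (Suc 0) = \<theta> (Suc 0)"
  proof (rule F.D.add.iso_cancel_right[of _ "Mult0 F"])
    show "\<eta> (Suc 0) \<cdot>\<^bsub>C\<^esub> Mult0 F = \<theta> (Suc 0) \<cdot>\<^bsub>C\<^esub> Mult0 F" using E.component_one T.component_one by simp
  qed (use F.Mult0_iso F.mult.ty_F0 in simp)+
  fix n show "\<eta> n = \<theta> n"
  proof (induction n)
    case (Suc n)
    show ?case
    proof (rule F.D.add.iso_cancel_right[of _ "Add2 F (Suc 0) n"])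
      show "\<eta> (Suc n) \<cdot>\<^bsub>C\<^esub> Add2 F (Suc 0) n = \<theta> (Suc n) \<cdot>\<^bsub>C\<^esub> Add2 F (Suc 0) n"
        using E.component_add[of 1 n] T.component_add[of 1 n] Suc one by simp
      show "iso_arr C (Add2 F (Suc 0) n)" by (rule F.Add2_iso) simp_all
    qed (use F.add.ty_F2[of "Suc 0" n] in simp)+
  qed (rule zero)
qed

locale robust_functor_on_Sigma = G: robust_symmetric_bimonoidal_functor Sigma_category C G
  for C :: "('o, 'm, 'z) symmetric_bimonoidal_data_scheme" (structure)
    and G :: "(nat, nat \<times> (nat \<Rightarrow> nat), 'o, 'm) bimonoidal_functor_data"
begin

abbreviation P where "P \<equiv> G.D.one.pow"
abbreviation PA where "PA \<equiv> G.D.one.pow_add"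
abbreviation act where "act \<equiv> G.D.one.permute"
abbreviation pow_mult where "pow_mult \<equiv> G.D.pow_mult"

lemma ty_G [simp]:
  "G.D.add.ty (Add2 G m n) = Some (OMap G m \<oplus> OMap G n, OMap G (m + n))"
  "G.D.add.ty (Mult2 G m n) = Some (OMap G m \<otimes> OMap G n, OMap G (m * n))"
  "G.D.add.ty (Add0 G) = Some (\<zero>, OMap G 0)"
  "G.D.add.ty (Mult0 G) = Some (\<one>, OMap G (Suc 0))"
  "\<sigma> permutes {Suc 0..n} \<Longrightarrow> G.D.add.ty (AMap G (n, \<sigma>)) = Some (OMap G n, OMap G n)"
  "OMap G n \<in> Obj C"
  using G.add.ty_F2[of m n] G.mult.ty_F2[of m n] G.add.ty_F0 G.mult.ty_F0 G.add.ty_AMap[of "(n, \<sigma>)"]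
      G.add.OMap_in_Obj[of n]
  by simp_all

lemma AMap_G_id [simp]: "AMap G (n, id) = \<iota> (OMap G n)"
  using G.add.AMap_Ident[of n] by simp

lemma iso_G [simp]: "iso_arr C (Add2 G m n)" "iso_arr C (Add0 G)" "iso_arr C (Mult0 G)"
  using G.Add2_iso[of m n] G.Add0_iso G.Mult0_iso by simp_all

text \<open>The only choice compatible with the unit and additivity conditions.\<close>
primrec comparison :: "nat \<Rightarrow> 'm" where
  "comparison 0 = Add0 G"
| "comparison (Suc n) = Add2 G 1 n \<cdot> (Mult0 G \<boxplus> comparison n)"

lemma ty_comparison [simp]: "G.D.add.ty (comparison n) = Some (P n, OMap G n)"
  by (induction n) simp_all

lemma iso_comparison [simp]: "iso_arr C (comparison n)"
  by (induction n) simp_all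

lemma comparison_add: "comparison (m + n) \<cdot> PA m n = Add2 G m n \<cdot> (comparison m \<boxplus> comparison n)"
proof (induction m)
  case 0
  have "Add2 G 0 n \<cdot> (comparison 0 \<boxplus> comparison n)
    = (AMap G (n, id) \<cdot> Add2 G 0 n \<cdot> (Add0 G \<boxplus> \<iota> (OMap G n))) \<cdot> (\<iota> \<zero> \<boxplus> comparison n)"
    by simp
  also have "\<dots> = \<lambda>\<^sub>\<oplus> (OMap G n) \<cdot> (\<iota> \<zero> \<boxplus> comparison n)"
    using G.add.F2_left[of n] by simp
  finally show ?case by (simp add: G.D.add.natural)
next
  case (Suc m)
  have assoc: "Add2 G (Suc m) n \<cdot> (Add2 G 1 m \<boxplus> \<iota> (OMap G n))
      = Add2 G 1 (m + n) \<cdot> (\<iota> (OMap G 1) \<boxplus> Add2 G m n) \<cdot> \<alpha>\<^sub>\<oplus> (OMap G 1) (OMap G m) (OMap G n)"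
    using G.add.F2_assoc[of 1 m n] by simp
  have "comparison (Suc m + n) \<cdot> PA (Suc m) n
    = Add2 G 1 (m + n) \<cdot> (Mult0 G \<boxplus> (comparison (m + n) \<cdot> PA m n)) \<cdot> \<alpha>\<^sub>\<oplus> \<one> (P m) (P n)"
    by simp
  also have "\<dots> = Add2 G 1 (m + n) \<cdot> (\<iota> (OMap G 1) \<boxplus> Add2 G m n) \<cdot> (Mult0 G \<boxplus> (comparison m \<boxplus> comparison n))
      \<cdot> \<alpha>\<^sub>\<oplus> \<one> (P m) (P n)"
    unfolding Suc.IH by simp
  also have "\<dots> = (Add2 G 1 (m + n) \<cdot> (\<iota> (OMap G 1) \<boxplus> Add2 G m n) \<cdot> \<alpha>\<^sub>\<oplus> (OMap G 1) (OMap G m) (OMap G n))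
      \<cdot> ((Mult0 G \<boxplus> comparison m) \<boxplus> comparison n)"
    by (simp add: G.D.add.natural)
  also have "\<dots> = Add2 G (Suc m) n \<cdot> (comparison (Suc m) \<boxplus> comparison n)"
    unfolding assoc[symmetric] by simp
  finally show ?case .
qed

lemma comparison_natural:
  assumes "\<sigma> permutes {1..n}"
  shows "comparison n \<cdot> act n \<sigma> = AMap G (n, \<sigma>) \<cdot> comparison n"
  using assms
proof (induction rule: permutation_induct)
  case (id n)
  then show ?case by simp
next
  case (comp n \<sigma> \<tau>)
  then have [simp]: "\<sigma> permutes {Suc 0..n}" "\<tau> permutes {Suc 0..n}" by simp_all
  have "AMap G (n, \<tau> \<circ> \<sigma>) = AMap G (n, \<tau>) \<cdot> AMap G (n, \<sigma>)"
    using G.add.AMap_Comp[of "(n, \<sigma>)" "(n, \<tau>)"] by simp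
  then show ?case
    by (simp add: G.D.one.permute_comp comp.IH G.D.add.chain[OF comp.IH(2)] del: o_apply)
next
  case (sum m n \<sigma> \<tau>)
  then have [simp]: "\<sigma> permutes {Suc 0..m}" "\<tau> permutes {Suc 0..n}" "block_sum m \<sigma> \<tau> permutes {Suc 0..m + n}"
    by (simp_all add: permutes_simps)
  have nat: "Add2 G m n \<cdot> (AMap G (m, \<sigma>) \<boxplus> AMap G (n, \<tau>)) = AMap G (m + n, block_sum m \<sigma> \<tau>) \<cdot> Add2 G m n"
    using G.add.F2_natural[of "(m, \<sigma>)" "(n, \<tau>)"] by simp
  show ?case
  proof (rule G.D.add.iso_cancel_right[of _ "PA m n"])
    have "(comparison (m + n) \<cdot> act (m + n) (block_sum m \<sigma> \<tau>)) \<cdot> PA m n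
      = (comparison (m + n) \<cdot> PA m n) \<cdot> (act m \<sigma> \<boxplus> act n \<tau>)"
      by (simp add: G.D.one.permute_block_sum)
    also have "\<dots> = (Add2 G m n \<cdot> (AMap G (m, \<sigma>) \<boxplus> AMap G (n, \<tau>))) \<cdot> (comparison m \<boxplus> comparison n)"
      unfolding comparison_add by (simp add: sum.IH)
    also have "\<dots> = AMap G (m + n, block_sum m \<sigma> \<tau>) \<cdot> (comparison (m + n) \<cdot> PA m n)"
      unfolding nat comparison_add by simp
    finally show "(comparison (m + n) \<cdot> act (m + n) (block_sum m \<sigma> \<tau>)) \<cdot> PA m n
      = (AMap G (m + n, block_sum m \<sigma> \<tau>) \<cdot> comparison (m + n)) \<cdot> PA m n"
      by simp
  qed simp+
next
  case (swap m n)
  have [simp]: "block_swap m n permutes {Suc 0..m + n}" by (simp add: permutes_simps)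
  have sym: "AMap G (m + n, block_swap m n) \<cdot> Add2 G m n = Add2 G n m \<cdot> \<zeta>\<^sub>\<oplus> (OMap G m) (OMap G n)"
    using G.add.F2_sym[of m n] by simp
  show ?case
  proof (rule G.D.add.iso_cancel_right[of _ "PA m n"])
    have "(comparison (m + n) \<cdot> act (m + n) (block_swap m n)) \<cdot> PA m n
      = (comparison (n + m) \<cdot> PA n m) \<cdot> \<zeta>\<^sub>\<oplus> (P m) (P n)"
      by (simp add: G.D.one.permute_block_swap add.commute)
    also have "\<dots> = (Add2 G n m \<cdot> \<zeta>\<^sub>\<oplus> (OMap G m) (OMap G n)) \<cdot> (comparison m \<boxplus> comparison n)"
      unfolding comparison_add by (simp add: G.D.add.sym_nat')
    also have "\<dots> = AMap G (m + n, block_swap m n) \<cdot> (comparison (m + n) \<cdot> PA m n)"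
      unfolding sym[symmetric] comparison_add by simp
    finally show "(comparison (m + n) \<cdot> act (m + n) (block_swap m n)) \<cdot> PA m n
      = (AMap G (m + n, block_swap m n) \<cdot> comparison (m + n)) \<cdot> PA m n"
      by simp
  qed simp+
qed

text \<open>Both sides satisfy the same recursion in \<open>n\<close>: the left one by definition of \<open>pow_mult\<close>, the right one because
  \<open>G\<close> preserves \<open>\<delta>\<^sub>l\<close>, which is an identity in \<open>\<Sigma>\<close>.\<close>
lemma comparison_mult: "comparison (m * n) \<cdot> pow_mult m n = Mult2 G m n \<cdot> (comparison m \<boxtimes> comparison n)"
proof (induction n)
  case 0
  have "Mult2 G m 0 \<cdot> (comparison m \<boxtimes> comparison 0)
    = (AMap G (0, id) \<cdot> Mult2 G m 0 \<cdot> (\<iota> (OMap G m) \<boxtimes> Add0 G)) \<cdot> (comparison m \<boxtimes> \<iota> \<zero>)"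
    by simp
  also have "\<dots> = Add0 G \<cdot> \<rho>\<^sub>\<bullet> (P m)"
    using G.functor_right_null[of m] by (simp add: G.D.dist_nat)
  finally show ?case by simp
next
  case (Suc n)
  have dist: "Mult2 G m (Suc n) \<cdot> (\<iota> (OMap G m) \<boxtimes> Add2 G 1 n)
      = Add2 G m (m * n) \<cdot> (Mult2 G m 1 \<boxplus> Mult2 G m n) \<cdot> \<delta>\<^sub>l (OMap G m) (OMap G 1) (OMap G n)"
    using G.functor_left_dist[of m 1 n] by simp
  have unit: "Mult2 G m (Suc 0) \<cdot> (\<iota> (OMap G m) \<boxtimes> Mult0 G) = \<rho>\<^sub>\<otimes> (OMap G m)"
    using G.mult.F2_right[of m] by simp
  have "Mult2 G m (Suc n) \<cdot> (comparison m \<boxtimes> comparison (Suc n))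
    = (Mult2 G m (Suc n) \<cdot> (\<iota> (OMap G m) \<boxtimes> Add2 G 1 n)) \<cdot> (comparison m \<boxtimes> (Mult0 G \<boxplus> comparison n))"
    by simp
  also have "\<dots> = Add2 G m (m * n) \<cdot> ((Mult2 G m 1 \<cdot> (comparison m \<boxtimes> Mult0 G)) \<boxplus> (Mult2 G m n
      \<cdot> (comparison m \<boxtimes> comparison n)))
      \<cdot> \<delta>\<^sub>l (P m) \<one> (P n)"
    unfolding dist by (simp add: G.D.dist_nat)
  also have "Mult2 G m 1 \<cdot> (comparison m \<boxtimes> Mult0 G) = (Mult2 G m (Suc 0) \<cdot> (\<iota> (OMap G m) \<boxtimes> Mult0 G))
      \<cdot> (comparison m \<boxtimes> \<iota> \<one>)"
    by simp
  also have "\<dots> = comparison m \<cdot> \<rho>\<^sub>\<otimes> (P m)"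
    unfolding unit by (simp add: G.D.mult.natural)
  also have "Add2 G m (m * n) \<cdot> ((comparison m \<cdot> \<rho>\<^sub>\<otimes> (P m)) \<boxplus> (Mult2 G m n \<cdot> (comparison m \<boxtimes> comparison n)))
      \<cdot> \<delta>\<^sub>l (P m) \<one> (P n)
    = (Add2 G m (m * n) \<cdot> (comparison m \<boxplus> comparison (m * n))) \<cdot> (\<rho>\<^sub>\<otimes> (P m) \<boxplus> pow_mult m n) \<cdot> \<delta>\<^sub>l (P m) \<one> (P n)"
    unfolding Suc.IH[symmetric] by simp
  also have "\<dots> = comparison (m * Suc n) \<cdot> pow_mult m (Suc n)"
    unfolding comparison_add[symmetric] by simp
  finally show ?case ..
qed

lemma comparison_one: "comparison (Suc 0) \<cdot> G.D.pow_one = Mult0 G"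
proof -
  have "comparison (Suc 0) = (AMap G (Suc 0, id) \<cdot> Add2 G 1 0 \<cdot> (\<iota> (OMap G 1) \<boxplus> Add0 G)) \<cdot> (Mult0 G \<boxplus> \<iota> \<zero>)"
    by simp
  also have "\<dots> = Mult0 G \<cdot> \<rho>\<^sub>\<oplus> \<one>"
    using G.add.F2_right[of 1] by (simp add: G.D.add.natural)
  finally show ?thesis by (simp del: comparison.simps)
qed

lemma comparison_transformation: "bimonoidal_transformation Sigma_category C G.D.free_functor G comparison"
proof -
  interpret F: robust_symmetric_bimonoidal_functor Sigma_category C G.D.free_functor
      by (rule G.D.robust_free_functor)
  show ?thesis
    by unfold_locales
      (simp_all only: Sigma_simps G.D.free_functor_simps,
       simp_all add: G.D.add.ty_iff_hom[symmetric] comparison_natural comparison_add comparison_mult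
           comparison_one del: comparison.simps(2))
qed

end


text \<open>The transformation is obtained by passing through the functor \<open>P\<close>.\<close>
lemma unique_bimonoidal_transformation:
  assumes "robust_symmetric_bimonoidal_functor Sigma_category C F" "robust_symmetric_bimonoidal_functor
      Sigma_category C G"
  shows "\<exists>!\<eta>. bimonoidal_transformation Sigma_category C F G \<eta>"
proof -
  interpret F: robust_functor_on_Sigma C F by (rule robust_functor_on_Sigma.intro) fact
  interpret G: robust_functor_on_Sigma C G by (rule robust_functor_on_Sigma.intro) fact
  have "bimonoidal_transformation Sigma_category C F F.G.D.free_functor (\<lambda>n\<in>Obj Sigma_category. inv_arr C
      (F.comparison n))"
    by (rule bimonoidal_transformation_inverse[OF F.comparison_transformation]) simp
  from bimonoidal_transformation_comp[OF this G.comparison_transformation]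
  show ?thesis using transformation_from_Sigma_unique[OF assms(1)] by blast
qed

lemma category_terminal: "category terminal_category"
  by unfold_locales (auto simp: terminal_category_def hom_def)

text \<open>A category with an object and exactly one arrow between any two objects is contractible: parallel arrows
  agree, so all arrows are invertible and all squares commute.\<close>
lemma (in category) equivalence_to_terminal:
  assumes K: "K \<in> Obj C" and unique: "\<And>A B. A \<in> Obj C \<Longrightarrow> B \<in> Obj C \<Longrightarrow> \<exists>!f. f \<in> hom C A B"
  shows "equivalence_of_categories C terminal_category (to_terminal C)"
proof -
  interpret T: category terminal_category by (rule category_terminal)
  let ?S = "\<lparr>OMap = (\<lambda>a. K), AMap = (\<lambda>a. \<iota> K)\<rparr> :: (unit, unit, _, _) functor_data"
  define t where "t A = (THE f. f \<in> hom C A K)" for A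
  have t: "t A \<in> hom C A K" if "A \<in> Obj C" for A
    unfolding t_def using unique[OF that K] by (rule theI')
  have ty_t [simp]: "t A \<Ztypecolon> A \<rightarrow> K" if "A \<in> Obj C" for A
    using t[OF that] by (rule hom_ty)
  have parallel: "f = g" if "f \<Ztypecolon> A \<rightarrow> B" "g \<Ztypecolon> A \<rightarrow> B" for f g A B
    using unique[of A B] ty_Obj[OF that(1)] that by (auto simp: ty_iff_hom)
  have iso: "iso_arr C f" if f: "f \<Ztypecolon> A \<rightarrow> B" for f A B
  proof -
    note [simp] = f ty_Obj[OF f]
    obtain g where g [simp]: "g \<Ztypecolon> B \<rightarrow> A" using unique[of B A] by (auto simp: ty_iff_hom)
    show ?thesis by (rule inverseI(1)[OF _ _ f g]; rule parallel) simp_all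
  qed
  have terminal [simp]: "Obj terminal_category = UNIV" "Arr terminal_category = UNIV"
    by (simp_all add: terminal_category_def)
  have Arr [simp]: "\<And>A. A \<in> Obj C \<Longrightarrow> \<iota> A \<in> Arr C"
    "\<And>f g. f \<in> Arr C \<Longrightarrow> g \<in> Arr C \<Longrightarrow> Dom C g = Cod C f \<Longrightarrow> g \<cdot> f \<in> Arr C"
    using Ident_in_hom Comp_in_hom by (auto simp: hom_def)
  have toT: "category_functor C terminal_category (to_terminal C)"
    by unfold_locales (auto simp: hom_def extensional_def)
  have S: "category_functor terminal_category C ?S"
    using K by unfold_locales (auto simp flip: ty_iff_hom)
  interpret id: category_functor C C "id_functor C"
    by unfold_locales (simp_all add: id_functor_def hom_def Dom_in_Obj Cod_in_Obj)
  interpret const: category_functor C C "comp_functor C ?S (to_terminal C)"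
    using K by unfold_locales (simp_all add: comp_functor_def Dom_in_Obj Cod_in_Obj flip: ty_iff_hom)
  interpret TS: category_functor terminal_category terminal_category "comp_functor terminal_category
      (to_terminal C) ?S"
    by unfold_locales (auto simp: hom_def extensional_def)
  interpret idT: category_functor terminal_category terminal_category "id_functor terminal_category"
    by unfold_locales (auto simp: hom_def extensional_def)
  have "natural_isomorphism C C (id_functor C) (comp_functor C ?S (to_terminal C)) (\<lambda>A\<in>Obj C. t A)"
  proof unfold_locales
    fix f assume f: "f \<in> Arr C"
    have ty [simp]: "f \<Ztypecolon> Dom C f \<rightarrow> Cod C f" using f by (rule Arr_ty)
    note [simp] = f K ty_Obj[OF ty]
    show "(\<lambda>A\<in>Obj C. t A) (Cod C f) \<cdot> AMap (id_functor C) f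
        = AMap (comp_functor C ?S (to_terminal C)) f \<cdot> (\<lambda>A\<in>Obj C. t A) (Dom C f)"
      by (rule parallel[of _ "Dom C f" K]) (simp_all add: id_functor_def comp_functor_def)
  qed (auto simp: id_functor_def comp_functor_def intro: iso simp flip: ty_iff_hom)
  moreover have "natural_isomorphism terminal_category terminal_category
      (comp_functor terminal_category (to_terminal C) ?S) (id_functor terminal_category) (\<lambda>_. ())"
    by unfold_locales (auto simp: hom_def extensional_def iso_arr_def inverse_arrows_def)
  ultimately show ?thesis
    unfolding equivalence_of_categories_def using toT S by blast
qed

theorem theoremI7p8p1:
  shows "flat_symmetric_bimonoidal_category Sigma_category \<and>
    (\<forall>C :: ('o, 'm) symmetric_bimonoidal_data.
       flat_symmetric_bimonoidal_category C \<longrightarrow>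
       equivalence_of_categories (robust_hom Sigma_category C) terminal_category
         (to_terminal (robust_hom Sigma_category C)))"
proof (intro conjI allI impI)
  show "flat_symmetric_bimonoidal_category Sigma_category" by (rule Sigma_flat_symmetric_bimonoidal)
next
  fix C :: "('o, 'm) symmetric_bimonoidal_data"
  assume "flat_symmetric_bimonoidal_category C"
  then interpret C: flat_symmetric_bimonoidal_category C .
  interpret H: category "robust_hom Sigma_category C" by (rule category_robust_hom)
  show "equivalence_of_categories (robust_hom Sigma_category C) terminal_category
      (to_terminal (robust_hom Sigma_category C))"
  proof (rule H.equivalence_to_terminal)
    show "C.free_functor \<in> Obj (robust_hom Sigma_category C)" using C.robust_free_functor by simp
    fix F G assume FG: "F \<in> Obj (robust_hom Sigma_category C)" "G \<in> Obj (robust_hom Sigma_category C)"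
    then obtain \<eta> where \<eta>: "bimonoidal_transformation Sigma_category C F G \<eta>"
      and unique: "\<And>\<theta>. bimonoidal_transformation Sigma_category C F G \<theta> \<Longrightarrow> \<theta> = \<eta>"
      using unique_bimonoidal_transformation[of C F G] by auto
    show "\<exists>!f. f \<in> hom (robust_hom Sigma_category C) F G"
    proof (rule ex1I[of _ "(F, \<eta>, G)"])
      show "(F, \<eta>, G) \<in> hom (robust_hom Sigma_category C) F G" using FG \<eta> by (simp add: hom_def)
      show "f = (F, \<eta>, G)" if "f \<in> hom (robust_hom Sigma_category C) F G" for f
        using that unique[of "fst (snd f)"] by (cases f) (auto simp: hom_def)
    qed
  qed
qed

end
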